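(* Let $(\mathcal{C},\otimes,I,\sigma)$ be a symmetric monoidal category that has equalizers, let $\mathsf{BiAlg}_{\mathcal{C},coc}$ be the category of cocommutative bialgebras in $\mathcal{C}$, and let $S_{coc}$ be the class of split extensions of cocommutative bialgebras. Then two $S_{coc}$-equivalence relations on the same object of $\mathsf{BiAlg}_{\mathcal{C},coc}$ centralize each other (in the sense of Smith) if and only if their normalizations commute in the sense of Huq.
   Context: Setting. $(\mathcal{C},\otimes,I,\sigma)$ is a symmetric monoidal category with equalizers (associativity and unit isomorphisms are suppressed); $f\cdot g$ denotes the composite "first $g$, then $f$". Algebras $(A,m,u_A)$ in $\mathcal{C}$ are associative and unital, coalgebras $(C,\Delta,\epsilon_C)$ are coassociative and counital. A bialgebra is an object with an algebra and a coalgebra structure such that $\Delta$ and $\epsilon$ are algebra morphisms; it is cocommutative if $\sigma\cdot\Delta=\Delta$. Morphisms of bialgebras are morphisms in $\mathcal{C}$ that are both algebra and coalgebra morphisms. $\mathsf{BiAlg}_{\mathcal{C},coc}$ (resp. $\mathsf{CoAlg}_{\mathcal{C},coc}$) is the category of cocommutative bialgebras (resp. coalgebras) in $\mathcal{C}$. $\mathsf{BiAlg}_{\mathcal{C},coc}$ is pointed with zero object $I$; the zero morphism $A\to B$ is $u_B\cdot\epsilon_A$. Standing facts on limits. $\mathsf{BiAlg}_{\mathcal{C},coc}$ is finitely complete: the product of $A$ and $B$ is $A\otimes B$ with projections $1_A\otimes\epsilon_B$ and $\epsilon_A\otimes 1_B$; the equalizer of $f,g\colon A\to B$ is carried by the equalizer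 in $\mathcal{C}$ of $(f\otimes 1_A)\cdot\Delta$ and $(g\otimes 1_A)\cdot\Delta\colon A\to B\otimes A$; pullbacks are built from these. The forgetful functor $U\colon\mathsf{BiAlg}_{\mathcal{C},coc}\to\mathsf{CoAlg}_{\mathcal{C},coc}$ has a left adjoint (free algebra functor), so it preserves limits and monomorphisms. Split extensions. A split extension of cocommutative bialgebras consists of cocommutative bialgebras $X,A,B$, bialgebra morphisms $\kappa\colon X\to A$, $\alpha\colon A\to B$, $e\colon B\to A$, and a morphism $\lambda\colon A\to X$ in $\mathcal{C}$ such that: (1) $\lambda\cdot\kappa=1_X$, $\alpha\cdot e=1_B$; (2) $\lambda\cdot e=u_X\cdot\epsilon_B$, $\alpha\cdot\kappa=u_B\cdot\epsilon_X$; (3) $m\cdot((\kappa\cdot\lambda)\otimes(e\cdot\alpha))\cdot\Delta=1_A$; (4) $\lambda\cdot m\cdot(\kappa\otimes e)=1_X\otimes\epsilon_B$; (5) $\lambda$ is a morphism of coalgebras preserving the unit. $S_{coc}$ is the class of split extensions of cocommutative bialgebras; a point $(\alpha,e)$ (split epimorphism with section) belongs to $S_{coc}$ if it can be completed by some $X,\kappa,\lambda$ to a split extension (then $\kappa$ is a kernel of $\alpha$ in $\mathsf{BiAlg}_{\mathcal{C},coc}$). Equivalence relations. An (internal) equivalence relation on $X$ is denoted $(R,r_0,r_1)$, with $r_0,r_1\colon R\to X$ jointly monic and with reflexivity morphism $e_R\colon X\to R$, $r_0e_R=r_1e_R=1_X$. It is an $S_{coc}$-equivalence relation if the point $(r_0,e_R)$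 belongs to $S_{coc}$. Its normalization is the subobject $r_1\cdot\ker(r_0)\colon K\to X$, where $\ker(r_0)\colon K\to R$ is the kernel of $r_0$. Smith centrality. Let $(R,r_0,r_1)$, $(S,s_0,s_1)$ be equivalence relations on $X$ and let $R\times_X S$ be the pullback of $s_0$ along $r_1$; its generalized elements are triples $(x,y,z)$ with $xRy$ and $ySz$. A connector between $R$ and $S$ is a morphism $\hat p\colon R\times_X S\to X$ such that, in terms of generalized elements and whenever the expressions are defined: $x\,S\,\hat p(x,y,z)$ and $z\,R\,\hat p(x,y,z)$; $\hat p(x,x,y)=y$ and $\hat p(x,y,y)=x$; $\hat p(x,y,\hat p(y,u,v))=\hat p(x,u,v)$ and $\hat p(\hat p(x,y,u),u,v)=\hat p(x,y,v)$. $R$ and $S$ centralize each other in the sense of Smith if a connector exists. Huq centrality. Two subobjects $x\colon X\to A$, $y\colon Y\to A$ in $\mathsf{BiAlg}_{\mathcal{C},coc}$ commute in the sense of Huq, written $[X,Y]=0$, if there is a bialgebra morphism $p\colon X\otimes Y\to A$ with $p\cdot(1_X\otimes u_Y)=x$ and $p\cdot(u_X\otimes 1_Y)=y$. *)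

theory Defs
  imports Main
begin

section \<open>Categories\<close>

text \<open>\<open>g \<cdot> f\<close> is the composite ``first \<open>f\<close>, then \<open>g\<close>''; \<open>Dom\<close>, \<open>Cod\<close>, \<open>\<cdot>\<close> are only
  meaningful on (composable) elements of \<open>Arr\<close>.\<close>

record ('o, 'm) category =
  Obj :: "'o set"
  Arr :: "'m set"
  Dom :: "'m \<Rightarrow> 'o"
  Cod :: "'m \<Rightarrow> 'o"
  Ide :: "'o \<Rightarrow> 'm" ("\<one>\<index>")
  Comp :: "'m \<Rightarrow> 'm \<Rightarrow> 'm" (infixr "\<cdot>\<index>" 70)

definition hom :: "('o, 'm, 'z) category_scheme \<Rightarrow> 'o \<Rightarrow> 'o \<Rightarrow> 'm set" where
  "hom C A B = {f \<in> Arr C. Dom C f = A \<and> Cod C f = B}"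

locale category =
  fixes C :: "('o, 'm, 'z) category_scheme" (structure)
  assumes Dom_Obj: "f \<in> Arr C \<Longrightarrow> Dom C f \<in> Obj C"
    and Cod_Obj: "f \<in> Arr C \<Longrightarrow> Cod C f \<in> Obj C"
    and Ide_hom: "A \<in> Obj C \<Longrightarrow> \<one> A \<in> hom C A A"
    and Comp_hom: "\<lbrakk>f \<in> hom C A B; g \<in> hom C B D\<rbrakk> \<Longrightarrow> g \<cdot> f \<in> hom C A D"
    and Ide_right: "f \<in> hom C A B \<Longrightarrow> f \<cdot> \<one> A = f"
    and Ide_left: "f \<in> hom C A B \<Longrightarrow> \<one> B \<cdot> f = f"
    and Comp_assoc: "\<lbrakk>f \<in> hom C A B; g \<in> hom C B D; h \<in> hom C D E\<rbrakk>
          \<Longrightarrow> (h \<cdot> g) \<cdot> f = h \<cdot> (g \<cdot> f)"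

definition inverse_arrows :: "('o, 'm, 'z) category_scheme \<Rightarrow> 'm \<Rightarrow> 'm \<Rightarrow> bool" where
  "inverse_arrows C f g \<longleftrightarrow>
     f \<in> Arr C \<and> g \<in> hom C (Cod C f) (Dom C f) \<and>
     g \<cdot>\<^bsub>C\<^esub> f = \<one>\<^bsub>C\<^esub> (Dom C f) \<and> f \<cdot>\<^bsub>C\<^esub> g = \<one>\<^bsub>C\<^esub> (Cod C f)"

definition iso :: "('o, 'm, 'z) category_scheme \<Rightarrow> 'm \<Rightarrow> bool" where
  "iso C f \<longleftrightarrow> (\<exists>g. inverse_arrows C f g)"

definition inv_arr :: "('o, 'm, 'z) category_scheme \<Rightarrow> 'm \<Rightarrow> 'm" where
  "inv_arr C f = (THE g. inverse_arrows C f g)"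

definition monic :: "('o, 'm, 'z) category_scheme \<Rightarrow> 'm \<Rightarrow> bool" where
  "monic C f \<longleftrightarrow> f \<in> Arr C \<and>
     (\<forall>T. \<forall>a \<in> hom C T (Dom C f). \<forall>b \<in> hom C T (Dom C f). f \<cdot>\<^bsub>C\<^esub> a = f \<cdot>\<^bsub>C\<^esub> b \<longrightarrow> a = b)"

definition is_equalizer :: "('o, 'm, 'z) category_scheme \<Rightarrow> 'm \<Rightarrow> 'm \<Rightarrow> 'm \<Rightarrow> bool" where
  "is_equalizer C f g i \<longleftrightarrow>
     f \<in> Arr C \<and> g \<in> hom C (Dom C f) (Cod C f) \<and>
     i \<in> Arr C \<and> Cod C i = Dom C f \<and> f \<cdot>\<^bsub>C\<^esub> i = g \<cdot>\<^bsub>C\<^esub> i \<and>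
     (\<forall>T. \<forall>h \<in> hom C T (Dom C f). f \<cdot>\<^bsub>C\<^esub> h = g \<cdot>\<^bsub>C\<^esub> h \<longrightarrow>
        (\<exists>!h'. h' \<in> hom C T (Dom C i) \<and> i \<cdot>\<^bsub>C\<^esub> h' = h))"

definition has_equalizers :: "('o, 'm, 'z) category_scheme \<Rightarrow> bool" where
  "has_equalizers C \<longleftrightarrow>
     (\<forall>A B. \<forall>f \<in> hom C A B. \<forall>g \<in> hom C A B. \<exists>i. is_equalizer C f g i)"

definition is_pullback :: "('o, 'm, 'z) category_scheme \<Rightarrow> 'm \<Rightarrow> 'm \<Rightarrow> 'm \<Rightarrow> 'm \<Rightarrow> bool" where
  "is_pullback C f g p q \<longleftrightarrow>
     f \<in> Arr C \<and> g \<in> Arr C \<and> Cod C f = Cod C g \<and>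
     p \<in> Arr C \<and> q \<in> Arr C \<and> Dom C p = Dom C q \<and> Cod C p = Dom C f \<and> Cod C q = Dom C g \<and>
     f \<cdot>\<^bsub>C\<^esub> p = g \<cdot>\<^bsub>C\<^esub> q \<and>
     (\<forall>T. \<forall>a \<in> hom C T (Dom C f). \<forall>b \<in> hom C T (Dom C g). f \<cdot>\<^bsub>C\<^esub> a = g \<cdot>\<^bsub>C\<^esub> b \<longrightarrow>
        (\<exists>!t. t \<in> hom C T (Dom C p) \<and> p \<cdot>\<^bsub>C\<^esub> t = a \<and> q \<cdot>\<^bsub>C\<^esub> t = b))"


section \<open>Internal equivalence relations and Smith centrality\<close>

text \<open>A relation on \<open>X\<close> is given by its two legs \<open>r0, r1 : R \<rightarrow> X\<close>; the object \<open>R\<close> is \<open>Dom C r0\<close>.\<close>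

definition is_relation :: "('o, 'm, 'z) category_scheme \<Rightarrow> 'o \<Rightarrow> 'm \<Rightarrow> 'm \<Rightarrow> bool" where
  "is_relation C X r0 r1 \<longleftrightarrow>
     r0 \<in> hom C (Dom C r0) X \<and> r1 \<in> hom C (Dom C r0) X \<and>
     (\<forall>T. \<forall>a \<in> hom C T (Dom C r0). \<forall>b \<in> hom C T (Dom C r0).
        r0 \<cdot>\<^bsub>C\<^esub> a = r0 \<cdot>\<^bsub>C\<^esub> b \<and> r1 \<cdot>\<^bsub>C\<^esub> a = r1 \<cdot>\<^bsub>C\<^esub> b \<longrightarrow> a = b)"

definition reflexivity :: "('o, 'm, 'z) category_scheme \<Rightarrow> 'o \<Rightarrow> 'm \<Rightarrow> 'm \<Rightarrow> 'm \<Rightarrow> bool" where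
  "reflexivity C X r0 r1 e \<longleftrightarrow>
     e \<in> hom C X (Dom C r0) \<and> r0 \<cdot>\<^bsub>C\<^esub> e = \<one>\<^bsub>C\<^esub> X \<and> r1 \<cdot>\<^bsub>C\<^esub> e = \<one>\<^bsub>C\<^esub> X"

text \<open>Generalized elements \<open>x, y : T \<rightarrow> X\<close> are related when \<open>(x, y)\<close> factors through \<open>(r0, r1)\<close>.\<close>

definition related :: "('o, 'm, 'z) category_scheme \<Rightarrow> 'm \<Rightarrow> 'm \<Rightarrow> 'm \<Rightarrow> 'm \<Rightarrow> bool" where
  "related C r0 r1 x y \<longleftrightarrow>
     (\<exists>a \<in> hom C (Dom C x) (Dom C r0). r0 \<cdot>\<^bsub>C\<^esub> a = x \<and> r1 \<cdot>\<^bsub>C\<^esub> a = y)"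

text \<open>Transitivity is stated on generalized elements; this is the existence of the usual morphism
  \<open>R \<times>\<^sub>X R \<rightarrow> R\<close> whenever the pullback \<open>R \<times>\<^sub>X R\<close> exists.\<close>

definition is_equivalence_relation ::
  "('o, 'm, 'z) category_scheme \<Rightarrow> 'o \<Rightarrow> 'm \<Rightarrow> 'm \<Rightarrow> bool" where
  "is_equivalence_relation C X r0 r1 \<longleftrightarrow>
     is_relation C X r0 r1 \<and>
     (\<exists>e. reflexivity C X r0 r1 e) \<and>
     (\<exists>s \<in> hom C (Dom C r0) (Dom C r0). r0 \<cdot>\<^bsub>C\<^esub> s = r1 \<and> r1 \<cdot>\<^bsub>C\<^esub> s = r0) \<and>
     (\<forall>T. \<forall>x \<in> hom C T X. \<forall>y \<in> hom C T X. \<forall>z \<in> hom C T X.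
        related C r0 r1 x y \<and> related C r0 r1 y z \<longrightarrow> related C r0 r1 x z)"

text \<open>With \<open>pR, pS\<close> the projections of \<open>R \<times>\<^sub>X S\<close>, the generalized element \<open>t : T \<rightarrow> R \<times>\<^sub>X S\<close> is the
  triple \<open>(x, y, z)\<close>, where \<open>x R y\<close> and \<open>y S z\<close>.\<close>

definition is_triple ::
  "('o, 'm, 'z) category_scheme \<Rightarrow> 'm \<Rightarrow> 'm \<Rightarrow> 'm \<Rightarrow> 'm \<Rightarrow> 'm \<Rightarrow> 'm \<Rightarrow> 'o \<Rightarrow> 'm \<Rightarrow> 'm \<Rightarrow> 'm \<Rightarrow> 'm \<Rightarrow> bool"
  where
  "is_triple C r0 r1 s0 s1 pR pS T t x y z \<longleftrightarrow>
     t \<in> hom C T (Dom C pR) \<and>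
     r0 \<cdot>\<^bsub>C\<^esub> pR \<cdot>\<^bsub>C\<^esub> t = x \<and> r1 \<cdot>\<^bsub>C\<^esub> pR \<cdot>\<^bsub>C\<^esub> t = y \<and> s0 \<cdot>\<^bsub>C\<^esub> pS \<cdot>\<^bsub>C\<^esub> t = y \<and> s1 \<cdot>\<^bsub>C\<^esub> pS \<cdot>\<^bsub>C\<^esub> t = z"

text \<open>If \<open>t\<close> is the triple \<open>(x, y, z)\<close> then \<open>p \<cdot> t\<close> is \<open>p(x, y, z)\<close>.  In the last two clauses the
  triples \<open>t1, t2, t3\<close> are the arguments of the inner operation, the outer operation and the
  right-hand side, respectively.\<close>

definition is_connector ::
  "('o, 'm, 'z) category_scheme \<Rightarrow> 'm \<Rightarrow> 'm \<Rightarrow> 'm \<Rightarrow> 'm \<Rightarrow> 'm \<Rightarrow> 'm \<Rightarrow> 'm \<Rightarrow> bool" where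
  "is_connector C r0 r1 s0 s1 pR pS p \<longleftrightarrow>
     (let trip = is_triple C r0 r1 s0 s1 pR pS in
      p \<in> hom C (Dom C pR) (Cod C r0) \<and>
      (\<forall>T t x y z. trip T t x y z \<longrightarrow>
         related C s0 s1 x (p \<cdot>\<^bsub>C\<^esub> t) \<and> related C r0 r1 z (p \<cdot>\<^bsub>C\<^esub> t)) \<and>
      (\<forall>T t x y. trip T t x x y \<longrightarrow> p \<cdot>\<^bsub>C\<^esub> t = y) \<and>
      (\<forall>T t x y. trip T t x y y \<longrightarrow> p \<cdot>\<^bsub>C\<^esub> t = x) \<and>
      (\<forall>T t1 t2 t3 x y u v.
         trip T t1 y u v \<and> trip T t2 x y (p \<cdot>\<^bsub>C\<^esub> t1) \<and> trip T t3 x u v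
         \<longrightarrow> p \<cdot>\<^bsub>C\<^esub> t2 = p \<cdot>\<^bsub>C\<^esub> t3) \<and>
      (\<forall>T t1 t2 t3 x y u v.
         trip T t1 x y u \<and> trip T t2 (p \<cdot>\<^bsub>C\<^esub> t1) u v \<and> trip T t3 x y v
         \<longrightarrow> p \<cdot>\<^bsub>C\<^esub> t2 = p \<cdot>\<^bsub>C\<^esub> t3))"

definition smith_centralize ::
  "('o, 'm, 'z) category_scheme \<Rightarrow> 'm \<Rightarrow> 'm \<Rightarrow> 'm \<Rightarrow> 'm \<Rightarrow> bool" where
  "smith_centralize C r0 r1 s0 s1 \<longleftrightarrow>
     (\<exists>pR pS p. is_pullback C r1 s0 pR pS \<and> is_connector C r0 r1 s0 s1 pR pS p)"


section \<open>Symmetric monoidal categories\<close>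

record ('o, 'm) monoidal_category = "('o, 'm) category" +
  tens_ob :: "'o \<Rightarrow> 'o \<Rightarrow> 'o" (infixr "\<odot>\<index>" 75)
  tens :: "'m \<Rightarrow> 'm \<Rightarrow> 'm" (infixr "\<otimes>\<index>" 75)
  unit_ob :: 'o ("\<I>\<index>")
  assoc :: "'o \<Rightarrow> 'o \<Rightarrow> 'o \<Rightarrow> 'm"
  lunit :: "'o \<Rightarrow> 'm"
  runit :: "'o \<Rightarrow> 'm"
  braid :: "'o \<Rightarrow> 'o \<Rightarrow> 'm"

locale symmetric_monoidal_category = category C
  for C :: "('o, 'm, 'z) monoidal_category_scheme" (structure) +
  assumes unit_Obj: "\<I> \<in> Obj C"
    and tens_Obj: "\<lbrakk>A \<in> Obj C; B \<in> Obj C\<rbrakk> \<Longrightarrow> A \<odot> B \<in> Obj C"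
    and tens_hom: "\<lbrakk>f \<in> hom C A A'; g \<in> hom C B B'\<rbrakk> \<Longrightarrow> f \<otimes> g \<in> hom C (A \<odot> B) (A' \<odot> B')"
    and tens_Ide: "\<lbrakk>A \<in> Obj C; B \<in> Obj C\<rbrakk> \<Longrightarrow> \<one> A \<otimes> \<one> B = \<one> (A \<odot> B)"
    and tens_Comp: "\<lbrakk>f \<in> hom C A A'; f' \<in> hom C A' A''; g \<in> hom C B B'; g' \<in> hom C B' B''\<rbrakk>
          \<Longrightarrow> (f' \<cdot> f) \<otimes> (g' \<cdot> g) = (f' \<otimes> g') \<cdot> (f \<otimes> g)"
    and assoc_hom: "\<lbrakk>A \<in> Obj C; B \<in> Obj C; D \<in> Obj C\<rbrakk>
          \<Longrightarrow> assoc C A B D \<in> hom C ((A \<odot> B) \<odot> D) (A \<odot> (B \<odot> D))"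
    and assoc_iso: "\<lbrakk>A \<in> Obj C; B \<in> Obj C; D \<in> Obj C\<rbrakk> \<Longrightarrow> iso C (assoc C A B D)"
    and assoc_natural: "\<lbrakk>f \<in> hom C A A'; g \<in> hom C B B'; h \<in> hom C D D'\<rbrakk>
          \<Longrightarrow> assoc C A' B' D' \<cdot> ((f \<otimes> g) \<otimes> h) = (f \<otimes> (g \<otimes> h)) \<cdot> assoc C A B D"
    and lunit_hom: "A \<in> Obj C \<Longrightarrow> lunit C A \<in> hom C (\<I> \<odot> A) A"
    and lunit_iso: "A \<in> Obj C \<Longrightarrow> iso C (lunit C A)"
    and lunit_natural: "f \<in> hom C A B \<Longrightarrow> lunit C B \<cdot> (\<one> \<I> \<otimes> f) = f \<cdot> lunit C A"
    and runit_hom: "A \<in> Obj C \<Longrightarrow> runit C A \<in> hom C (A \<odot> \<I>) A"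
    and runit_iso: "A \<in> Obj C \<Longrightarrow> iso C (runit C A)"
    and runit_natural: "f \<in> hom C A B \<Longrightarrow> runit C B \<cdot> (f \<otimes> \<one> \<I>) = f \<cdot> runit C A"
    and braid_hom: "\<lbrakk>A \<in> Obj C; B \<in> Obj C\<rbrakk> \<Longrightarrow> braid C A B \<in> hom C (A \<odot> B) (B \<odot> A)"
    and braid_natural: "\<lbrakk>f \<in> hom C A A'; g \<in> hom C B B'\<rbrakk>
          \<Longrightarrow> braid C A' B' \<cdot> (f \<otimes> g) = (g \<otimes> f) \<cdot> braid C A B"
    and pentagon: "\<lbrakk>A \<in> Obj C; B \<in> Obj C; D \<in> Obj C; E \<in> Obj C\<rbrakk>
          \<Longrightarrow> assoc C A B (D \<odot> E) \<cdot> assoc C (A \<odot> B) D E =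
              (\<one> A \<otimes> assoc C B D E) \<cdot> assoc C A (B \<odot> D) E \<cdot> (assoc C A B D \<otimes> \<one> E)"
    and triangle: "\<lbrakk>A \<in> Obj C; B \<in> Obj C\<rbrakk>
          \<Longrightarrow> (\<one> A \<otimes> lunit C B) \<cdot> assoc C A \<I> B = runit C A \<otimes> \<one> B"
    and hexagon: "\<lbrakk>A \<in> Obj C; B \<in> Obj C; D \<in> Obj C\<rbrakk>
          \<Longrightarrow> assoc C B D A \<cdot> braid C A (B \<odot> D) \<cdot> assoc C A B D =
              (\<one> B \<otimes> braid C A D) \<cdot> assoc C B A D \<cdot> (braid C A B \<otimes> \<one> D)"
    and symmetry: "\<lbrakk>A \<in> Obj C; B \<in> Obj C\<rbrakk> \<Longrightarrow> braid C B A \<cdot> braid C A B = \<one> (A \<odot> B)"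

text \<open>The morphism \<open>1 \<otimes> \<sigma> \<otimes> 1 : (A \<otimes> B) \<otimes> (D \<otimes> E) \<rightarrow> (A \<otimes> D) \<otimes> (B \<otimes> E)\<close>, with the associativity
  isomorphisms written out.\<close>

definition interchange ::
  "('o, 'm, 'z) monoidal_category_scheme \<Rightarrow> 'o \<Rightarrow> 'o \<Rightarrow> 'o \<Rightarrow> 'o \<Rightarrow> 'm" where
  "interchange C A B D E =
     inv_arr C (assoc C A D (B \<odot>\<^bsub>C\<^esub> E)) \<cdot>\<^bsub>C\<^esub>
     (\<one>\<^bsub>C\<^esub> A \<otimes>\<^bsub>C\<^esub>
        (assoc C D B E \<cdot>\<^bsub>C\<^esub> (braid C B D \<otimes>\<^bsub>C\<^esub> \<one>\<^bsub>C\<^esub> E) \<cdot>\<^bsub>C\<^esub> inv_arr C (assoc C B D E))) \<cdot>\<^bsub>C\<^esub>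
     assoc C A B (D \<odot>\<^bsub>C\<^esub> E)"


section \<open>Algebras, coalgebras and bialgebras\<close>

datatype ('o, 'm) algebra = Algebra (alg_ob: 'o) (alg_mult: 'm) (alg_unit: 'm)

datatype ('o, 'm) coalgebra = Coalgebra (coalg_ob: 'o) (coalg_comult: 'm) (coalg_counit: 'm)

datatype ('o, 'm) bialgebra = Bialgebra (bi_alg: "('o, 'm) algebra") (bi_coalg: "('o, 'm) coalgebra")

abbreviation ob :: "('o, 'm) bialgebra \<Rightarrow> 'o" where "ob A \<equiv> alg_ob (bi_alg A)"
abbreviation mult :: "('o, 'm) bialgebra \<Rightarrow> 'm" where "mult A \<equiv> alg_mult (bi_alg A)"
abbreviation unt :: "('o, 'm) bialgebra \<Rightarrow> 'm" where "unt A \<equiv> alg_unit (bi_alg A)"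
abbreviation comult :: "('o, 'm) bialgebra \<Rightarrow> 'm" where "comult A \<equiv> coalg_comult (bi_coalg A)"
abbreviation counit :: "('o, 'm) bialgebra \<Rightarrow> 'm" where "counit A \<equiv> coalg_counit (bi_coalg A)"

definition is_algebra ::
  "('o, 'm, 'z) monoidal_category_scheme \<Rightarrow> ('o, 'm) algebra \<Rightarrow> bool" where
  "is_algebra C M \<longleftrightarrow>
     (let A = alg_ob M; m = alg_mult M; u = alg_unit M in
      A \<in> Obj C \<and> m \<in> hom C (A \<odot>\<^bsub>C\<^esub> A) A \<and> u \<in> hom C \<I>\<^bsub>C\<^esub> A \<and>
      m \<cdot>\<^bsub>C\<^esub> (m \<otimes>\<^bsub>C\<^esub> \<one>\<^bsub>C\<^esub> A) = m \<cdot>\<^bsub>C\<^esub> (\<one>\<^bsub>C\<^esub> A \<otimes>\<^bsub>C\<^esub> m) \<cdot>\<^bsub>C\<^esub> assoc C A A A \<and>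
      m \<cdot>\<^bsub>C\<^esub> (u \<otimes>\<^bsub>C\<^esub> \<one>\<^bsub>C\<^esub> A) = lunit C A \<and>
      m \<cdot>\<^bsub>C\<^esub> (\<one>\<^bsub>C\<^esub> A \<otimes>\<^bsub>C\<^esub> u) = runit C A)"

definition is_coalgebra ::
  "('o, 'm, 'z) monoidal_category_scheme \<Rightarrow> ('o, 'm) coalgebra \<Rightarrow> bool" where
  "is_coalgebra C M \<longleftrightarrow>
     (let A = coalg_ob M; d = coalg_comult M; c = coalg_counit M in
      A \<in> Obj C \<and> d \<in> hom C A (A \<odot>\<^bsub>C\<^esub> A) \<and> c \<in> hom C A \<I>\<^bsub>C\<^esub> \<and>
      assoc C A A A \<cdot>\<^bsub>C\<^esub> (d \<otimes>\<^bsub>C\<^esub> \<one>\<^bsub>C\<^esub> A) \<cdot>\<^bsub>C\<^esub> d = (\<one>\<^bsub>C\<^esub> A \<otimes>\<^bsub>C\<^esub> d) \<cdot>\<^bsub>C\<^esub> d \<and>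
      lunit C A \<cdot>\<^bsub>C\<^esub> (c \<otimes>\<^bsub>C\<^esub> \<one>\<^bsub>C\<^esub> A) \<cdot>\<^bsub>C\<^esub> d = \<one>\<^bsub>C\<^esub> A \<and>
      runit C A \<cdot>\<^bsub>C\<^esub> (\<one>\<^bsub>C\<^esub> A \<otimes>\<^bsub>C\<^esub> c) \<cdot>\<^bsub>C\<^esub> d = \<one>\<^bsub>C\<^esub> A)"

definition is_cocommutative ::
  "('o, 'm, 'z) monoidal_category_scheme \<Rightarrow> ('o, 'm) coalgebra \<Rightarrow> bool" where
  "is_cocommutative C M \<longleftrightarrow>
     braid C (coalg_ob M) (coalg_ob M) \<cdot>\<^bsub>C\<^esub> coalg_comult M = coalg_comult M"

definition alg_morphism ::
  "('o, 'm, 'z) monoidal_category_scheme \<Rightarrow> ('o, 'm) algebra \<Rightarrow> ('o, 'm) algebra \<Rightarrow> 'm \<Rightarrow> bool" where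
  "alg_morphism C M N f \<longleftrightarrow>
     f \<in> hom C (alg_ob M) (alg_ob N) \<and>
     f \<cdot>\<^bsub>C\<^esub> alg_mult M = alg_mult N \<cdot>\<^bsub>C\<^esub> (f \<otimes>\<^bsub>C\<^esub> f) \<and>
     f \<cdot>\<^bsub>C\<^esub> alg_unit M = alg_unit N"

definition coalg_morphism ::
  "('o, 'm, 'z) monoidal_category_scheme \<Rightarrow> ('o, 'm) coalgebra \<Rightarrow> ('o, 'm) coalgebra \<Rightarrow> 'm \<Rightarrow> bool"
  where
  "coalg_morphism C M N f \<longleftrightarrow>
     f \<in> hom C (coalg_ob M) (coalg_ob N) \<and>
     coalg_comult N \<cdot>\<^bsub>C\<^esub> f = (f \<otimes>\<^bsub>C\<^esub> f) \<cdot>\<^bsub>C\<^esub> coalg_comult M \<and>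
     coalg_counit N \<cdot>\<^bsub>C\<^esub> f = coalg_counit M"

definition unit_alg :: "('o, 'm, 'z) monoidal_category_scheme \<Rightarrow> ('o, 'm) algebra" where
  "unit_alg C = Algebra \<I>\<^bsub>C\<^esub> (lunit C \<I>\<^bsub>C\<^esub>) (\<one>\<^bsub>C\<^esub> \<I>\<^bsub>C\<^esub>)"

definition tensor_alg ::
  "('o, 'm, 'z) monoidal_category_scheme \<Rightarrow> ('o, 'm) algebra \<Rightarrow> ('o, 'm) algebra \<Rightarrow> ('o, 'm) algebra"
  where
  "tensor_alg C M N =
     (let A = alg_ob M; B = alg_ob N in
      Algebra (A \<odot>\<^bsub>C\<^esub> B)
        ((alg_mult M \<otimes>\<^bsub>C\<^esub> alg_mult N) \<cdot>\<^bsub>C\<^esub> interchange C A B A B)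
        ((alg_unit M \<otimes>\<^bsub>C\<^esub> alg_unit N) \<cdot>\<^bsub>C\<^esub> inv_arr C (lunit C \<I>\<^bsub>C\<^esub>)))"

definition tensor_coalg ::
  "('o, 'm, 'z) monoidal_category_scheme \<Rightarrow> ('o, 'm) coalgebra \<Rightarrow> ('o, 'm) coalgebra \<Rightarrow>
   ('o, 'm) coalgebra" where
  "tensor_coalg C M N =
     (let A = coalg_ob M; B = coalg_ob N in
      Coalgebra (A \<odot>\<^bsub>C\<^esub> B)
        (interchange C A A B B \<cdot>\<^bsub>C\<^esub> (coalg_comult M \<otimes>\<^bsub>C\<^esub> coalg_comult N))
        (lunit C \<I>\<^bsub>C\<^esub> \<cdot>\<^bsub>C\<^esub> (coalg_counit M \<otimes>\<^bsub>C\<^esub> coalg_counit N)))"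

definition tensor_bialg ::
  "('o, 'm, 'z) monoidal_category_scheme \<Rightarrow> ('o, 'm) bialgebra \<Rightarrow> ('o, 'm) bialgebra \<Rightarrow>
   ('o, 'm) bialgebra" where
  "tensor_bialg C A B =
     Bialgebra (tensor_alg C (bi_alg A) (bi_alg B)) (tensor_coalg C (bi_coalg A) (bi_coalg B))"

definition is_bialgebra ::
  "('o, 'm, 'z) monoidal_category_scheme \<Rightarrow> ('o, 'm) bialgebra \<Rightarrow> bool" where
  "is_bialgebra C A \<longleftrightarrow>
     alg_ob (bi_alg A) = coalg_ob (bi_coalg A) \<and>
     is_algebra C (bi_alg A) \<and> is_coalgebra C (bi_coalg A) \<and>
     alg_morphism C (bi_alg A) (tensor_alg C (bi_alg A) (bi_alg A)) (comult A) \<and>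
     alg_morphism C (bi_alg A) (unit_alg C) (counit A)"

definition bialg_morphism ::
  "('o, 'm, 'z) monoidal_category_scheme \<Rightarrow> ('o, 'm) bialgebra \<Rightarrow> ('o, 'm) bialgebra \<Rightarrow> 'm \<Rightarrow> bool"
  where
  "bialg_morphism C A B f \<longleftrightarrow>
     alg_morphism C (bi_alg A) (bi_alg B) f \<and> coalg_morphism C (bi_coalg A) (bi_coalg B) f"


section \<open>The categories of cocommutative coalgebras and bialgebras\<close>

text \<open>A morphism of structured objects is a morphism of \<open>C\<close> together with its source and target.\<close>

datatype ('s, 'm) struct_arr = SArr (src: 's) (tgt: 's) (und: 'm)

definition CoAlg_coc ::
  "('o, 'm, 'z) monoidal_category_scheme \<Rightarrow>
   (('o, 'm) coalgebra, (('o, 'm) coalgebra, 'm) struct_arr) category" where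
  "CoAlg_coc C =
     (let Ob = {A. is_coalgebra C A \<and> is_cocommutative C A} in
      \<lparr>Obj = Ob,
       Arr = {f. src f \<in> Ob \<and> tgt f \<in> Ob \<and> coalg_morphism C (src f) (tgt f) (und f)},
       Dom = src, Cod = tgt,
       Ide = (\<lambda>A. SArr A A (\<one>\<^bsub>C\<^esub> (coalg_ob A))),
       Comp = (\<lambda>g f. SArr (src f) (tgt g) (und g \<cdot>\<^bsub>C\<^esub> und f))\<rparr>)"

definition BiAlg_coc ::
  "('o, 'm, 'z) monoidal_category_scheme \<Rightarrow>
   (('o, 'm) bialgebra, (('o, 'm) bialgebra, 'm) struct_arr) category" where
  "BiAlg_coc C =
     (let Ob = {A. is_bialgebra C A \<and> is_cocommutative C (bi_coalg A)} in
      \<lparr>Obj = Ob,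
       Arr = {f. src f \<in> Ob \<and> tgt f \<in> Ob \<and> bialg_morphism C (src f) (tgt f) (und f)},
       Dom = src, Cod = tgt,
       Ide = (\<lambda>A. SArr A A (\<one>\<^bsub>C\<^esub> (ob A))),
       Comp = (\<lambda>g f. SArr (src f) (tgt g) (und g \<cdot>\<^bsub>C\<^esub> und f))\<rparr>)"

text \<open>The action on morphisms of the forgetful functor \<open>U : BiAlg_coc C \<rightarrow> CoAlg_coc C\<close>.\<close>

definition forget :: "(('o, 'm) bialgebra, 'm) struct_arr \<Rightarrow> (('o, 'm) coalgebra, 'm) struct_arr" where
  "forget f = SArr (bi_coalg (src f)) (bi_coalg (tgt f)) (und f)"

text \<open>This standing fact about \<open>U\<close> follows if \<open>U\<close> has a left adjoint (the free algebra functor), and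
  also if the equalizer of \<open>f, g : A \<rightarrow> B\<close> in \<open>BiAlg_coc C\<close> is carried by the equalizer in \<open>C\<close> of
  \<open>(f \<otimes> 1) \<cdot> \<Delta>\<close> and \<open>(g \<otimes> 1) \<cdot> \<Delta>\<close>.  It is not a consequence of the existence of equalizers
  in \<open>C\<close> alone, since \<open>\<otimes>\<close> need not preserve them.\<close>

definition forget_preserves_monos :: "('o, 'm, 'z) monoidal_category_scheme \<Rightarrow> bool" where
  "forget_preserves_monos C \<longleftrightarrow>
     (\<forall>f. monic (BiAlg_coc C) f \<longrightarrow> monic (CoAlg_coc C) (forget f))"

definition zero_mor ::
  "('o, 'm, 'z) monoidal_category_scheme \<Rightarrow> ('o, 'm) bialgebra \<Rightarrow> ('o, 'm) bialgebra \<Rightarrow>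
   (('o, 'm) bialgebra, 'm) struct_arr" where
  "zero_mor C A B = SArr A B (unt B \<cdot>\<^bsub>C\<^esub> counit A)"

definition is_kernel ::
  "('o, 'm, 'z) monoidal_category_scheme \<Rightarrow> (('o, 'm) bialgebra, 'm) struct_arr \<Rightarrow>
   (('o, 'm) bialgebra, 'm) struct_arr \<Rightarrow> bool" where
  "is_kernel C f k \<longleftrightarrow> is_equalizer (BiAlg_coc C) f (zero_mor C (src f) (tgt f)) k"


section \<open>Split extensions and equivalence relations of cocommutative bialgebras\<close>

definition split_extension ::
  "('o, 'm, 'z) monoidal_category_scheme \<Rightarrow>
   ('o, 'm) bialgebra \<Rightarrow> ('o, 'm) bialgebra \<Rightarrow> ('o, 'm) bialgebra \<Rightarrow>
   (('o, 'm) bialgebra, 'm) struct_arr \<Rightarrow> (('o, 'm) bialgebra, 'm) struct_arr \<Rightarrow>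
   (('o, 'm) bialgebra, 'm) struct_arr \<Rightarrow> 'm \<Rightarrow> bool" where
  "split_extension C X A B \<kappa> \<alpha> e l \<longleftrightarrow>
     \<kappa> \<in> hom (BiAlg_coc C) X A \<and> \<alpha> \<in> hom (BiAlg_coc C) A B \<and> e \<in> hom (BiAlg_coc C) B A \<and>
     l \<in> hom C (ob A) (ob X) \<and>
     l \<cdot>\<^bsub>C\<^esub> und \<kappa> = \<one>\<^bsub>C\<^esub> (ob X) \<and>
     und \<alpha> \<cdot>\<^bsub>C\<^esub> und e = \<one>\<^bsub>C\<^esub> (ob B) \<and>
     l \<cdot>\<^bsub>C\<^esub> und e = unt X \<cdot>\<^bsub>C\<^esub> counit B \<and>
     und \<alpha> \<cdot>\<^bsub>C\<^esub> und \<kappa> = unt B \<cdot>\<^bsub>C\<^esub> counit X \<and>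
     mult A \<cdot>\<^bsub>C\<^esub> ((und \<kappa> \<cdot>\<^bsub>C\<^esub> l) \<otimes>\<^bsub>C\<^esub> (und e \<cdot>\<^bsub>C\<^esub> und \<alpha>)) \<cdot>\<^bsub>C\<^esub> comult A = \<one>\<^bsub>C\<^esub> (ob A) \<and>
     l \<cdot>\<^bsub>C\<^esub> mult A \<cdot>\<^bsub>C\<^esub> (und \<kappa> \<otimes>\<^bsub>C\<^esub> und e)
       = runit C (ob X) \<cdot>\<^bsub>C\<^esub> (\<one>\<^bsub>C\<^esub> (ob X) \<otimes>\<^bsub>C\<^esub> counit B) \<and>
     coalg_morphism C (bi_coalg A) (bi_coalg X) l \<and>
     l \<cdot>\<^bsub>C\<^esub> unt A = unt X"

definition in_S_coc ::
  "('o, 'm, 'z) monoidal_category_scheme \<Rightarrow> (('o, 'm) bialgebra, 'm) struct_arr \<Rightarrow>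
   (('o, 'm) bialgebra, 'm) struct_arr \<Rightarrow> bool" where
  "in_S_coc C \<alpha> e \<longleftrightarrow> (\<exists>X \<kappa> l. split_extension C X (src \<alpha>) (tgt \<alpha>) \<kappa> \<alpha> e l)"

definition S_coc_equivalence_relation ::
  "('o, 'm, 'z) monoidal_category_scheme \<Rightarrow> ('o, 'm) bialgebra \<Rightarrow>
   (('o, 'm) bialgebra, 'm) struct_arr \<Rightarrow> (('o, 'm) bialgebra, 'm) struct_arr \<Rightarrow> bool" where
  "S_coc_equivalence_relation C X r0 r1 \<longleftrightarrow>
     is_equivalence_relation (BiAlg_coc C) X r0 r1 \<and>
     (\<exists>e. reflexivity (BiAlg_coc C) X r0 r1 e \<and> in_S_coc C r0 e)"

text \<open>Normalizations are determined up to isomorphism, by the choice of a kernel of \<open>r0\<close>.\<close>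

definition is_normalization ::
  "('o, 'm, 'z) monoidal_category_scheme \<Rightarrow> (('o, 'm) bialgebra, 'm) struct_arr \<Rightarrow>
   (('o, 'm) bialgebra, 'm) struct_arr \<Rightarrow> (('o, 'm) bialgebra, 'm) struct_arr \<Rightarrow> bool" where
  "is_normalization C r0 r1 n \<longleftrightarrow> (\<exists>k. is_kernel C r0 k \<and> n = r1 \<cdot>\<^bsub>BiAlg_coc C\<^esub> k)"

definition huq_commute ::
  "('o, 'm, 'z) monoidal_category_scheme \<Rightarrow> (('o, 'm) bialgebra, 'm) struct_arr \<Rightarrow>
   (('o, 'm) bialgebra, 'm) struct_arr \<Rightarrow> bool" where
  "huq_commute C x y \<longleftrightarrow>
     (let X = src x; Y = src y in
      \<exists>p \<in> hom (BiAlg_coc C) (tensor_bialg C X Y) (tgt x).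
        und p \<cdot>\<^bsub>C\<^esub> (\<one>\<^bsub>C\<^esub> (ob X) \<otimes>\<^bsub>C\<^esub> unt Y) \<cdot>\<^bsub>C\<^esub> inv_arr C (runit C (ob X)) = und x \<and>
        und p \<cdot>\<^bsub>C\<^esub> (unt X \<otimes>\<^bsub>C\<^esub> \<one>\<^bsub>C\<^esub> (ob Y)) \<cdot>\<^bsub>C\<^esub> inv_arr C (lunit C (ob Y)) = und y)"

end

theory Submission
  imports Defs
begin

text \<open>
  The tensor product makes cocommutative coalgebras a cartesian category, and cocommutative
  bialgebras are the monoids in it.  Hence for every cocommutative coalgebra \<open>T\<close> the coalgebra
  morphisms from \<open>T\<close> to a bialgebra form a monoid under convolution, and by the Yoneda lemma every
  question reduces to these monoids of generalized elements.  As the splitting \<open>\<lambda>\<close> of a split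
  extension is a coalgebra morphism, an \<open>S\<^sub>c\<^sub>o\<^sub>c\<close>-equivalence relation becomes a Schreier congruence:
  \<open>x R y\<close> iff \<open>y = a x\<close> for a unique \<open>a\<close> in the normalization.

  A connector \<open>p\<close> gives the Huq morphism \<open>(a, b) \<mapsto> p(a, 1, b)\<close>.  Conversely, if the normalizations
  commute, \<open>p(x, y, z) = w z\<close> with \<open>x = w y\<close> is a connector.  Preservation of monomorphisms by the
  forgetful functor provides the joint monicity of the legs of a relation on coalgebra morphisms,
  so that \<open>w\<close> is unique.
\<close>

section \<open>Monoidal coherence\<close>

text \<open>The Schreier decomposition supplies the missing quotient: decomposing the reversed pair
  \<open>(y, x)\<close> writes \<open>x\<close> as a left multiple \<open>w y\<close>. As
  \<open>l\<close> is only a coalgebra morphism and nothing can be cancelled, the crux is that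
  \<open>w z\<close> respects products. If \<open>w'\<close> is the quotient of a second pair, then
  decomposing the pair \<open>(y, y w')\<close> gives \<open>y w' = c y\<close> with
  \<open>c\<close> in the normalization of \<open>R\<close>. Writing \<open>z = v y\<close> with
  \<open>v\<close> in the normalization of \<open>S\<close>, commutation yields
  \<open>c z = v c y = v y w' = z w'\<close>, which is the exchange that multiplicativity requires.

  Elements are coalgebra morphisms, while relations, pullbacks and connectors are internal to
  bialgebras. Two devices bridge the gap: bialgebra laws and multiplicativity are reflected along
  jointly monic pairs, and the pullback is constructed explicitly from the splitting. The
  associativity isomorphisms are part of the data, so the cartesian structure has to be derived from
  the coherence axioms.\<close>

context category
begin

section \<open>Composition, isomorphisms and cancellation\<close>

lemma Comp_typing [simp]:
  assumes "f \<in> Arr C" "g \<in> Arr C" "Dom C g = Cod C f"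
  shows "g \<cdot> f \<in> Arr C" "Dom C (g \<cdot> f) = Dom C f" "Cod C (g \<cdot> f) = Cod C g"
  using Comp_hom[of f "Dom C f" "Cod C f" g "Cod C g"] assms by (simp_all add: hom_def)

lemma Ide_typing [simp]:
  assumes "A \<in> Obj C"
  shows "\<one> A \<in> Arr C" "Dom C (\<one> A) = A" "Cod C (\<one> A) = A"
  using Ide_hom[OF assms] by (simp_all add: hom_def)

lemma Comp_Ide [simp]:
  assumes "f \<in> Arr C"
  shows "Dom C f = A \<Longrightarrow> f \<cdot> \<one> A = f" "Cod C f = B \<Longrightarrow> \<one> B \<cdot> f = f"
  using Ide_left[of f "Dom C f" "Cod C f"] Ide_right[of f "Dom C f" "Cod C f"] assms
  by (simp_all add: hom_def)

lemma Comp_assoc' [simp]: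
  assumes "f \<in> Arr C" "g \<in> Arr C" "h \<in> Arr C" "Dom C g = Cod C f" "Dom C h = Cod C g"
  shows "(h \<cdot> g) \<cdot> f = h \<cdot> (g \<cdot> f)"
  using Comp_assoc[of f "Dom C f" "Cod C f" g "Cod C g" h "Cod C h"] assms by (simp add: hom_def)

text \<open>Composites are kept right-bracketed, so a rule with left-hand side
  \<open>f \<cdot> g\<close> no longer matches once something is composed before \<open>g\<close>.
  This is the form of such a rule that rewrites inside a longer chain.\<close>

lemma Comp_eq_extend:
  assumes "f \<cdot> g = h" "f \<in> Arr C" "g \<in> Arr C" "z \<in> Arr C" "Dom C f = Cod C g" "Dom C g = Cod C z"
  shows "f \<cdot> (g \<cdot> z) = h \<cdot> z"
  using Comp_assoc'[of z g f] assms by simp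

lemma Obj_typing [simp]: "f \<in> Arr C \<Longrightarrow> Dom C f \<in> Obj C" "f \<in> Arr C \<Longrightarrow> Cod C f \<in> Obj C"
  by (simp_all add: Dom_Obj Cod_Obj)

lemma inverse_arrows_unique:
  assumes "inverse_arrows C f g" "inverse_arrows C f g'"
  shows "g = g'"
proof -
  have "g = g \<cdot> (f \<cdot> g')" using assms by (simp add: inverse_arrows_def hom_def)
  also have "\<dots> = (g \<cdot> f) \<cdot> g'"
    using assms by (intro Comp_assoc'[symmetric]) (simp_all add: inverse_arrows_def hom_def)
  also have "\<dots> = g'" using assms by (simp add: inverse_arrows_def hom_def)
  finally show ?thesis .
qed

lemma inv_arr_inverse:
  assumes "iso C f"
  shows "inverse_arrows C f (inv_arr C f)"
  using assms inverse_arrows_unique theI[of "inverse_arrows C f"]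
  unfolding iso_def inv_arr_def by metis

lemma inv_arr_props:
  assumes "iso C f"
  shows "f \<in> Arr C" "inv_arr C f \<in> Arr C" "Dom C (inv_arr C f) = Cod C f"
    "Cod C (inv_arr C f) = Dom C f"
    "inv_arr C f \<cdot> f = \<one> (Dom C f)" "f \<cdot> inv_arr C f = \<one> (Cod C f)"
  using inv_arr_inverse[OF assms] by (simp_all add: inverse_arrows_def hom_def)

lemma iso_cancel_left:
  assumes "iso C f" "f \<cdot> g = f \<cdot> h" "g \<in> Arr C" "h \<in> Arr C" "Cod C g = Dom C f" "Cod C h = Dom C f"
  shows "g = h"
proof -
  note inv = inv_arr_props[OF assms(1)]
  have "inv_arr C f \<cdot> (f \<cdot> k) = k" if "k \<in> Arr C" "Cod C k = Dom C f" for k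
    using that inv by (simp add: Comp_eq_extend[OF inv(5)])
  then show ?thesis using assms by metis
qed

lemma iso_cancel_right:
  assumes "iso C f" "g \<cdot> f = h \<cdot> f" "g \<in> Arr C" "h \<in> Arr C" "Dom C g = Cod C f" "Dom C h = Cod C f"
  shows "g = h"
proof -
  note inv = inv_arr_props[OF assms(1)]
  have "(k \<cdot> f) \<cdot> inv_arr C f = k" if "k \<in> Arr C" "Dom C k = Cod C f" for k
    using that inv by simp
  then show ?thesis using assms by metis
qed

end

context symmetric_monoidal_category
begin

section \<open>Rewriting rules for the monoidal structure\<close>

declare unit_Obj [simp] tens_Obj [simp]

lemma tens_typing [simp]:
  assumes "f \<in> Arr C" "g \<in> Arr C"
  shows "f \<otimes> g \<in> Arr C" "Dom C (f \<otimes> g) = Dom C f \<odot> Dom C g"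
    "Cod C (f \<otimes> g) = Cod C f \<odot> Cod C g"
  using tens_hom[of f "Dom C f" "Cod C f" g "Dom C g" "Cod C g"] assms by (simp_all add: hom_def)

declare tens_Ide [simp]

lemma tens_Comp' :
  assumes "f \<in> Arr C" "f' \<in> Arr C" "g \<in> Arr C" "g' \<in> Arr C" "Dom C f' = Cod C f"
      "Dom C g' = Cod C g"
  shows "(f' \<otimes> g') \<cdot> (f \<otimes> g) = (f' \<cdot> f) \<otimes> (g' \<cdot> g)"
  using tens_Comp[of f "Dom C f" "Cod C f" f' "Cod C f'" g "Dom C g" "Cod C g" g' "Cod C g'"] assms
  by (simp add: hom_def)

lemma tens_Comp_extend:
  assumes "f \<in> Arr C" "f' \<in> Arr C" "g \<in> Arr C" "g' \<in> Arr C" "Dom C f' = Cod C f"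
      "Dom C g' = Cod C g"
    "z \<in> Arr C" "Cod C z = Dom C f \<odot> Dom C g"
  shows "(f' \<otimes> g') \<cdot> ((f \<otimes> g) \<cdot> z) = ((f' \<cdot> f) \<otimes> (g' \<cdot> g)) \<cdot> z"
  using assms by (intro Comp_eq_extend) (simp_all add: tens_Comp')

lemmas tens_merge = tens_Comp' tens_Comp_extend

abbreviation ainv :: "'o \<Rightarrow> 'o \<Rightarrow> 'o \<Rightarrow> 'm" where
  "ainv A B D \<equiv> inv_arr C (assoc C A B D)"

abbreviation linv :: "'o \<Rightarrow> 'm" where "linv A \<equiv> inv_arr C (lunit C A)"
abbreviation rinv :: "'o \<Rightarrow> 'm" where "rinv A \<equiv> inv_arr C (runit C A)"

declare assoc_iso [simp] lunit_iso [simp] runit_iso [simp]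

lemma assoc_typing [simp]:
  assumes "A \<in> Obj C" "B \<in> Obj C" "D \<in> Obj C"
  shows "assoc C A B D \<in> Arr C" "Dom C (assoc C A B D) = (A \<odot> B) \<odot> D"
    "Cod C (assoc C A B D) = A \<odot> (B \<odot> D)"
  using assoc_hom[OF assms] by (simp_all add: hom_def)

lemma lunit_typing [simp]:
  assumes "A \<in> Obj C"
  shows "lunit C A \<in> Arr C" "Dom C (lunit C A) = \<I> \<odot> A" "Cod C (lunit C A) = A"
    "runit C A \<in> Arr C" "Dom C (runit C A) = A \<odot> \<I>" "Cod C (runit C A) = A"
  using lunit_hom[OF assms] runit_hom[OF assms] by (simp_all add: hom_def)

lemma braid_typing [simp]:
  assumes "A \<in> Obj C" "B \<in> Obj C"
  shows "braid C A B \<in> Arr C" "Dom C (braid C A B) = A \<odot> B" "Cod C (braid C A B) = B \<odot> A"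
  using braid_hom[OF assms] by (simp_all add: hom_def)

lemma ainv_typing [simp]:
  assumes "A \<in> Obj C" "B \<in> Obj C" "D \<in> Obj C"
  shows "ainv A B D \<in> Arr C" "Dom C (ainv A B D) = A \<odot> (B \<odot> D)"
    "Cod C (ainv A B D) = (A \<odot> B) \<odot> D"
    "ainv A B D \<cdot> assoc C A B D = \<one> ((A \<odot> B) \<odot> D)"
    "assoc C A B D \<cdot> ainv A B D = \<one> (A \<odot> (B \<odot> D))"
  using inv_arr_props[of "assoc C A B D"] assms by simp_all

lemma linv_typing [simp]:
  assumes "A \<in> Obj C"
  shows "linv A \<in> Arr C" "Dom C (linv A) = A" "Cod C (linv A) = \<I> \<odot> A"
    "linv A \<cdot> lunit C A = \<one> (\<I> \<odot> A)" "lunit C A \<cdot> linv A = \<one> A"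
  using inv_arr_props[of "lunit C A"] assms by simp_all

lemma rinv_typing [simp]:
  assumes "A \<in> Obj C"
  shows "rinv A \<in> Arr C" "Dom C (rinv A) = A" "Cod C (rinv A) = A \<odot> \<I>"
    "rinv A \<cdot> runit C A = \<one> (A \<odot> \<I>)" "runit C A \<cdot> rinv A = \<one> A"
  using inv_arr_props[of "runit C A"] assms by simp_all

lemma cancel_inverses [simp]:
  assumes "z \<in> Arr C"
  shows "\<lbrakk>A \<in> Obj C; B \<in> Obj C; D \<in> Obj C; Cod C z = (A \<odot> B) \<odot> D\<rbrakk> \<Longrightarrow> ainv A B D \<cdot> (assoc C A B D
      \<cdot> z) = z"
    "\<lbrakk>A \<in> Obj C; B \<in> Obj C; D \<in> Obj C; Cod C z = A \<odot> (B \<odot> D)\<rbrakk> \<Longrightarrow> assoc C A B D \<cdot> (ainv A B D \<cdot> z)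
        = z"
    "\<lbrakk>A \<in> Obj C; Cod C z = \<I> \<odot> A\<rbrakk> \<Longrightarrow> linv A \<cdot> (lunit C A \<cdot> z) = z"
    "\<lbrakk>A \<in> Obj C; Cod C z = A\<rbrakk> \<Longrightarrow> lunit C A \<cdot> (linv A \<cdot> z) = z"
    "\<lbrakk>A \<in> Obj C; Cod C z = A \<odot> \<I>\<rbrakk> \<Longrightarrow> rinv A \<cdot> (runit C A \<cdot> z) = z"
    "\<lbrakk>A \<in> Obj C; Cod C z = A\<rbrakk> \<Longrightarrow> runit C A \<cdot> (rinv A \<cdot> z) = z"
    "\<lbrakk>A \<in> Obj C; B \<in> Obj C; Cod C z = A \<odot> B\<rbrakk> \<Longrightarrow> braid C B A \<cdot> (braid C A B \<cdot> z) = z"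
  using assms by (simp_all add: Comp_eq_extend[OF ainv_typing(4)] Comp_eq_extend[OF ainv_typing(5)]
      Comp_eq_extend[OF linv_typing(4)] Comp_eq_extend[OF linv_typing(5)]
      Comp_eq_extend[OF rinv_typing(4)] Comp_eq_extend[OF rinv_typing(5)] Comp_eq_extend[OF
          symmetry])

declare symmetry [simp]

lemma assoc_nat:
  assumes "f \<in> Arr C" "g \<in> Arr C" "h \<in> Arr C" "Cod C f = A" "Cod C g = B" "Cod C h = D"
  shows "assoc C A B D \<cdot> ((f \<otimes> g) \<otimes> h) = (f \<otimes> (g \<otimes> h)) \<cdot> assoc C (Dom C f) (Dom C g) (Dom C h)"
  using assoc_natural[of f "Dom C f" "Cod C f" g "Dom C g" "Cod C g" h "Dom C h" "Cod C h"] assms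
  by (simp add: hom_def)

lemma ainv_nat:
  assumes "f \<in> Arr C" "g \<in> Arr C" "h \<in> Arr C" "Cod C f = A" "Cod C g = B" "Cod C h = D"
  shows "ainv A B D \<cdot> (f \<otimes> (g \<otimes> h)) = ((f \<otimes> g) \<otimes> h) \<cdot> ainv (Dom C f) (Dom C g) (Dom C h)"
proof -
  have "A \<in> Obj C" "B \<in> Obj C" "D \<in> Obj C" using assms by auto
  then show ?thesis
  using assms by (intro iso_cancel_left[of "assoc C A B D" "ainv A B D \<cdot> (f \<otimes> (g \<otimes> h))"
        "((f \<otimes> g) \<otimes> h) \<cdot> ainv (Dom C f) (Dom C g) (Dom C h)"])
     (simp_all add: Comp_eq_extend[OF assoc_nat])
qed

lemma lunit_nat: "f \<in> Arr C \<Longrightarrow> Cod C f = A \<Longrightarrow> lunit C A \<cdot> (\<one> \<I> \<otimes> f) = f \<cdot> lunit C (Dom C f)"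
  using lunit_natural[of f "Dom C f" A] by (simp add: hom_def)

lemma runit_nat: "f \<in> Arr C \<Longrightarrow> Cod C f = A \<Longrightarrow> runit C A \<cdot> (f \<otimes> \<one> \<I>) = f \<cdot> runit C (Dom C f)"
  using runit_natural[of f "Dom C f" A] by (simp add: hom_def)

lemma braid_nat:
  assumes "f \<in> Arr C" "g \<in> Arr C" "Cod C f = A" "Cod C g = B"
  shows "braid C A B \<cdot> (f \<otimes> g) = (g \<otimes> f) \<cdot> braid C (Dom C f) (Dom C g)"
  using braid_natural[of f "Dom C f" "Cod C f" g "Dom C g" "Cod C g"] assms by (simp add: hom_def)

section \<open>Coherence of the unit isomorphisms and the braiding\<close>

lemma tens_unit_faithful:
  assumes "\<one> \<I> \<otimes> f = \<one> \<I> \<otimes> g" "f \<in> Arr C" "g \<in> Arr C" "Dom C f = Dom C g" "Cod C f = Cod C g"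
  shows "f = g"
proof (rule iso_cancel_right[of "lunit C (Dom C f)"])
  show "f \<cdot> lunit C (Dom C f) = g \<cdot> lunit C (Dom C f)"
    using assms lunit_nat[of f "Cod C f"] lunit_nat[of g "Cod C f"] by simp
qed (use assms in simp_all)

lemma unit_tens_faithful:
  assumes "f \<otimes> \<one> \<I> = g \<otimes> \<one> \<I>" "f \<in> Arr C" "g \<in> Arr C" "Dom C f = Dom C g" "Cod C f = Cod C g"
  shows "f = g"
proof (rule iso_cancel_right[of "runit C (Dom C f)"])
  show "f \<cdot> runit C (Dom C f) = g \<cdot> runit C (Dom C f)"
    using assms runit_nat[of f "Cod C f"] runit_nat[of g "Cod C f"] by simp
qed (use assms in simp_all)

lemma iso_tens:
  assumes "iso C f" "iso C g"
  shows "iso C (f \<otimes> g)"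
proof -
  have "inverse_arrows C (f \<otimes> g) (inv_arr C f \<otimes> inv_arr C g)"
    using inv_arr_props[OF assms(1)] inv_arr_props[OF assms(2)]
    by (simp add: inverse_arrows_def hom_def tens_merge)
  then show ?thesis by (auto simp: iso_def)
qed

lemma iso_Ide: "A \<in> Obj C \<Longrightarrow> iso C (\<one> A)"
  unfolding iso_def inverse_arrows_def hom_def by (intro exI[of _ "\<one> A"]) simp

lemma iso_comp:
  assumes "iso C f" "iso C g" "Dom C g = Cod C f"
  shows "iso C (g \<cdot> f)"
proof -
  note [simp] = inv_arr_props[OF assms(1)] inv_arr_props[OF assms(2)]
    Comp_eq_extend[OF inv_arr_props(5)[OF assms(1)]] Comp_eq_extend[OF inv_arr_props(6)[OF
        assms(1)]]
    Comp_eq_extend[OF inv_arr_props(5)[OF assms(2)]] Comp_eq_extend[OF inv_arr_props(6)[OF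
        assms(2)]]
  have "inverse_arrows C (g \<cdot> f) (inv_arr C f \<cdot> inv_arr C g)"
    using assms by (simp add: inverse_arrows_def hom_def)
  then show ?thesis by (auto simp: iso_def)
qed

text \<open>Kelly's argument: tensoring with the unit is faithful, so the equation may be checked
  behind \<open>\<one> \<I> \<otimes> _\<close>. There the pentagon for
  \<open>\<I>, \<I>, A, B\<close> and the triangle give it up to the isomorphism
  \<open>?k\<close>.\<close>

lemma lunit_tens:
  assumes [simp]: "A \<in> Obj C" "B \<in> Obj C"
  shows "lunit C (A \<odot> B) \<cdot> assoc C \<I> A B = lunit C A \<otimes> \<one> B"
proof -
  let ?k = "assoc C \<I> (\<I> \<odot> A) B \<cdot> (assoc C \<I> \<I> A \<otimes> \<one> B)"
  have "(\<one> \<I> \<otimes> (lunit C (A \<odot> B) \<cdot> assoc C \<I> A B)) \<cdot> ?k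
      = (\<one> \<I> \<otimes> lunit C (A \<odot> B)) \<cdot> ((\<one> \<I> \<otimes> assoc C \<I> A B) \<cdot> ?k)"
    by (simp add: tens_merge)
  also have "\<dots> = (\<one> \<I> \<otimes> lunit C (A \<odot> B)) \<cdot> (assoc C \<I> \<I> (A \<odot> B) \<cdot> assoc C (\<I> \<odot> \<I>) A B)"
    using pentagon[of \<I> \<I> A B] by simp
  also have "\<dots> = (runit C \<I> \<otimes> \<one> (A \<odot> B)) \<cdot> assoc C (\<I> \<odot> \<I>) A B"
    by (subst Comp_eq_extend[OF triangle]) simp_all
  also have "\<dots> = assoc C \<I> A B \<cdot> ((runit C \<I> \<otimes> \<one> A) \<otimes> \<one> B)"
    using assoc_nat[of "runit C \<I>" "\<one> A" "\<one> B" \<I> A B] by simp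
  also have "\<dots> = assoc C \<I> A B \<cdot> (((\<one> \<I> \<otimes> lunit C A) \<otimes> \<one> B) \<cdot> (assoc C \<I> \<I> A \<otimes> \<one> B))"
    by (simp add: tens_merge triangle)
  also have "\<dots> = (\<one> \<I> \<otimes> (lunit C A \<otimes> \<one> B)) \<cdot> ?k"
    by (subst Comp_eq_extend[OF assoc_nat[of "\<one> \<I>" "lunit C A" "\<one> B"]]) simp_all
  finally have "\<one> \<I> \<otimes> (lunit C (A \<odot> B) \<cdot> assoc C \<I> A B) = \<one> \<I> \<otimes> (lunit C A \<otimes> \<one> B)"
    by (intro iso_cancel_right[of ?k "\<one> \<I> \<otimes> (lunit C (A \<odot> B) \<cdot> assoc C \<I> A B)"] iso_comp iso_tens)
       (simp_all add: iso_Ide)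
  then show ?thesis by (rule tens_unit_faithful) simp_all
qed

text \<open>Mirror image of \<open>lunit_tens\<close>: the pentagon for
  \<open>A, B, \<I>, \<I>\<close>, tested after tensoring with the unit on the right.\<close>

lemma runit_tens:
  assumes [simp]: "A \<in> Obj C" "B \<in> Obj C"
  shows "(\<one> A \<otimes> runit C B) \<cdot> assoc C A B \<I> = runit C (A \<odot> B)"
proof -
  have nat: "assoc C A B \<I> \<cdot> (\<one> (A \<odot> B) \<otimes> lunit C \<I>)
      = (\<one> A \<otimes> (\<one> B \<otimes> lunit C \<I>)) \<cdot> assoc C A B (\<I> \<odot> \<I>)"
    using assoc_nat[of "\<one> A" "\<one> B" "lunit C \<I>" A B \<I>] by simp
  have "assoc C A B \<I> \<cdot> (((\<one> A \<otimes> runit C B) \<cdot> assoc C A B \<I>) \<otimes> \<one> \<I>)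
     = (assoc C A B \<I> \<cdot> ((\<one> A \<otimes> runit C B) \<otimes> \<one> \<I>)) \<cdot> (assoc C A B \<I> \<otimes> \<one> \<I>)"
    by (simp add: tens_merge)
  also have "\<dots> = (\<one> A \<otimes> (runit C B \<otimes> \<one> \<I>)) \<cdot> assoc C A (B \<odot> \<I>) \<I> \<cdot> (assoc C A B \<I> \<otimes> \<one> \<I>)"
    by (subst assoc_nat) simp_all
  also have "\<dots> = (\<one> A \<otimes> (\<one> B \<otimes> lunit C \<I>)) \<cdot>
      ((\<one> A \<otimes> assoc C B \<I> \<I>) \<cdot> assoc C A (B \<odot> \<I>) \<I> \<cdot> (assoc C A B \<I> \<otimes> \<one> \<I>))"
    by (simp add: triangle[symmetric] tens_merge)
  also have "\<dots> = (\<one> A \<otimes> (\<one> B \<otimes> lunit C \<I>)) \<cdot> (assoc C A B (\<I> \<odot> \<I>) \<cdot> assoc C (A \<odot> B) \<I> \<I>)"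
    using pentagon[of A B \<I> \<I>] by simp
  also have "\<dots> = (assoc C A B \<I> \<cdot> (\<one> (A \<odot> B) \<otimes> lunit C \<I>)) \<cdot> assoc C (A \<odot> B) \<I> \<I>"
    by (simp add: Comp_eq_extend[OF nat])
  also have "\<dots> = assoc C A B \<I> \<cdot> (runit C (A \<odot> B) \<otimes> \<one> \<I>)"
    by (simp add: triangle)
  finally have "((\<one> A \<otimes> runit C B) \<cdot> assoc C A B \<I>) \<otimes> \<one> \<I> = runit C (A \<odot> B) \<otimes> \<one> \<I>"
    by (rule iso_cancel_left[rotated 1]) simp_all
  then show ?thesis by (rule unit_tens_faithful) simp_all
qed

text \<open>Naturality of the left unitor along itself gives \<open>lunit C (\<I> \<odot> \<I>) =
  \<one> \<I> \<otimes> lunit C \<I>\<close>; then \<open>lunit_tens\<close> and the triangle have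
  the same left-hand side.\<close>

lemma lunit_unit: "lunit C \<I> = runit C \<I>"
proof -
  have "lunit C (\<I> \<odot> \<I>) = \<one> \<I> \<otimes> lunit C \<I>"
    by (rule iso_cancel_left[of "lunit C \<I>"]) (simp_all add: lunit_nat)
  then have "lunit C \<I> \<otimes> \<one> \<I> = runit C \<I> \<otimes> \<one> \<I>"
    using lunit_tens[of \<I> \<I>] triangle[of \<I> \<I>] by simp
  then show ?thesis by (rule unit_tens_faithful) simp_all
qed

text \<open>The hexagon for \<open>A, \<I>, \<I>\<close>, with the unitors absorbed, says this after
  tensoring with \<open>\<I>\<close> and composing with the invertible
  \<open>braid C A \<I>\<close>.\<close>

lemma lunit_braid:
  assumes [simp]: "A \<in> Obj C"
  shows "lunit C A \<cdot> braid C A \<I> = runit C A"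
proof -
  have "braid C A \<I> \<cdot> (runit C A \<otimes> \<one> \<I>)
      = (braid C A \<I> \<cdot> (\<one> A \<otimes> lunit C \<I>)) \<cdot> assoc C A \<I> \<I>"
    by (simp add: triangle)
  also have "\<dots> = (lunit C \<I> \<otimes> \<one> A) \<cdot> braid C A (\<I> \<odot> \<I>) \<cdot> assoc C A \<I> \<I>"
    by (subst braid_nat) simp_all
  also have "\<dots> = lunit C (\<I> \<odot> A) \<cdot> (assoc C \<I> \<I> A \<cdot> braid C A (\<I> \<odot> \<I>) \<cdot> assoc C A \<I> \<I>)"
    by (simp add: lunit_tens[symmetric])
  also have "\<dots> = (lunit C (\<I> \<odot> A) \<cdot> (\<one> \<I> \<otimes> braid C A \<I>)) \<cdot> assoc C \<I> A \<I> \<cdot> (braid C A \<I> \<otimes> \<one> \<I>)"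
    by (simp add: hexagon)
  also have "\<dots> = braid C A \<I> \<cdot> (lunit C (A \<odot> \<I>) \<cdot> assoc C \<I> A \<I>) \<cdot> (braid C A \<I> \<otimes> \<one> \<I>)"
    by (subst lunit_nat) simp_all
  also have "\<dots> = braid C A \<I> \<cdot> ((lunit C A \<cdot> braid C A \<I>) \<otimes> \<one> \<I>)"
    by (simp add: lunit_tens tens_merge)
  finally have "runit C A \<otimes> \<one> \<I> = (lunit C A \<cdot> braid C A \<I>) \<otimes> \<one> \<I>"
    by (rule iso_cancel_left[rotated 1])
       (auto simp: iso_def inverse_arrows_def hom_def intro!: exI[of _ "braid C \<I> A"])
  then show ?thesis by (rule unit_tens_faithful[symmetric]) simp_all
qed

text \<open>Everything below is computed on right-bracketed tensor words, where \<open>swap A B Z\<close>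
  exchanges the first two letters.\<close>

definition swap :: "'o \<Rightarrow> 'o \<Rightarrow> 'o \<Rightarrow> 'm" where
  "swap A B Z = assoc C B A Z \<cdot> (braid C A B \<otimes> \<one> Z) \<cdot> ainv A B Z"

lemma swap_typing [simp]:
  assumes "A \<in> Obj C" "B \<in> Obj C" "Z \<in> Obj C"
  shows "swap A B Z \<in> Arr C" "Dom C (swap A B Z) = A \<odot> (B \<odot> Z)" "Cod C (swap A B Z) = B \<odot> (A \<odot> Z)"
  using assms by (simp_all add: swap_def)

lemma swap_swap [simp]:
  assumes [simp]: "A \<in> Obj C" "B \<in> Obj C" "Z \<in> Obj C"
  shows "swap B A Z \<cdot> swap A B Z = \<one> (A \<odot> (B \<odot> Z))"
  by (simp add: swap_def tens_merge)

lemma swap_nat: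
  assumes [simp]: "f \<in> Arr C" "g \<in> Arr C" "h \<in> Arr C"
    and cods: "Cod C f = A" "Cod C g = B" "Cod C h = Z"
  shows "swap A B Z \<cdot> (f \<otimes> (g \<otimes> h)) = (g \<otimes> (f \<otimes> h)) \<cdot> swap (Dom C f) (Dom C g) (Dom C h)"
proof -
  have [simp]: "A \<in> Obj C" "B \<in> Obj C" "Z \<in> Obj C" using cods by auto
  have "swap A B Z \<cdot> (f \<otimes> (g \<otimes> h))
     = assoc C B A Z \<cdot> (braid C A B \<otimes> \<one> Z) \<cdot> (ainv A B Z \<cdot> (f \<otimes> (g \<otimes> h)))"
    using cods by (simp add: swap_def)
  also have "\<dots> = assoc C B A Z \<cdot> ((braid C A B \<cdot> (f \<otimes> g)) \<otimes> h) \<cdot> ainv (Dom C f) (Dom C g) (Dom C h)"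
    using cods by (subst ainv_nat) (simp_all add: tens_merge)
  also have "\<dots> = (assoc C B A Z \<cdot> ((g \<otimes> f) \<otimes> h)) \<cdot> (braid C (Dom C f) (Dom C g) \<otimes> \<one> (Dom C h))
      \<cdot> ainv (Dom C f) (Dom C g) (Dom C h)"
    using cods by (simp add: braid_nat tens_merge)
  also have "\<dots> = (g \<otimes> (f \<otimes> h)) \<cdot> swap (Dom C f) (Dom C g) (Dom C h)"
    using cods by (subst assoc_nat) (simp_all add: swap_def)
  finally show ?thesis .
qed

text \<open>The hexagon with a spectator \<open>Z\<close>: passing \<open>B \<odot> D\<close> is
  passing \<open>B\<close> and then \<open>D\<close>. Precomposing with \<open>?k\<close>, which
  rebrackets \<open>((A \<odot> B) \<odot> D) \<odot> Z\<close>, lets pentagon and hexagon reduce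
  both sides to \<open>?m\<close>.\<close>

lemma assoc_swap_tens:
  assumes [simp]: "A \<in> Obj C" "B \<in> Obj C" "D \<in> Obj C" "Z \<in> Obj C"
  shows "assoc C B D (A \<odot> Z) \<cdot> swap A (B \<odot> D) Z
    = (\<one> B \<otimes> swap A D Z) \<cdot> swap A B (D \<odot> Z) \<cdot> (\<one> A \<otimes> assoc C B D Z)"
proof -
  let ?k = "assoc C A (B \<odot> D) Z \<cdot> (assoc C A B D \<otimes> \<one> Z)"
  let ?m = "(\<one> B \<otimes> (assoc C D A Z \<cdot> (braid C A D \<otimes> \<one> Z))) \<cdot> assoc C B (A \<odot> D) Z
    \<cdot> (assoc C B A D \<otimes> \<one> Z) \<cdot> ((braid C A B \<otimes> \<one> D) \<otimes> \<one> Z)"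
  have "(assoc C B D (A \<odot> Z) \<cdot> swap A (B \<odot> D) Z) \<cdot> ?k
     = (assoc C B D (A \<odot> Z) \<cdot> assoc C (B \<odot> D) A Z) \<cdot> ((braid C A (B \<odot> D) \<cdot> assoc C A B D) \<otimes> \<one> Z)"
    by (simp add: swap_def tens_merge)
  also have "\<dots> = (\<one> B \<otimes> assoc C D A Z) \<cdot> assoc C B (D \<odot> A) Z \<cdot>
     ((assoc C B D A \<cdot> braid C A (B \<odot> D) \<cdot> assoc C A B D) \<otimes> \<one> Z)"
    by (simp add: pentagon tens_merge)
  also have "\<dots> = (\<one> B \<otimes> assoc C D A Z) \<cdot> (assoc C B (D \<odot> A) Z \<cdot>
     ((\<one> B \<otimes> braid C A D) \<otimes> \<one> Z)) \<cdot> (assoc C B A D \<otimes> \<one> Z) \<cdot> ((braid C A B \<otimes> \<one> D) \<otimes> \<one> Z)"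
    by (simp add: hexagon tens_merge)
  also have "\<dots> = ?m"
    by (subst assoc_nat) (simp_all add: tens_merge)
  finally have L: "(assoc C B D (A \<odot> Z) \<cdot> swap A (B \<odot> D) Z) \<cdot> ?k = ?m" .
  have "((\<one> B \<otimes> swap A D Z) \<cdot> swap A B (D \<odot> Z) \<cdot> (\<one> A \<otimes> assoc C B D Z)) \<cdot> ?k
    = (\<one> B \<otimes> swap A D Z) \<cdot> swap A B (D \<odot> Z) \<cdot> ((\<one> A \<otimes> assoc C B D Z) \<cdot> ?k)"
    by simp
  also have "\<dots> = (\<one> B \<otimes> swap A D Z) \<cdot> swap A B (D \<odot> Z) \<cdot> assoc C A B (D \<odot> Z) \<cdot> assoc C (A \<odot> B) D Z"
    by (simp add: pentagon)
  also have "\<dots> = (\<one> B \<otimes> swap A D Z) \<cdot> assoc C B A (D \<odot> Z) \<cdot> ((braid C A B \<otimes> (\<one> D \<otimes> \<one> Z))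
      \<cdot> assoc C (A \<odot> B) D Z)"
    by (simp add: swap_def[of A B])
  also have "\<dots> = (\<one> B \<otimes> swap A D Z) \<cdot> (assoc C B A (D \<odot> Z) \<cdot> assoc C (B \<odot> A) D Z)
      \<cdot> ((braid C A B \<otimes> \<one> D) \<otimes> \<one> Z)"
    using assoc_nat[of "braid C A B" "\<one> D" "\<one> Z" "B \<odot> A" D Z] by simp
  also have "\<dots> = ?m"
    by (simp add: pentagon swap_def tens_merge)
  finally have R: "((\<one> B \<otimes> swap A D Z) \<cdot> swap A B (D \<odot> Z) \<cdot> (\<one> A \<otimes> assoc C B D Z)) \<cdot> ?k = ?m" .
  show ?thesis
    by (rule iso_cancel_right[of ?k], intro iso_comp iso_tens, simp_all only: L R)
       (simp_all add: iso_Ide)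
qed

lemma braid_tens_right:
  assumes [simp]: "A \<in> Obj C" "B \<in> Obj C" "D \<in> Obj C"
  shows "assoc C B D A \<cdot> braid C A (B \<odot> D) = (\<one> B \<otimes> braid C A D) \<cdot> swap A B D"
  by (rule iso_cancel_right[of "assoc C A B D"]) (simp_all add: hexagon swap_def)

text \<open>The second hexagon. Only the first is an axiom; this one is its inverse form, obtained
  with the symmetry.\<close>

lemma braid_tens_left:
  assumes [simp]: "A \<in> Obj C" "B \<in> Obj C" "D \<in> Obj C"
  shows "braid C (A \<odot> B) D = swap A D B \<cdot> (\<one> A \<otimes> braid C B D) \<cdot> assoc C A B D"
proof -
  have "(swap A D B \<cdot> (\<one> A \<otimes> braid C B D) \<cdot> assoc C A B D) \<cdot> braid C D (A \<odot> B)
    = \<one> (D \<odot> (A \<odot> B))"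
    by (simp add: braid_tens_right tens_merge)
  then have "(swap A D B \<cdot> (\<one> A \<otimes> braid C B D) \<cdot> assoc C A B D) \<cdot> braid C D (A \<odot> B) =
    braid C (A \<odot> B) D \<cdot> braid C D (A \<odot> B)" by simp
  then show ?thesis
    by (rule iso_cancel_right[rotated 1, symmetric])
      (auto simp: iso_def inverse_arrows_def hom_def intro!: exI[of _ "braid C (A \<odot> B) D"])
qed

section \<open>Tensor products of coalgebras\<close>

text \<open>Exchanging the first two letters does not depend on how the rest
  \<open>D \<odot> W\<close> of the word is bracketed; a pentagon on either side of the braiding
  shows it.\<close>

lemma swap_tens_last:
  assumes [simp]: "A \<in> Obj C" "B \<in> Obj C" "D \<in> Obj C" "W \<in> Obj C"
  shows "(\<one> B \<otimes> assoc C A D W) \<cdot> assoc C B (A \<odot> D) W \<cdot> (swap A B D \<otimes> \<one> W)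
    = swap A B (D \<odot> W) \<cdot> (\<one> A \<otimes> assoc C B D W) \<cdot> assoc C A (B \<odot> D) W"
proof -
  let ?k = "assoc C A B D \<otimes> \<one> W"
  have "((\<one> B \<otimes> assoc C A D W) \<cdot> assoc C B (A \<odot> D) W \<cdot> (swap A B D \<otimes> \<one> W)) \<cdot> ?k
    = ((\<one> B \<otimes> assoc C A D W) \<cdot> assoc C B (A \<odot> D) W \<cdot> (assoc C B A D \<otimes> \<one> W))
       \<cdot> ((braid C A B \<otimes> \<one> D) \<otimes> \<one> W)"
    by (simp add: swap_def tens_merge)
  also have "\<dots> = assoc C B A (D \<odot> W) \<cdot> (assoc C (B \<odot> A) D W \<cdot> ((braid C A B \<otimes> \<one> D) \<otimes> \<one> W))"
    by (simp add: pentagon[symmetric])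
  also have "\<dots> = assoc C B A (D \<odot> W) \<cdot> (braid C A B \<otimes> \<one> (D \<odot> W)) \<cdot> assoc C (A \<odot> B) D W"
    by (subst assoc_nat) simp_all
  also have "\<dots> = swap A B (D \<odot> W) \<cdot> (assoc C A B (D \<odot> W) \<cdot> assoc C (A \<odot> B) D W)"
    by (simp add: swap_def)
  also have "\<dots> = (swap A B (D \<odot> W) \<cdot> (\<one> A \<otimes> assoc C B D W) \<cdot> assoc C A (B \<odot> D) W) \<cdot> ?k"
    by (simp add: pentagon)
  finally show ?thesis
    by (rule iso_cancel_right[rotated 1]) (simp_all add: iso_tens iso_Ide)
qed

section \<open>Comultiplication and counit as operations on words\<close>

abbreviation (input) carrier ("\<flat>_" [1000] 1000) where "\<flat>A \<equiv> coalg_ob A"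

text \<open>\<open>dup\<close> doubles and \<open>del\<close> erases the first letter of a word with
  rest \<open>Z\<close>. In this form the coalgebra laws and their interplay with
  \<open>swap\<close> need no explicit associators.\<close>

definition dup :: "('o, 'm) coalgebra \<Rightarrow> 'o \<Rightarrow> 'm" where
  "dup A Z = assoc C (coalg_ob A) (coalg_ob A) Z \<cdot> (coalg_comult A \<otimes> \<one> Z)"

definition del :: "('o, 'm) coalgebra \<Rightarrow> 'o \<Rightarrow> 'm" where
  "del A Z = lunit C Z \<cdot> (coalg_counit A \<otimes> \<one> Z)"

lemma coalgebra_typing [simp]:
  assumes "is_coalgebra C A"
  shows "coalg_ob A \<in> Obj C"
    "coalg_comult A \<in> Arr C" "Dom C (coalg_comult A) = coalg_ob A"
    "Cod C (coalg_comult A) = coalg_ob A \<odot> coalg_ob A"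
    "coalg_counit A \<in> Arr C" "Dom C (coalg_counit A) = coalg_ob A" "Cod C (coalg_counit A) = \<I>"
  using assms by (simp_all add: is_coalgebra_def Let_def hom_def)

lemma coalgebra_laws:
  assumes "is_coalgebra C A"
  shows "assoc C (coalg_ob A) (coalg_ob A) (coalg_ob A) \<cdot> (coalg_comult A \<otimes> \<one> (coalg_ob A))
      \<cdot> coalg_comult A
      = (\<one> (coalg_ob A) \<otimes> coalg_comult A) \<cdot> coalg_comult A"
    "lunit C (coalg_ob A) \<cdot> (coalg_counit A \<otimes> \<one> (coalg_ob A)) \<cdot> coalg_comult A = \<one> (coalg_ob A)"
    "runit C (coalg_ob A) \<cdot> (\<one> (coalg_ob A) \<otimes> coalg_counit A) \<cdot> coalg_comult A = \<one> (coalg_ob A)"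
  using assms by (simp_all add: is_coalgebra_def Let_def)

context
  fixes A :: "('o, 'm) coalgebra"
  assumes A [simp]: "is_coalgebra C A"
begin

lemma dup_typing [simp]:
  assumes "Z \<in> Obj C"
  shows "dup A Z \<in> Arr C" "Dom C (dup A Z) = coalg_ob A \<odot> Z"
    "Cod C (dup A Z) = coalg_ob A \<odot> (coalg_ob A \<odot> Z)"
    "del A Z \<in> Arr C" "Dom C (del A Z) = coalg_ob A \<odot> Z" "Cod C (del A Z) = Z"
  using assms by (simp_all add: dup_def del_def)

lemma dup_nat:
  assumes [simp]: "f \<in> Arr C" and f: "Cod C f = Z"
  shows "dup A Z \<cdot> (\<one> \<flat>A \<otimes> f) = (\<one> \<flat>A \<otimes> (\<one> \<flat>A \<otimes> f)) \<cdot> dup A (Dom C f)"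
proof -
  have [simp]: "Z \<in> Obj C" using f by auto
  have "dup A Z \<cdot> (\<one> \<flat>A \<otimes> f) = (assoc C \<flat>A \<flat>A Z \<cdot> ((\<one> \<flat>A \<otimes> \<one> \<flat>A) \<otimes> f))
      \<cdot> (coalg_comult A \<otimes> \<one> (Dom C f))"
    using f by (simp add: dup_def tens_merge)
  also have "\<dots> = (\<one> \<flat>A \<otimes> (\<one> \<flat>A \<otimes> f)) \<cdot> dup A (Dom C f)"
    using f by (subst assoc_nat) (simp_all add: dup_def)
  finally show ?thesis .
qed

lemma del_nat:
  assumes [simp]: "f \<in> Arr C" and f: "Cod C f = Z"
  shows "del A Z \<cdot> (\<one> \<flat>A \<otimes> f) = f \<cdot> del A (Dom C f)"
proof -
  have [simp]: "Z \<in> Obj C" using f by auto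
  have "del A Z \<cdot> (\<one> \<flat>A \<otimes> f) = (lunit C Z \<cdot> (\<one> \<I> \<otimes> f)) \<cdot> (coalg_counit A \<otimes> \<one> (Dom C f))"
    using f by (simp add: del_def tens_merge)
  also have "\<dots> = f \<cdot> del A (Dom C f)"
    using f by (subst lunit_nat) (simp_all add: del_def)
  finally show ?thesis .
qed

lemma dup_dup:
  assumes [simp]: "Z \<in> Obj C"
  shows "dup A (\<flat>A \<odot> Z) \<cdot> dup A Z = (\<one> \<flat>A \<otimes> dup A Z) \<cdot> dup A Z"
proof -
  have "dup A (\<flat>A \<odot> Z) \<cdot> dup A Z
    = assoc C \<flat>A \<flat>A (\<flat>A \<odot> Z) \<cdot> ((coalg_comult A \<otimes> (\<one> \<flat>A \<otimes> \<one> Z)) \<cdot> assoc C \<flat>A \<flat>A Z)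
        \<cdot> (coalg_comult A \<otimes> \<one> Z)"
    by (simp add: dup_def)
  also have "\<dots> = assoc C \<flat>A \<flat>A (\<flat>A \<odot> Z) \<cdot> (assoc C (\<flat>A \<odot> \<flat>A) \<flat>A Z \<cdot> ((coalg_comult A \<otimes> \<one> \<flat>A) \<otimes> \<one> Z))
      \<cdot> (coalg_comult A \<otimes> \<one> Z)"
    by (subst assoc_nat) simp_all
  also have "\<dots> = (\<one> \<flat>A \<otimes> assoc C \<flat>A \<flat>A Z) \<cdot> assoc C \<flat>A (\<flat>A \<odot> \<flat>A) Z \<cdot>
     ((assoc C \<flat>A \<flat>A \<flat>A \<cdot> (coalg_comult A \<otimes> \<one> \<flat>A) \<cdot> coalg_comult A) \<otimes> \<one> Z)"
    by (simp add: Comp_eq_extend[OF pentagon] tens_merge)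
  also have "\<dots> = (\<one> \<flat>A \<otimes> assoc C \<flat>A \<flat>A Z) \<cdot> (assoc C \<flat>A (\<flat>A \<odot> \<flat>A) Z
      \<cdot> ((\<one> \<flat>A \<otimes> coalg_comult A) \<otimes> \<one> Z))
     \<cdot> (coalg_comult A \<otimes> \<one> Z)"
    by (simp add: coalgebra_laws tens_merge)
  also have "\<dots> = (\<one> \<flat>A \<otimes> dup A Z) \<cdot> dup A Z"
    by (subst assoc_nat) (simp_all add: dup_def tens_merge)
  finally show ?thesis .
qed

lemma dup_comult: "dup A \<flat>A \<cdot> coalg_comult A = (\<one> \<flat>A \<otimes> coalg_comult A) \<cdot> coalg_comult A"
  by (simp add: dup_def coalgebra_laws)

lemma del_dup:
  assumes [simp]: "Z \<in> Obj C"
  shows "del A (\<flat>A \<odot> Z) \<cdot> dup A Z = \<one> (\<flat>A \<odot> Z)"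
proof -
  have "del A (\<flat>A \<odot> Z) \<cdot> dup A Z
    = lunit C (\<flat>A \<odot> Z) \<cdot> ((coalg_counit A \<otimes> (\<one> \<flat>A \<otimes> \<one> Z)) \<cdot> assoc C \<flat>A \<flat>A Z)
        \<cdot> (coalg_comult A \<otimes> \<one> Z)"
    by (simp add: dup_def del_def)
  also have "\<dots> = (lunit C (\<flat>A \<odot> Z) \<cdot> assoc C \<I> \<flat>A Z) \<cdot> (((coalg_counit A \<otimes> \<one> \<flat>A)
      \<cdot> coalg_comult A) \<otimes> \<one> Z)"
    using assoc_nat[of "coalg_counit A" "\<one> \<flat>A" "\<one> Z" \<I> "\<flat>A" Z, symmetric]
    by (simp add: tens_merge del: tens_Ide)
  also have "\<dots> = (lunit C \<flat>A \<cdot> (coalg_counit A \<otimes> \<one> \<flat>A) \<cdot> coalg_comult A) \<otimes> \<one> Z"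
    by (simp add: lunit_tens tens_merge del: Comp_assoc')
  finally show ?thesis by (simp add: coalgebra_laws)
qed

lemma del_comult: "del A \<flat>A \<cdot> coalg_comult A = \<one> \<flat>A"
  by (simp add: del_def coalgebra_laws)

lemma tens_del_dup:
  assumes [simp]: "Z \<in> Obj C"
  shows "(\<one> \<flat>A \<otimes> del A Z) \<cdot> dup A Z = \<one> (\<flat>A \<odot> Z)"
proof -
  have "(\<one> \<flat>A \<otimes> del A Z) \<cdot> dup A Z
    = (\<one> \<flat>A \<otimes> lunit C Z) \<cdot> ((\<one> \<flat>A \<otimes> (coalg_counit A \<otimes> \<one> Z)) \<cdot> assoc C \<flat>A \<flat>A Z)
        \<cdot> (coalg_comult A \<otimes> \<one> Z)"
    by (simp add: dup_def del_def tens_merge)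
  also have "\<dots> = ((\<one> \<flat>A \<otimes> lunit C Z) \<cdot> assoc C \<flat>A \<I> Z) \<cdot> (((\<one> \<flat>A \<otimes> coalg_counit A)
      \<cdot> coalg_comult A) \<otimes> \<one> Z)"
    using assoc_nat[of "\<one> \<flat>A" "coalg_counit A" "\<one> Z" "\<flat>A" \<I> Z, symmetric]
    by (simp add: tens_merge)
  also have "\<dots> = (runit C \<flat>A \<cdot> (\<one> \<flat>A \<otimes> coalg_counit A) \<cdot> coalg_comult A) \<otimes> \<one> Z"
    by (simp add: triangle tens_merge del: Comp_assoc')
  finally show ?thesis by (simp add: coalgebra_laws)
qed

lemma swap_dup:
  assumes [simp]: "Z \<in> Obj C" and "is_cocommutative C A"
  shows "swap \<flat>A \<flat>A Z \<cdot> dup A Z = dup A Z"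
  using assms(2) by (simp add: swap_def dup_def tens_merge is_cocommutative_def)

text \<open>Doubling \<open>A\<close> after it has moved past \<open>B\<close> amounts to doubling
  it in place and moving both copies: naturality of the exchange along the comultiplication, then
  \<open>assoc_swap_tens\<close>.\<close>

lemma dup_swap:
  assumes [simp]: "Z \<in> Obj C" "B \<in> Obj C"
  shows "dup A (B \<odot> Z) \<cdot> swap B \<flat>A Z
    = (\<one> \<flat>A \<otimes> swap B \<flat>A Z) \<cdot> swap B \<flat>A (\<flat>A \<odot> Z) \<cdot> (\<one> B \<otimes> dup A Z)"
proof -
  have "dup A (B \<odot> Z) \<cdot> swap B \<flat>A Z
    = assoc C \<flat>A \<flat>A (B \<odot> Z) \<cdot> ((coalg_comult A \<otimes> (\<one> B \<otimes> \<one> Z)) \<cdot> swap B \<flat>A Z)"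
    by (simp add: dup_def)
  also have "\<dots> = assoc C \<flat>A \<flat>A (B \<odot> Z) \<cdot> (swap B (\<flat>A \<odot> \<flat>A) Z \<cdot> (\<one> B \<otimes> (coalg_comult A \<otimes> \<one> Z)))"
    by (subst swap_nat) simp_all
  also have "\<dots> = (\<one> \<flat>A \<otimes> swap B \<flat>A Z) \<cdot> swap B \<flat>A (\<flat>A \<odot> Z) \<cdot> (\<one> B \<otimes> dup A Z)"
    by (simp add: Comp_eq_extend[OF assoc_swap_tens] dup_def tens_merge)
  finally show ?thesis .
qed

text \<open>Obtained from \<open>dup_swap\<close> by composing with the inverse exchanges on both
  sides.\<close>

lemma tens_dup_swap:
  assumes [simp]: "Z \<in> Obj C" "B \<in> Obj C"
  shows "(\<one> B \<otimes> dup A Z) \<cdot> swap \<flat>A B Z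
    = swap \<flat>A B (\<flat>A \<odot> Z) \<cdot> (\<one> \<flat>A \<otimes> swap \<flat>A B Z) \<cdot> dup A (B \<odot> Z)"
proof -
  have "swap \<flat>A B (\<flat>A \<odot> Z) \<cdot> (\<one> \<flat>A \<otimes> swap \<flat>A B Z) \<cdot> dup A (B \<odot> Z)
      = swap \<flat>A B (\<flat>A \<odot> Z) \<cdot> (\<one> \<flat>A \<otimes> swap \<flat>A B Z) \<cdot> (dup A (B \<odot> Z) \<cdot> swap B \<flat>A Z) \<cdot> swap \<flat>A B Z"
    by (simp add: swap_swap)
  also have "\<dots> = (swap \<flat>A B (\<flat>A \<odot> Z) \<cdot> ((\<one> \<flat>A \<otimes> swap \<flat>A B Z) \<cdot> (\<one> \<flat>A \<otimes> swap B \<flat>A Z))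
      \<cdot> swap B \<flat>A (\<flat>A \<odot> Z))
      \<cdot> (\<one> B \<otimes> dup A Z) \<cdot> swap \<flat>A B Z"
    by (simp add: dup_swap)
  also have "\<dots> = (\<one> B \<otimes> dup A Z) \<cdot> swap \<flat>A B Z"
    by (simp add: tens_merge)
  finally show ?thesis by simp
qed

text \<open>Naturality carries the counit through the exchange and leaves a braiding with
  \<open>\<I>\<close>, which \<open>lunit_braid\<close> removes.\<close>

lemma del_swap:
  assumes [simp]: "Z \<in> Obj C" "B \<in> Obj C"
  shows "del A (B \<odot> Z) \<cdot> swap B \<flat>A Z = \<one> B \<otimes> del A Z"
proof -
  have "del A (B \<odot> Z) \<cdot> swap B \<flat>A Z
     = lunit C (B \<odot> Z) \<cdot> ((coalg_counit A \<otimes> (\<one> B \<otimes> \<one> Z)) \<cdot> swap B \<flat>A Z)"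
    by (simp add: del_def)
  also have "\<dots> = (lunit C (B \<odot> Z) \<cdot> assoc C \<I> B Z) \<cdot> (braid C B \<I> \<otimes> \<one> Z) \<cdot> ainv B \<I> Z
      \<cdot> (\<one> B \<otimes> (coalg_counit A \<otimes> \<one> Z))"
    using swap_nat[of "\<one> B" "coalg_counit A" "\<one> Z" B \<I> Z, symmetric]
    by (simp add: swap_def[of B \<I>])
  also have "\<dots> = ((lunit C B \<cdot> braid C B \<I>) \<otimes> \<one> Z) \<cdot> ainv B \<I> Z \<cdot> (\<one> B \<otimes> (coalg_counit A \<otimes> \<one> Z))"
    by (simp add: lunit_tens tens_merge del: Comp_assoc')
  also have "\<dots> = \<one> B \<otimes> del A Z"
    by (simp add: lunit_braid triangle[symmetric] tens_merge del_def)
  finally show ?thesis .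
qed

lemma tens_del_swap:
  assumes [simp]: "Z \<in> Obj C" "B \<in> Obj C"
  shows "(\<one> B \<otimes> del A Z) \<cdot> swap \<flat>A B Z = del A (B \<odot> Z)"
  by (simp add: del_swap[symmetric] swap_swap)

end

lemma coalg_ob_tensor [simp]: "coalg_ob (tensor_coalg C A B) = coalg_ob A \<odot> coalg_ob B"
  by (simp add: tensor_coalg_def Let_def)

lemma interchange_typing [simp]:
  assumes "A \<in> Obj C" "B \<in> Obj C" "D \<in> Obj C" "E \<in> Obj C"
  shows "interchange C A B D E \<in> Arr C" "Dom C (interchange C A B D E) = (A \<odot> B) \<odot> (D \<odot> E)"
    "Cod C (interchange C A B D E) = (A \<odot> D) \<odot> (B \<odot> E)"
  using assms by (simp_all add: interchange_def)

lemma interchange_swap: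
  assumes "A \<in> Obj C" "B \<in> Obj C" "D \<in> Obj C" "E \<in> Obj C"
  shows "interchange C A B D E = ainv A D (B \<odot> E) \<cdot> (\<one> A \<otimes> swap B D E) \<cdot> assoc C A B (D \<odot> E)"
  using assms by (simp add: interchange_def swap_def)

lemma interchange_nat:
  assumes [simp]: "f \<in> Arr C" "g \<in> Arr C" "h \<in> Arr C" "k \<in> Arr C"
    and cods: "Cod C f = A" "Cod C g = B" "Cod C h = D" "Cod C k = E"
  shows "interchange C A B D E \<cdot> ((f \<otimes> g) \<otimes> (h \<otimes> k))
    = ((f \<otimes> h) \<otimes> (g \<otimes> k)) \<cdot> interchange C (Dom C f) (Dom C g) (Dom C h) (Dom C k)"
proof -
  have [simp]: "A \<in> Obj C" "B \<in> Obj C" "D \<in> Obj C" "E \<in> Obj C" using cods by auto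
  have "interchange C A B D E \<cdot> ((f \<otimes> g) \<otimes> (h \<otimes> k))
    = ainv A D (B \<odot> E) \<cdot> (\<one> A \<otimes> swap B D E) \<cdot> (assoc C A B (D \<odot> E) \<cdot> ((f \<otimes> g) \<otimes> (h \<otimes> k)))"
    using cods by (simp add: interchange_swap)
  also have "\<dots> = ainv A D (B \<odot> E) \<cdot> (f \<otimes> (swap B D E \<cdot> (g \<otimes> (h \<otimes> k))))
      \<cdot> assoc C (Dom C f) (Dom C g) (Dom C h \<odot> Dom C k)"
    using cods by (subst assoc_nat) (simp_all add: tens_merge)
  also have "\<dots> = (ainv A D (B \<odot> E) \<cdot> (f \<otimes> (h \<otimes> (g \<otimes> k))))
      \<cdot> (\<one> (Dom C f) \<otimes> swap (Dom C g) (Dom C h) (Dom C k))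
     \<cdot> assoc C (Dom C f) (Dom C g) (Dom C h \<odot> Dom C k)"
    using cods by (subst swap_nat) (simp_all add: tens_merge)
  also have "\<dots> = ((f \<otimes> h) \<otimes> (g \<otimes> k)) \<cdot> interchange C (Dom C f) (Dom C g) (Dom C h) (Dom C k)"
    using cods by (subst ainv_nat) (simp_all add: interchange_swap)
  finally show ?thesis .
qed

section \<open>The tensor product of two coalgebras and its projections\<close>

context
  fixes A B :: "('o, 'm) coalgebra"
  assumes A [simp]: "is_coalgebra C A" and B [simp]: "is_coalgebra C B"
begin

text \<open>\<open>dup2\<close> is the action of the comultiplication of \<open>A \<otimes> B\<close> on the word \<open>A \<otimes> (B \<otimes> W)\<close>.\<close>

definition dup2 :: "'o \<Rightarrow> 'm" where
  "dup2 W = (\<one> \<flat>A \<otimes> swap \<flat>A \<flat>B (\<flat>B \<odot> W)) \<cdot> (\<one> \<flat>A \<otimes> (\<one> \<flat>A \<otimes> dup B W)) \<cdot> dup A (\<flat>B \<odot> W)"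

text \<open>The comultiplication of \<open>A \<otimes> B\<close> with its target flattened to the
  word \<open>A, B, A, B\<close>; \<open>comult_tensor\<close> restores the brackets.\<close>

definition comult2 :: "'m" where
  "comult2 = (\<one> \<flat>A \<otimes> swap \<flat>A \<flat>B \<flat>B) \<cdot> (\<one> \<flat>A \<otimes> (\<one> \<flat>A \<otimes> coalg_comult B)) \<cdot> dup A \<flat>B"

lemma dup2_typing [simp]:
  assumes "W \<in> Obj C"
  shows "dup2 W \<in> Arr C" "Dom C (dup2 W) = \<flat>A \<odot> (\<flat>B \<odot> W)"
      "Cod C (dup2 W) = \<flat>A \<odot> (\<flat>B \<odot> (\<flat>A \<odot> (\<flat>B \<odot> W)))"
  using assms by (simp_all add: dup2_def)

lemma comult2_typing [simp]:
  "comult2 \<in> Arr C" "Dom C comult2 = \<flat>A \<odot> \<flat>B" "Cod C comult2 = \<flat>A \<odot> (\<flat>B \<odot> (\<flat>A \<odot> \<flat>B))"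
  by (simp_all add: comult2_def)

lemma comult_tensor: "coalg_comult (tensor_coalg C A B) = ainv \<flat>A \<flat>B (\<flat>A \<odot> \<flat>B) \<cdot> comult2"
proof -
  have "coalg_comult (tensor_coalg C A B) = ainv \<flat>A \<flat>B (\<flat>A \<odot> \<flat>B) \<cdot> (\<one> \<flat>A \<otimes> swap \<flat>A \<flat>B \<flat>B)
      \<cdot> (assoc C \<flat>A \<flat>A (\<flat>B \<odot> \<flat>B) \<cdot> ((\<one> \<flat>A \<otimes> \<one> \<flat>A) \<otimes> coalg_comult B)) \<cdot> (coalg_comult A \<otimes> \<one> \<flat>B)"
    by (simp add: tensor_coalg_def Let_def interchange_swap tens_merge)
  also have "\<dots> = ainv \<flat>A \<flat>B (\<flat>A \<odot> \<flat>B) \<cdot> comult2"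
    by (subst assoc_nat) (simp_all add: comult2_def dup_def)
  finally show ?thesis .
qed

lemma counit_tensor: "coalg_counit (tensor_coalg C A B) = lunit C \<I>
    \<cdot> (coalg_counit A \<otimes> coalg_counit B)"
  by (simp add: tensor_coalg_def Let_def)

lemma tensor_typing [simp]:
  "coalg_comult (tensor_coalg C A B) \<in> Arr C" "Dom C (coalg_comult (tensor_coalg C A B)) = \<flat>A \<odot> \<flat>B"
  "Cod C (coalg_comult (tensor_coalg C A B)) = (\<flat>A \<odot> \<flat>B) \<odot> (\<flat>A \<odot> \<flat>B)"
  "coalg_counit (tensor_coalg C A B) \<in> Arr C"
      "Dom C (coalg_counit (tensor_coalg C A B)) = \<flat>A \<odot> \<flat>B"
      "Cod C (coalg_counit (tensor_coalg C A B)) = \<I>"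
  by (simp_all add: comult_tensor counit_tensor)

text \<open>Flattening all brackets turns the comultiplication of the first factor of
  \<open>(A \<odot> B) \<odot> W\<close> into \<open>dup2\<close>. This moves coassociativity of the
  tensor product to words.\<close>

lemma tensor_act_comult:
  assumes [simp]: "W \<in> Obj C"
  shows "(\<one> \<flat>A \<otimes> (\<one> \<flat>B \<otimes> assoc C \<flat>A \<flat>B W)) \<cdot> assoc C \<flat>A \<flat>B ((\<flat>A \<odot> \<flat>B) \<odot> W)
      \<cdot> assoc C (\<flat>A \<odot> \<flat>B) (\<flat>A \<odot> \<flat>B) W
      \<cdot> (coalg_comult (tensor_coalg C A B) \<otimes> \<one> W) = dup2 W \<cdot> assoc C \<flat>A \<flat>B W"
proof -
  let ?f = "swap \<flat>A \<flat>B \<flat>B \<cdot> (\<one> \<flat>A \<otimes> coalg_comult B)"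
  \<comment> \<open>The rebracketing is done separately for the part built from \<open>B\<close>
    (fact \<open>f\<close>) and for the doubling of \<open>A\<close> (fact \<open>2\<close>); fact
    \<open>1\<close> brings the left-hand side into a form where both apply.\<close>
  have f: "(\<one> \<flat>B \<otimes> assoc C \<flat>A \<flat>B W) \<cdot> assoc C \<flat>B (\<flat>A \<odot> \<flat>B) W \<cdot> (?f \<otimes> \<one> W)
    = swap \<flat>A \<flat>B (\<flat>B \<odot> W) \<cdot> (\<one> \<flat>A \<otimes> dup B W) \<cdot> assoc C \<flat>A \<flat>B W"
  proof -
    have "(\<one> \<flat>B \<otimes> assoc C \<flat>A \<flat>B W) \<cdot> assoc C \<flat>B (\<flat>A \<odot> \<flat>B) W \<cdot> (?f \<otimes> \<one> W)
      = ((\<one> \<flat>B \<otimes> assoc C \<flat>A \<flat>B W) \<cdot> assoc C \<flat>B (\<flat>A \<odot> \<flat>B) W \<cdot> (swap \<flat>A \<flat>B \<flat>B \<otimes> \<one> W))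
          \<cdot> ((\<one> \<flat>A \<otimes> coalg_comult B) \<otimes> \<one> W)"
      by (simp add: tens_merge)
    also have "\<dots> = swap \<flat>A \<flat>B (\<flat>B \<odot> W) \<cdot> (\<one> \<flat>A \<otimes> assoc C \<flat>B \<flat>B W) \<cdot> (assoc C \<flat>A (\<flat>B \<odot> \<flat>B) W
        \<cdot> ((\<one> \<flat>A \<otimes> coalg_comult B) \<otimes> \<one> W))"
      by (simp add: swap_tens_last)
    also have "\<dots> = swap \<flat>A \<flat>B (\<flat>B \<odot> W) \<cdot> (\<one> \<flat>A \<otimes> dup B W) \<cdot> assoc C \<flat>A \<flat>B W"
      by (subst assoc_nat) (simp_all add: dup_def tens_merge)
    finally show ?thesis .
  qed
  have "assoc C \<flat>A \<flat>B ((\<flat>A \<odot> \<flat>B) \<odot> W) \<cdot> assoc C (\<flat>A \<odot> \<flat>B) (\<flat>A \<odot> \<flat>B) W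
      \<cdot> (coalg_comult (tensor_coalg C A B) \<otimes> \<one> W)
    = (\<one> \<flat>A \<otimes> assoc C \<flat>B (\<flat>A \<odot> \<flat>B) W) \<cdot> assoc C \<flat>A (\<flat>B \<odot> (\<flat>A \<odot> \<flat>B)) W \<cdot> (comult2 \<otimes> \<one> W)"
    by (simp add: Comp_eq_extend[OF pentagon] comult_tensor tens_merge)
  also have "\<dots> = (\<one> \<flat>A \<otimes> assoc C \<flat>B (\<flat>A \<odot> \<flat>B) W) \<cdot> (assoc C \<flat>A (\<flat>B \<odot> (\<flat>A \<odot> \<flat>B)) W
      \<cdot> ((\<one> \<flat>A \<otimes> ?f) \<otimes> \<one> W)) \<cdot> (dup A \<flat>B \<otimes> \<one> W)"
    by (simp add: comult2_def tens_merge)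
  also have "\<dots> = (\<one> \<flat>A \<otimes> (assoc C \<flat>B (\<flat>A \<odot> \<flat>B) W \<cdot> (?f \<otimes> \<one> W))) \<cdot> assoc C \<flat>A (\<flat>A \<odot> \<flat>B) W
      \<cdot> (dup A \<flat>B \<otimes> \<one> W)"
    by (subst assoc_nat) (simp_all add: tens_merge)
  finally have 1: "(\<one> \<flat>A \<otimes> (\<one> \<flat>B \<otimes> assoc C \<flat>A \<flat>B W)) \<cdot> assoc C \<flat>A \<flat>B ((\<flat>A \<odot> \<flat>B) \<odot> W)
      \<cdot> assoc C (\<flat>A \<odot> \<flat>B) (\<flat>A \<odot> \<flat>B) W
      \<cdot> (coalg_comult (tensor_coalg C A B) \<otimes> \<one> W)
    = (\<one> \<flat>A \<otimes> ((\<one> \<flat>B \<otimes> assoc C \<flat>A \<flat>B W) \<cdot> assoc C \<flat>B (\<flat>A \<odot> \<flat>B) W \<cdot> (?f \<otimes> \<one> W)))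
        \<cdot> assoc C \<flat>A (\<flat>A \<odot> \<flat>B) W \<cdot> (dup A \<flat>B \<otimes> \<one> W)"
    by (simp add: tens_merge)
  have "(\<one> \<flat>A \<otimes> assoc C \<flat>A \<flat>B W) \<cdot> assoc C \<flat>A (\<flat>A \<odot> \<flat>B) W \<cdot> (dup A \<flat>B \<otimes> \<one> W)
    = ((\<one> \<flat>A \<otimes> assoc C \<flat>A \<flat>B W) \<cdot> assoc C \<flat>A (\<flat>A \<odot> \<flat>B) W \<cdot> (assoc C \<flat>A \<flat>A \<flat>B \<otimes> \<one> W))
        \<cdot> ((coalg_comult A \<otimes> \<one> \<flat>B) \<otimes> \<one> W)"
    by (simp add: dup_def tens_merge)
  also have "\<dots> = assoc C \<flat>A \<flat>A (\<flat>B \<odot> W) \<cdot> (assoc C (\<flat>A \<odot> \<flat>A) \<flat>B W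
      \<cdot> ((coalg_comult A \<otimes> \<one> \<flat>B) \<otimes> \<one> W))"
    by (simp add: pentagon[symmetric])
  also have "\<dots> = dup A (\<flat>B \<odot> W) \<cdot> assoc C \<flat>A \<flat>B W"
    by (subst assoc_nat) (simp_all add: dup_def)
  finally have 2: "(\<one> \<flat>A \<otimes> assoc C \<flat>A \<flat>B W) \<cdot> assoc C \<flat>A (\<flat>A \<odot> \<flat>B) W \<cdot> (dup A \<flat>B \<otimes> \<one> W)
      = dup A (\<flat>B \<odot> W) \<cdot> assoc C \<flat>A \<flat>B W" .
  have "(\<one> \<flat>A \<otimes> ((\<one> \<flat>B \<otimes> assoc C \<flat>A \<flat>B W) \<cdot> assoc C \<flat>B (\<flat>A \<odot> \<flat>B) W \<cdot> (?f \<otimes> \<one> W)))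
      \<cdot> assoc C \<flat>A (\<flat>A \<odot> \<flat>B) W \<cdot> (dup A \<flat>B \<otimes> \<one> W)
    = (\<one> \<flat>A \<otimes> (swap \<flat>A \<flat>B (\<flat>B \<odot> W) \<cdot> (\<one> \<flat>A \<otimes> dup B W))) \<cdot> ((\<one> \<flat>A \<otimes> assoc C \<flat>A \<flat>B W)
        \<cdot> assoc C \<flat>A (\<flat>A \<odot> \<flat>B) W \<cdot> (dup A \<flat>B \<otimes> \<one> W))"
    by (simp only: f) (simp add: tens_merge)
  also have "\<dots> = dup2 W \<cdot> assoc C \<flat>A \<flat>B W"
    unfolding 2 dup2_def by (simp add: tens_merge)
  finally show ?thesis using 1 by simp
qed

text \<open>Both sides are brought to the common form \<open>?m\<close>, in which all copies of
  \<open>A\<close> and then all copies of \<open>B\<close> are made before any letters are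
  exchanged. On the left-hand side this uses coassociativity of \<open>A\<close> and of
  \<open>B\<close>.\<close>

lemma dup2_comult2: "dup2 (\<flat>A \<odot> \<flat>B) \<cdot> comult2 = (\<one> \<flat>A \<otimes> (\<one> \<flat>B \<otimes> comult2)) \<cdot> comult2"
proof -
  let ?c = "coalg_comult B"
  let ?f = "swap \<flat>A \<flat>B \<flat>B \<cdot> (\<one> \<flat>A \<otimes> ?c)"
  let ?m = "(\<one> \<flat>A \<otimes> (swap \<flat>A \<flat>B (\<flat>B \<odot> (\<flat>A \<odot> \<flat>B)) \<cdot> (\<one> \<flat>A \<otimes> (\<one> \<flat>B \<otimes> swap \<flat>A \<flat>B \<flat>B))
      \<cdot> (\<one> \<flat>A \<otimes> swap \<flat>A \<flat>B (\<flat>B \<odot> \<flat>B))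
     \<cdot> (\<one> \<flat>A \<otimes> (\<one> \<flat>A \<otimes> ((\<one> \<flat>B \<otimes> ?c) \<cdot> ?c))))) \<cdot> (\<one> \<flat>A \<otimes> dup A \<flat>B) \<cdot> dup A \<flat>B"
  have "dup2 (\<flat>A \<odot> \<flat>B) \<cdot> comult2 = (\<one> \<flat>A \<otimes> (swap \<flat>A \<flat>B (\<flat>B \<odot> (\<flat>A \<odot> \<flat>B)) \<cdot> (\<one> \<flat>A \<otimes> dup B (\<flat>A \<odot> \<flat>B))))
      \<cdot> (dup A (\<flat>B \<odot> (\<flat>A \<odot> \<flat>B)) \<cdot> (\<one> \<flat>A \<otimes> ?f)) \<cdot> dup A \<flat>B"
    by (simp add: dup2_def comult2_def tens_merge)
  also have "\<dots> = (\<one> \<flat>A \<otimes> (swap \<flat>A \<flat>B (\<flat>B \<odot> (\<flat>A \<odot> \<flat>B)) \<cdot> (\<one> \<flat>A \<otimes> (dup B (\<flat>A \<odot> \<flat>B) \<cdot> swap \<flat>A \<flat>B \<flat>B))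
      \<cdot> (\<one> \<flat>A \<otimes> (\<one> \<flat>A \<otimes> ?c))))
      \<cdot> (dup A (\<flat>A \<odot> \<flat>B) \<cdot> dup A \<flat>B)"
    by (simp add: dup_nat tens_merge)
  also have "\<dots> = (\<one> \<flat>A \<otimes> (swap \<flat>A \<flat>B (\<flat>B \<odot> (\<flat>A \<odot> \<flat>B)) \<cdot> (\<one> \<flat>A \<otimes> (\<one> \<flat>B \<otimes> swap \<flat>A \<flat>B \<flat>B))
      \<cdot> (\<one> \<flat>A \<otimes> swap \<flat>A \<flat>B (\<flat>B \<odot> \<flat>B))
     \<cdot> (\<one> \<flat>A \<otimes> (\<one> \<flat>A \<otimes> (dup B \<flat>B \<cdot> ?c))))) \<cdot> (\<one> \<flat>A \<otimes> dup A \<flat>B) \<cdot> dup A \<flat>B"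
    by (simp add: dup_swap dup_dup tens_merge)
  also have "\<dots> = ?m" by (simp add: dup_comult)
  finally have L: "dup2 (\<flat>A \<odot> \<flat>B) \<cdot> comult2 = ?m" .
  have "(\<one> \<flat>A \<otimes> (\<one> \<flat>B \<otimes> comult2)) \<cdot> comult2 = (\<one> \<flat>A \<otimes> ((\<one> \<flat>B \<otimes> (\<one> \<flat>A \<otimes> ?f)) \<cdot> ((\<one> \<flat>B \<otimes> dup A \<flat>B)
      \<cdot> swap \<flat>A \<flat>B \<flat>B) \<cdot> (\<one> \<flat>A \<otimes> ?c))) \<cdot> dup A \<flat>B"
    by (simp add: comult2_def tens_merge)
  also have "\<dots> = (\<one> \<flat>A \<otimes> (((\<one> \<flat>B \<otimes> (\<one> \<flat>A \<otimes> ?f)) \<cdot> swap \<flat>A \<flat>B (\<flat>A \<odot> \<flat>B)) \<cdot> (\<one> \<flat>A \<otimes> swap \<flat>A \<flat>B \<flat>B)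
      \<cdot> (dup A (\<flat>B \<odot> \<flat>B) \<cdot> (\<one> \<flat>A \<otimes> ?c)))) \<cdot> dup A \<flat>B"
    by (simp add: tens_dup_swap)
  also have "\<dots> = (\<one> \<flat>A \<otimes> (((\<one> \<flat>B \<otimes> (\<one> \<flat>A \<otimes> ?f)) \<cdot> swap \<flat>A \<flat>B (\<flat>A \<odot> \<flat>B)) \<cdot> (\<one> \<flat>A \<otimes> swap \<flat>A \<flat>B \<flat>B)
      \<cdot> (\<one> \<flat>A \<otimes> (\<one> \<flat>A \<otimes> ?c)))) \<cdot> (\<one> \<flat>A \<otimes> dup A \<flat>B) \<cdot> dup A \<flat>B"
    by (subst dup_nat) (simp_all add: tens_merge)
  also have "\<dots> = (\<one> \<flat>A \<otimes> (swap \<flat>A \<flat>B (\<flat>B \<odot> (\<flat>A \<odot> \<flat>B)) \<cdot> (\<one> \<flat>A \<otimes> (\<one> \<flat>B \<otimes> swap \<flat>A \<flat>B \<flat>B))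
      \<cdot> (\<one> \<flat>A \<otimes> ((\<one> \<flat>B \<otimes> (\<one> \<flat>A \<otimes> ?c)) \<cdot> swap \<flat>A \<flat>B \<flat>B)) \<cdot> (\<one> \<flat>A \<otimes> (\<one> \<flat>A \<otimes> ?c))))
      \<cdot> (\<one> \<flat>A \<otimes> dup A \<flat>B) \<cdot> dup A \<flat>B"
    using swap_nat[of "\<one> \<flat>A" "\<one> \<flat>B" ?f "\<flat>A" "\<flat>B"
        "\<flat>B \<odot> (\<flat>A \<odot> \<flat>B)", symmetric] by (simp add: tens_merge)
  also have "\<dots> = ?m"
    using swap_nat[of "\<one> \<flat>A" "\<one> \<flat>B" ?c "\<flat>A" "\<flat>B" "\<flat>B \<odot> \<flat>B", symmetric] by (simp add: tens_merge)
  finally show ?thesis using L by simp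
qed

lemma tensor_coassoc:
  "assoc C (\<flat>A \<odot> \<flat>B) (\<flat>A \<odot> \<flat>B) (\<flat>A \<odot> \<flat>B) \<cdot> (coalg_comult (tensor_coalg C A B) \<otimes> \<one> (\<flat>A \<odot> \<flat>B))
      \<cdot> coalg_comult (tensor_coalg C A B)
    = (\<one> (\<flat>A \<odot> \<flat>B) \<otimes> coalg_comult (tensor_coalg C A B)) \<cdot> coalg_comult (tensor_coalg C A B)"
proof -
  \<comment> \<open>The isomorphism flattening the target, so that \<open>tensor_act_comult\<close>
    applies.\<close>
  let ?k = "(\<one> \<flat>A \<otimes> (\<one> \<flat>B \<otimes> assoc C \<flat>A \<flat>B (\<flat>A \<odot> \<flat>B))) \<cdot> assoc C \<flat>A \<flat>B ((\<flat>A \<odot> \<flat>B) \<odot> (\<flat>A \<odot> \<flat>B))"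
  have "?k \<cdot> (assoc C (\<flat>A \<odot> \<flat>B) (\<flat>A \<odot> \<flat>B) (\<flat>A \<odot> \<flat>B)
      \<cdot> (coalg_comult (tensor_coalg C A B) \<otimes> \<one> (\<flat>A \<odot> \<flat>B)) \<cdot> coalg_comult (tensor_coalg C A B))
    = ((\<one> \<flat>A \<otimes> (\<one> \<flat>B \<otimes> assoc C \<flat>A \<flat>B (\<flat>A \<odot> \<flat>B))) \<cdot> assoc C \<flat>A \<flat>B ((\<flat>A \<odot> \<flat>B) \<odot> (\<flat>A \<odot> \<flat>B))
        \<cdot> assoc C (\<flat>A \<odot> \<flat>B) (\<flat>A \<odot> \<flat>B) (\<flat>A \<odot> \<flat>B)
      \<cdot> (coalg_comult (tensor_coalg C A B) \<otimes> \<one> (\<flat>A \<odot> \<flat>B))) \<cdot> coalg_comult (tensor_coalg C A B)"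
          by simp
  also have "\<dots> = dup2 (\<flat>A \<odot> \<flat>B) \<cdot> comult2"
    unfolding tensor_act_comult[OF tens_Obj[OF coalgebra_typing(1)[OF A] coalgebra_typing(1)[OF B]]]
    by (simp add: comult_tensor)
  also have "\<dots> = (\<one> \<flat>A \<otimes> (\<one> \<flat>B \<otimes> (assoc C \<flat>A \<flat>B (\<flat>A \<odot> \<flat>B) \<cdot> coalg_comult (tensor_coalg C A B))))
      \<cdot> assoc C \<flat>A \<flat>B (\<flat>A \<odot> \<flat>B) \<cdot> coalg_comult (tensor_coalg C A B)"
    by (simp add: dup2_comult2 comult_tensor)
  also have "\<dots> = (\<one> \<flat>A \<otimes> (\<one> \<flat>B \<otimes> assoc C \<flat>A \<flat>B (\<flat>A \<odot> \<flat>B)))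
      \<cdot> ((\<one> \<flat>A \<otimes> (\<one> \<flat>B \<otimes> coalg_comult (tensor_coalg C A B))) \<cdot> assoc C \<flat>A \<flat>B (\<flat>A \<odot> \<flat>B))
      \<cdot> coalg_comult (tensor_coalg C A B)"
    by (simp add: tens_merge)
  also have "\<dots> = ?k \<cdot> ((\<one> (\<flat>A \<odot> \<flat>B) \<otimes> coalg_comult (tensor_coalg C A B))
      \<cdot> coalg_comult (tensor_coalg C A B))"
    using assoc_nat[of "\<one> \<flat>A" "\<one> \<flat>B" "coalg_comult (tensor_coalg C A B)" "\<flat>A" "\<flat>B"
        "(\<flat>A \<odot> \<flat>B) \<odot> (\<flat>A \<odot> \<flat>B)", symmetric] by simp
  finally show ?thesis
    by (rule iso_cancel_left[rotated 1]) (simp_all add: iso_comp iso_tens iso_Ide)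
qed

text \<open>The braiding of \<open>A \<odot> B\<close> with itself splits into exchanges of single
  letters. One of them undoes the exchange inside \<open>comult2\<close>; those remaining exchange
  the two copies of \<open>A\<close> and the two copies of \<open>B\<close>, which cocommutativity
  absorbs.\<close>

lemma tensor_cocommutative:
  assumes "is_cocommutative C A" "is_cocommutative C B"
  shows "is_cocommutative C (tensor_coalg C A B)"
proof -
  have swapB: "braid C \<flat>B \<flat>B \<cdot> coalg_comult B = coalg_comult B"
    using assms(2) by (simp add: is_cocommutative_def)
  have "assoc C \<flat>A \<flat>B (\<flat>A \<odot> \<flat>B) \<cdot> (braid C (\<flat>A \<odot> \<flat>B) (\<flat>A \<odot> \<flat>B) \<cdot> coalg_comult (tensor_coalg C A B))
    = (assoc C \<flat>A \<flat>B (\<flat>A \<odot> \<flat>B) \<cdot> swap \<flat>A (\<flat>A \<odot> \<flat>B) \<flat>B) \<cdot> (\<one> \<flat>A \<otimes> braid C \<flat>B (\<flat>A \<odot> \<flat>B)) \<cdot> comult2"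
    by (simp add: braid_tens_left comult_tensor)
  also have "\<dots> = (\<one> \<flat>A \<otimes> swap \<flat>A \<flat>B \<flat>B) \<cdot> swap \<flat>A \<flat>A (\<flat>B \<odot> \<flat>B) \<cdot> (\<one> \<flat>A \<otimes> (assoc C \<flat>A \<flat>B \<flat>B
      \<cdot> braid C \<flat>B (\<flat>A \<odot> \<flat>B))) \<cdot> comult2"
    by (simp add: assoc_swap_tens tens_merge)
  also have "\<dots> = (\<one> \<flat>A \<otimes> swap \<flat>A \<flat>B \<flat>B) \<cdot> swap \<flat>A \<flat>A (\<flat>B \<odot> \<flat>B) \<cdot> (\<one> \<flat>A \<otimes> ((\<one> \<flat>A \<otimes> braid C \<flat>B \<flat>B)
      \<cdot> (swap \<flat>B \<flat>A \<flat>B \<cdot> swap \<flat>A \<flat>B \<flat>B) \<cdot> (\<one> \<flat>A \<otimes> coalg_comult B))) \<cdot> dup A \<flat>B"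
    by (simp add: braid_tens_right comult2_def tens_merge del: swap_swap)
  also have "\<dots> = (\<one> \<flat>A \<otimes> swap \<flat>A \<flat>B \<flat>B) \<cdot> (swap \<flat>A \<flat>A (\<flat>B \<odot> \<flat>B)
      \<cdot> (\<one> \<flat>A \<otimes> (\<one> \<flat>A \<otimes> coalg_comult B))) \<cdot> dup A \<flat>B"
    by (simp add: tens_merge swapB)
  also have "\<dots> = (\<one> \<flat>A \<otimes> swap \<flat>A \<flat>B \<flat>B) \<cdot> (\<one> \<flat>A \<otimes> (\<one> \<flat>A \<otimes> coalg_comult B)) \<cdot> (swap \<flat>A \<flat>A \<flat>B
      \<cdot> dup A \<flat>B)"
    by (subst swap_nat) simp_all
  also have "\<dots> = assoc C \<flat>A \<flat>B (\<flat>A \<odot> \<flat>B) \<cdot> coalg_comult (tensor_coalg C A B)"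
    by (simp add: comult_tensor swap_dup assms(1)) (simp add: comult2_def)
  finally have "braid C (\<flat>A \<odot> \<flat>B) (\<flat>A \<odot> \<flat>B) \<cdot> coalg_comult (tensor_coalg C A B)
      = coalg_comult (tensor_coalg C A B)"
    by (rule iso_cancel_left[rotated 1]) simp_all
  then show ?thesis by (simp add: is_cocommutative_def)
qed

lemma tensor_left_counit:
  "lunit C (\<flat>A \<odot> \<flat>B) \<cdot> (coalg_counit (tensor_coalg C A B) \<otimes> \<one> (\<flat>A \<odot> \<flat>B))
      \<cdot> coalg_comult (tensor_coalg C A B) = \<one> (\<flat>A \<odot> \<flat>B)"
proof -
  have act: "lunit C W \<cdot> (coalg_counit (tensor_coalg C A B) \<otimes> \<one> W) = del A W \<cdot> (\<one> \<flat>A \<otimes> del B W)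
      \<cdot> assoc C \<flat>A \<flat>B W"
    if [simp]: "W \<in> Obj C" for W
  proof -
    have nat: "assoc C \<I> \<I> W \<cdot> ((coalg_counit A \<otimes> \<one> \<I>) \<otimes> \<one> W)
        = (coalg_counit A \<otimes> \<one> (\<I> \<odot> W)) \<cdot> assoc C \<flat>A \<I> W"
      using assoc_nat[of "coalg_counit A" "\<one> \<I>" "\<one> W" \<I> \<I> W] by simp
    have "del A W \<cdot> (\<one> \<flat>A \<otimes> del B W) \<cdot> assoc C \<flat>A \<flat>B W
      = (del A W \<cdot> (\<one> \<flat>A \<otimes> lunit C W)) \<cdot> ((\<one> \<flat>A \<otimes> (coalg_counit B \<otimes> \<one> W)) \<cdot> assoc C \<flat>A \<flat>B W)"
      by (simp add: del_def[of B] tens_merge)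
    also have "\<dots> = lunit C W \<cdot> del A (\<I> \<odot> W) \<cdot> (assoc C \<flat>A \<I> W \<cdot> ((\<one> \<flat>A \<otimes> coalg_counit B) \<otimes> \<one> W))"
      using assoc_nat[of "\<one> \<flat>A" "coalg_counit B" "\<one> W" "\<flat>A" \<I> W] by (simp add: del_nat)
    also have "\<dots> = lunit C W \<cdot> lunit C (\<I> \<odot> W) \<cdot> ((coalg_counit A \<otimes> (\<one> \<I> \<otimes> \<one> W)) \<cdot> assoc C \<flat>A \<I> W)
        \<cdot> ((\<one> \<flat>A \<otimes> coalg_counit B) \<otimes> \<one> W)"
      by (simp add: del_def)
    also have "\<dots> = lunit C W \<cdot> (lunit C (\<I> \<odot> W) \<cdot> assoc C \<I> \<I> W) \<cdot> ((coalg_counit A \<otimes> \<one> \<I>) \<otimes> \<one> W)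
        \<cdot> ((\<one> \<flat>A \<otimes> coalg_counit B) \<otimes> \<one> W)"
      by (simp add: Comp_eq_extend[OF nat])
    also have "\<dots> = lunit C W \<cdot> (coalg_counit (tensor_coalg C A B) \<otimes> \<one> W)"
      by (simp add: lunit_tens tens_merge counit_tensor)
    finally show ?thesis by simp
  qed
  have "lunit C (\<flat>A \<odot> \<flat>B) \<cdot> (coalg_counit (tensor_coalg C A B) \<otimes> \<one> (\<flat>A \<odot> \<flat>B))
      \<cdot> coalg_comult (tensor_coalg C A B)
    = (lunit C (\<flat>A \<odot> \<flat>B) \<cdot> (coalg_counit (tensor_coalg C A B) \<otimes> \<one> (\<flat>A \<odot> \<flat>B)))
        \<cdot> coalg_comult (tensor_coalg C A B)" by simp
  also have "\<dots> = del A (\<flat>A \<odot> \<flat>B) \<cdot> (\<one> \<flat>A \<otimes> del B (\<flat>A \<odot> \<flat>B)) \<cdot> comult2"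
    by (subst act) (simp_all add: comult_tensor)
  also have "\<dots> = del A (\<flat>A \<odot> \<flat>B) \<cdot> (\<one> \<flat>A \<otimes> ((del B (\<flat>A \<odot> \<flat>B) \<cdot> swap \<flat>A \<flat>B \<flat>B)
      \<cdot> (\<one> \<flat>A \<otimes> coalg_comult B))) \<cdot> dup A \<flat>B"
    by (simp add: comult2_def tens_merge)
  also have "\<dots> = \<one> (\<flat>A \<odot> \<flat>B)"
    by (simp add: del_swap tens_merge del_comult del_dup del: Comp_assoc')
  finally show ?thesis .
qed

definition proj1 :: "'m" where "proj1 = runit C \<flat>A \<cdot> (\<one> \<flat>A \<otimes> coalg_counit B)"
definition proj2 :: "'m" where "proj2 = lunit C \<flat>B \<cdot> (coalg_counit A \<otimes> \<one> \<flat>B)"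

lemma proj_typing [simp]:
  "proj1 \<in> Arr C" "Dom C proj1 = \<flat>A \<odot> \<flat>B" "Cod C proj1 = \<flat>A"
  "proj2 \<in> Arr C" "Dom C proj2 = \<flat>A \<odot> \<flat>B" "Cod C proj2 = \<flat>B"
  by (simp_all add: proj1_def proj2_def)

text \<open>On words a projection erases the letter that it drops. With \<open>proj2_ainv\<close>
  this reduces the laws of a product to the calculus of \<open>del\<close>, \<open>dup\<close> and
  \<open>swap\<close>.\<close>

lemma proj1_ainv:
  assumes [simp]: "W \<in> Obj C"
  shows "(proj1 \<otimes> \<one> W) \<cdot> ainv \<flat>A \<flat>B W = \<one> \<flat>A \<otimes> del B W"
proof -
  have "(proj1 \<otimes> \<one> W) \<cdot> ainv \<flat>A \<flat>B W = (runit C \<flat>A \<otimes> \<one> W) \<cdot> ((\<one> \<flat>A \<otimes> coalg_counit B) \<otimes> \<one> W)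
      \<cdot> ainv \<flat>A \<flat>B W"
    by (simp add: proj1_def tens_merge)
  also have "\<dots> = (runit C \<flat>A \<otimes> \<one> W) \<cdot> (ainv \<flat>A \<I> W \<cdot> (\<one> \<flat>A \<otimes> (coalg_counit B \<otimes> \<one> W)))"
    by (subst ainv_nat) simp_all
  also have "\<dots> = \<one> \<flat>A \<otimes> del B W"
    by (simp add: triangle[symmetric] del_def tens_merge)
  finally show ?thesis .
qed

lemma proj2_ainv:
  assumes [simp]: "W \<in> Obj C"
  shows "(proj2 \<otimes> \<one> W) \<cdot> ainv \<flat>A \<flat>B W = del A (\<flat>B \<odot> W)"
proof -
  have "(proj2 \<otimes> \<one> W) \<cdot> ainv \<flat>A \<flat>B W = (lunit C \<flat>B \<otimes> \<one> W) \<cdot> ((coalg_counit A \<otimes> \<one> \<flat>B) \<otimes> \<one> W)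
      \<cdot> ainv \<flat>A \<flat>B W"
    by (simp add: proj2_def tens_merge)
  also have "\<dots> = (lunit C \<flat>B \<otimes> \<one> W) \<cdot> (ainv \<I> \<flat>B W \<cdot> (coalg_counit A \<otimes> (\<one> \<flat>B \<otimes> \<one> W)))"
    by (subst ainv_nat) simp_all
  also have "\<dots> = del A (\<flat>B \<odot> W)"
    by (simp add: lunit_tens[symmetric] del_def tens_merge)
  finally show ?thesis .
qed

lemma proj2_del: "proj2 = del A \<flat>B"
  by (simp add: proj2_def del_def)

text \<open>Splits \<open>f \<otimes> g\<close> so that \<open>f\<close> acts first and stands next
  to the inverse associator, where \<open>proj1_ainv\<close> or \<open>proj2_ainv\<close> can
  rewrite it.\<close>

lemma tens_Comp_tensor:
  assumes "f \<in> Arr C" "g \<in> Arr C" "Dom C f = \<flat>A \<odot> \<flat>B" "Dom C g = \<flat>A \<odot> \<flat>B"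
  shows "(f \<otimes> g) \<cdot> coalg_comult (tensor_coalg C A B)
     = (\<one> (Cod C f) \<otimes> g) \<cdot> ((f \<otimes> \<one> (\<flat>A \<odot> \<flat>B)) \<cdot> ainv \<flat>A \<flat>B (\<flat>A \<odot> \<flat>B)) \<cdot> comult2"
  using assms by (simp add: comult_tensor tens_merge)

lemma proj1_coalg_morphism: "coalg_comult A \<cdot> proj1 = (proj1 \<otimes> proj1)
    \<cdot> coalg_comult (tensor_coalg C A B)"
proof -
  have "(proj1 \<otimes> proj1) \<cdot> coalg_comult (tensor_coalg C A B) = (\<one> \<flat>A \<otimes> proj1)
      \<cdot> (\<one> \<flat>A \<otimes> ((del B (\<flat>A \<odot> \<flat>B) \<cdot> swap \<flat>A \<flat>B \<flat>B) \<cdot> (\<one> \<flat>A \<otimes> coalg_comult B))) \<cdot> dup A \<flat>B"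
    by (simp add: tens_Comp_tensor proj1_ainv comult2_def tens_merge)
  also have "\<dots> = (\<one> \<flat>A \<otimes> proj1) \<cdot> dup A \<flat>B"
    by (simp add: del_swap tens_merge del_comult del: Comp_assoc')
  also have "\<dots> = (\<one> \<flat>A \<otimes> runit C \<flat>A) \<cdot> ((\<one> \<flat>A \<otimes> (\<one> \<flat>A \<otimes> coalg_counit B)) \<cdot> dup A \<flat>B)"
    by (simp add: proj1_def tens_merge)
  also have "\<dots> = (\<one> \<flat>A \<otimes> runit C \<flat>A) \<cdot> dup A \<I> \<cdot> (\<one> \<flat>A \<otimes> coalg_counit B)"
    by (simp add: dup_nat)
  also have "\<dots> = ((\<one> \<flat>A \<otimes> runit C \<flat>A) \<cdot> assoc C \<flat>A \<flat>A \<I>) \<cdot> (coalg_comult A \<otimes> \<one> \<I>)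
      \<cdot> (\<one> \<flat>A \<otimes> coalg_counit B)"
    by (simp add: dup_def)
  also have "\<dots> = (runit C (\<flat>A \<odot> \<flat>A) \<cdot> (coalg_comult A \<otimes> \<one> \<I>)) \<cdot> (\<one> \<flat>A \<otimes> coalg_counit B)"
    by (simp add: runit_tens)
  also have "\<dots> = coalg_comult A \<cdot> proj1"
    by (subst runit_nat) (simp_all add: proj1_def)
  finally show ?thesis by simp
qed

lemma proj2_coalg_morphism: "coalg_comult B \<cdot> proj2 = (proj2 \<otimes> proj2)
    \<cdot> coalg_comult (tensor_coalg C A B)"
proof -
  have "(proj2 \<otimes> proj2) \<cdot> coalg_comult (tensor_coalg C A B) = (\<one> \<flat>B \<otimes> del A \<flat>B)
      \<cdot> del A (\<flat>B \<odot> (\<flat>A \<odot> \<flat>B)) \<cdot> comult2"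
    by (simp add: tens_Comp_tensor proj2_ainv) (simp add: proj2_del)
  also have "\<dots> = (del A (\<flat>B \<odot> \<flat>B) \<cdot> (\<one> \<flat>A \<otimes> (\<one> \<flat>B \<otimes> del A \<flat>B))) \<cdot> comult2"
    by (subst del_nat) simp_all
  also have "\<dots> = del A (\<flat>B \<odot> \<flat>B) \<cdot> (\<one> \<flat>A \<otimes> (((\<one> \<flat>B \<otimes> del A \<flat>B) \<cdot> swap \<flat>A \<flat>B \<flat>B)
      \<cdot> (\<one> \<flat>A \<otimes> coalg_comult B))) \<cdot> dup A \<flat>B"
    by (simp add: comult2_def tens_merge)
  also have "\<dots> = del A (\<flat>B \<odot> \<flat>B) \<cdot> (\<one> \<flat>A \<otimes> (coalg_comult B \<cdot> del A \<flat>B)) \<cdot> dup A \<flat>B"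
    by (simp only: tens_del_swap A B coalgebra_typing) (simp add: del_nat)
  also have "\<dots> = (del A (\<flat>B \<odot> \<flat>B) \<cdot> (\<one> \<flat>A \<otimes> coalg_comult B)) \<cdot> ((\<one> \<flat>A \<otimes> del A \<flat>B) \<cdot> dup A \<flat>B)"
    by (simp add: tens_merge)
  also have "\<dots> = coalg_comult B \<cdot> proj2"
    by (simp add: tens_del_dup del_nat proj2_del)
  finally show ?thesis by simp
qed

text \<open>Of the word \<open>A, B, A, B\<close> only the first and the last letter survive, which
  cancels both doublings. This equation is the uniqueness half of the universal property of the
  product.\<close>

lemma proj_pair: "(proj1 \<otimes> proj2) \<cdot> coalg_comult (tensor_coalg C A B) = \<one> (\<flat>A \<odot> \<flat>B)"
proof -
  have "(proj1 \<otimes> proj2) \<cdot> coalg_comult (tensor_coalg C A B) = (\<one> \<flat>A \<otimes> (proj2 \<cdot> del B (\<flat>A \<odot> \<flat>B)))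
      \<cdot> comult2"
    by (simp add: tens_Comp_tensor proj1_ainv tens_merge)
  also have "\<dots> = (\<one> \<flat>A \<otimes> (del B \<flat>B \<cdot> (\<one> \<flat>B \<otimes> del A \<flat>B))) \<cdot> comult2"
    by (simp add: del_nat proj2_del)
  also have "\<dots> = (\<one> \<flat>A \<otimes> del B \<flat>B) \<cdot> (\<one> \<flat>A \<otimes> (((\<one> \<flat>B \<otimes> del A \<flat>B) \<cdot> swap \<flat>A \<flat>B \<flat>B)
      \<cdot> (\<one> \<flat>A \<otimes> coalg_comult B))) \<cdot> dup A \<flat>B"
    by (simp add: comult2_def tens_merge)
  also have "\<dots> = (\<one> \<flat>A \<otimes> (del B \<flat>B \<cdot> coalg_comult B)) \<cdot> ((\<one> \<flat>A \<otimes> del A \<flat>B) \<cdot> dup A \<flat>B)"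
    by (simp only: tens_del_swap A B coalgebra_typing) (simp add: del_nat tens_merge)
  also have "\<dots> = \<one> (\<flat>A \<odot> \<flat>B)"
    by (simp add: tens_del_dup del_comult)
  finally show ?thesis .
qed

lemma proj_counit:
  "coalg_counit A \<cdot> proj1 = coalg_counit (tensor_coalg C A B)"
      "coalg_counit B \<cdot> proj2 = coalg_counit (tensor_coalg C A B)"
proof -
  have "coalg_counit A \<cdot> proj1 = (runit C \<I> \<cdot> (coalg_counit A \<otimes> \<one> \<I>)) \<cdot> (\<one> \<flat>A \<otimes> coalg_counit B)"
    by (simp add: runit_nat proj1_def)
  then show "coalg_counit A \<cdot> proj1 = coalg_counit (tensor_coalg C A B)"
    by (simp add: counit_tensor tens_merge lunit_unit)
  have "coalg_counit B \<cdot> proj2 = (lunit C \<I> \<cdot> (\<one> \<I> \<otimes> coalg_counit B)) \<cdot> (coalg_counit A \<otimes> \<one> \<flat>B)"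
    by (simp add: lunit_nat proj2_def)
  then show "coalg_counit B \<cdot> proj2 = coalg_counit (tensor_coalg C A B)"
    by (simp add: counit_tensor tens_merge)
qed

text \<open>The right counit law is the left one transported along the braiding, which is where
  cocommutativity enters.\<close>

lemma tensor_coalgebra:
  assumes "is_cocommutative C A" "is_cocommutative C B"
  shows "is_coalgebra C (tensor_coalg C A B)"
proof -
  have br: "braid C (\<flat>A \<odot> \<flat>B) (\<flat>A \<odot> \<flat>B) \<cdot> coalg_comult (tensor_coalg C A B)
      = coalg_comult (tensor_coalg C A B)"
    using tensor_cocommutative[OF assms] by (simp add: is_cocommutative_def)
  have "runit C (\<flat>A \<odot> \<flat>B) \<cdot> (\<one> (\<flat>A \<odot> \<flat>B) \<otimes> coalg_counit (tensor_coalg C A B))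
      \<cdot> coalg_comult (tensor_coalg C A B)
    = lunit C (\<flat>A \<odot> \<flat>B) \<cdot> (braid C (\<flat>A \<odot> \<flat>B) \<I> \<cdot> (\<one> (\<flat>A \<odot> \<flat>B) \<otimes> coalg_counit (tensor_coalg C A
        B))) \<cdot> coalg_comult (tensor_coalg C A B)"
    by (simp add: lunit_braid[symmetric])
  also have "\<dots> = lunit C (\<flat>A \<odot> \<flat>B) \<cdot> (coalg_counit (tensor_coalg C A B) \<otimes> \<one> (\<flat>A \<odot> \<flat>B))
      \<cdot> (braid C (\<flat>A \<odot> \<flat>B) (\<flat>A \<odot> \<flat>B) \<cdot> coalg_comult (tensor_coalg C A B))"
    by (subst braid_nat) simp_all
  also have "\<dots> = \<one> (\<flat>A \<odot> \<flat>B)"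
    by (simp add: br tensor_left_counit)
  finally show ?thesis
    unfolding is_coalgebra_def Let_def hom_def by (simp add: tensor_coassoc tensor_left_counit)
qed

end

text \<open>Both sides make four copies of \<open>A\<close>; by coassociativity they differ only by
  an exchange of the two middle copies, which cocommutativity absorbs.\<close>

lemma comult_coalg_morphism:
  assumes A [simp]: "is_coalgebra C A" and coc: "is_cocommutative C A"
  shows "coalg_comult (tensor_coalg C A A) \<cdot> coalg_comult A
    = (coalg_comult A \<otimes> coalg_comult A) \<cdot> coalg_comult A"
proof -
  let ?a = "coalg_ob A" and ?d = "coalg_comult A"
  have nat: "(\<one> ?a \<otimes> (\<one> ?a \<otimes> ?d)) \<cdot> assoc C ?a ?a ?a
      = assoc C ?a ?a (?a \<odot> ?a) \<cdot> (\<one> (?a \<odot> ?a) \<otimes> ?d)"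
    using assoc_nat[of "\<one> ?a" "\<one> ?a" ?d ?a ?a "?a \<odot> ?a"] by simp
  have "assoc C ?a ?a (?a \<odot> ?a) \<cdot> (coalg_comult (tensor_coalg C A A) \<cdot> ?d)
     = (\<one> ?a \<otimes> (swap ?a ?a ?a \<cdot> (\<one> ?a \<otimes> ?d))) \<cdot> (dup A ?a \<cdot> ?d)"
    by (simp add: comult_tensor comult2_def tens_merge)
  also have "\<dots> = (\<one> ?a \<otimes> (swap ?a ?a ?a \<cdot> (dup A ?a \<cdot> ?d))) \<cdot> ?d"
    by (simp add: dup_comult tens_merge)
  also have "\<dots> = (\<one> ?a \<otimes> (dup A ?a \<cdot> ?d)) \<cdot> ?d"
    using coc by (subst Comp_eq_extend[OF swap_dup]) simp_all
  also have "\<dots> = (\<one> ?a \<otimes> (\<one> ?a \<otimes> ?d)) \<cdot> (dup A ?a \<cdot> ?d)"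
    by (simp add: dup_comult tens_merge)
  also have "\<dots> = ((\<one> ?a \<otimes> (\<one> ?a \<otimes> ?d)) \<cdot> assoc C ?a ?a ?a) \<cdot> (?d \<otimes> \<one> ?a) \<cdot> ?d"
    by (simp add: dup_def)
  also have "\<dots> = (assoc C ?a ?a (?a \<odot> ?a) \<cdot> (\<one> (?a \<odot> ?a) \<otimes> ?d)) \<cdot> (?d \<otimes> \<one> ?a) \<cdot> ?d"
    using nat by (simp only:)
  also have "\<dots> = assoc C ?a ?a (?a \<odot> ?a) \<cdot> ((?d \<otimes> ?d) \<cdot> ?d)"
    by (simp add: tens_merge)
  finally show ?thesis
    by (rule iso_cancel_left[rotated 1]) simp_all
qed

section \<open>Cocommutative coalgebras as a cartesian category\<close>

definition coc :: "('o, 'm) coalgebra \<Rightarrow> bool" where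
  "coc A \<longleftrightarrow> is_coalgebra C A \<and> is_cocommutative C A"

definition cohom :: "('o, 'm) coalgebra \<Rightarrow> ('o, 'm) coalgebra \<Rightarrow> 'm set" where
  "cohom T A = {f. coc T \<and> coc A \<and> coalg_morphism C T A f}"

abbreviation tensor_coalg' (infixr "\<otimes>\<^sub>c" 75) where "A \<otimes>\<^sub>c B \<equiv> tensor_coalg C A B"

definition pair :: "('o, 'm) coalgebra \<Rightarrow> 'm \<Rightarrow> 'm \<Rightarrow> 'm" where
  "pair T f g = (f \<otimes> g) \<cdot> coalg_comult T"

definition unit_coalg :: "('o, 'm) coalgebra" where
  "unit_coalg = Coalgebra \<I> (linv \<I>) (\<one> \<I>)"

lemma coc_coalgebra [simp]: "coc A \<Longrightarrow> is_coalgebra C A"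
  by (simp add: coc_def)

lemma coc_cocommutative: "coc A \<Longrightarrow> is_cocommutative C A"
  by (simp add: coc_def)

lemma cohom_coc:
  assumes "f \<in> cohom T A"
  shows "coc T" "coc A"
  using assms by (simp_all add: cohom_def)

lemma cohom_typing:
  assumes "f \<in> cohom T A"
  shows "f \<in> Arr C" "Dom C f = \<flat>T" "Cod C f = \<flat>A"
  using assms by (simp_all add: cohom_def coalg_morphism_def hom_def)

lemma cohom_comult: "f \<in> cohom T A \<Longrightarrow> coalg_comult A \<cdot> f = (f \<otimes> f) \<cdot> coalg_comult T"
  by (simp add: cohom_def coalg_morphism_def)

lemma cohom_counit: "f \<in> cohom T A \<Longrightarrow> coalg_counit A \<cdot> f = coalg_counit T"
  by (simp add: cohom_def coalg_morphism_def)

lemma cohom_I: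
  assumes "coc T" "coc A" "f \<in> Arr C" "Dom C f = \<flat>T" "Cod C f = \<flat>A"
    "coalg_comult A \<cdot> f = (f \<otimes> f) \<cdot> coalg_comult T" "coalg_counit A \<cdot> f = coalg_counit T"
  shows "f \<in> cohom T A"
  using assms by (simp add: cohom_def coalg_morphism_def hom_def)

lemma cohom_comp [intro]:
  assumes f: "f \<in> cohom T A" and g: "g \<in> cohom A B"
  shows "g \<cdot> f \<in> cohom T B"
proof -
  note [simp] = cohom_typing[OF f] cohom_typing[OF g] cohom_coc[OF f] cohom_coc[OF g]
  have "coalg_comult B \<cdot> (g \<cdot> f) = (g \<otimes> g) \<cdot> (coalg_comult A \<cdot> f)"
    by (simp add: Comp_eq_extend[OF cohom_comult[OF g]])
  also have "\<dots> = ((g \<cdot> f) \<otimes> (g \<cdot> f)) \<cdot> coalg_comult T"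
    by (simp add: cohom_comult[OF f] tens_merge)
  finally show ?thesis
    by (intro cohom_I) (simp_all add: Comp_eq_extend[OF cohom_counit[OF g]] cohom_counit[OF f])
qed

lemma cohom_assoc:
  assumes "f \<in> cohom T A" "g \<in> cohom A B" "h \<in> cohom B D"
  shows "(h \<cdot> g) \<cdot> f = h \<cdot> (g \<cdot> f)"
  using cohom_typing[OF assms(1)] cohom_typing[OF assms(2)] cohom_typing[OF assms(3)] by simp

lemma cohom_Ide [simp]: "coc A \<Longrightarrow> \<one> \<flat>A \<in> cohom A A"
  by (intro cohom_I) simp_all

lemma cohom_Ide_comp:
  assumes "f \<in> cohom T A"
  shows "\<one> \<flat>A \<cdot> f = f" "f \<cdot> \<one> \<flat>T = f"
  using cohom_typing[OF assms] by simp_all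

lemma coc_tensor [simp]: "coc A \<Longrightarrow> coc B \<Longrightarrow> coc (A \<otimes>\<^sub>c B)"
  unfolding coc_def by (simp add: tensor_coalgebra tensor_cocommutative)

lemma comult_cohom: "coc A \<Longrightarrow> coalg_comult A \<in> cohom A (A \<otimes>\<^sub>c A)"
proof (rule cohom_I)
  assume A: "coc A"
  then show "coalg_comult (A \<otimes>\<^sub>c A) \<cdot> coalg_comult A = (coalg_comult A \<otimes> coalg_comult A)
      \<cdot> coalg_comult A"
    by (simp add: comult_coalg_morphism coc_cocommutative)
  have "coalg_counit (A \<otimes>\<^sub>c A) \<cdot> coalg_comult A
    = (lunit C \<I> \<cdot> (\<one> \<I> \<otimes> coalg_counit A)) \<cdot> (coalg_counit A \<otimes> \<one> \<flat>A) \<cdot> coalg_comult A"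
    using A by (simp add: counit_tensor tens_merge)
  also have "\<dots> = coalg_counit A \<cdot> (lunit C \<flat>A \<cdot> (coalg_counit A \<otimes> \<one> \<flat>A) \<cdot> coalg_comult A)"
    using A by (subst lunit_nat) simp_all
  also have "\<dots> = coalg_counit A" using A by (simp add: coalgebra_laws)
  finally show "coalg_counit (A \<otimes>\<^sub>c A) \<cdot> coalg_comult A = coalg_counit A" .
qed simp_all

lemma tens_cohom:
  assumes f: "f \<in> cohom A A'" and g: "g \<in> cohom B B'"
  shows "f \<otimes> g \<in> cohom (A \<otimes>\<^sub>c B) (A' \<otimes>\<^sub>c B')"
proof (rule cohom_I)
  note [simp] = cohom_typing[OF f] cohom_typing[OF g] cohom_coc[OF f] cohom_coc[OF g]
  have "coalg_comult (A' \<otimes>\<^sub>c B') \<cdot> (f \<otimes> g)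
    = (interchange C \<flat>A' \<flat>A' \<flat>B' \<flat>B' \<cdot> ((f \<otimes> f) \<otimes> (g \<otimes> g))) \<cdot> (coalg_comult A \<otimes> coalg_comult B)"
    by (simp add: tensor_coalg_def Let_def tens_merge cohom_comult[OF f] cohom_comult[OF g])
  also have "\<dots> = ((f \<otimes> g) \<otimes> (f \<otimes> g)) \<cdot> coalg_comult (A \<otimes>\<^sub>c B)"
    by (subst interchange_nat) (simp_all add: tensor_coalg_def Let_def)
  finally show "coalg_comult (A' \<otimes>\<^sub>c B') \<cdot> (f \<otimes> g) = ((f \<otimes> g) \<otimes> (f \<otimes> g)) \<cdot> coalg_comult (A \<otimes>\<^sub>c B)" .
  show "coalg_counit (A' \<otimes>\<^sub>c B') \<cdot> (f \<otimes> g) = coalg_counit (A \<otimes>\<^sub>c B)"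
    by (simp add: counit_tensor tens_merge cohom_counit[OF f] cohom_counit[OF g])
qed (use cohom_typing[OF f] cohom_typing[OF g] cohom_coc[OF f] cohom_coc[OF g] in simp_all)

lemma pair_cohom [intro]:
  assumes f: "f \<in> cohom T A" and g: "g \<in> cohom T B"
  shows "pair T f g \<in> cohom T (A \<otimes>\<^sub>c B)"
  unfolding pair_def using comult_cohom[OF cohom_coc(1)[OF f]] tens_cohom[OF f g]
      by (rule cohom_comp)

lemma proj1_cohom [simp]: "coc A \<Longrightarrow> coc B \<Longrightarrow> proj1 A B \<in> cohom (A \<otimes>\<^sub>c B) A"
  by (intro cohom_I) (simp_all add: proj1_coalg_morphism proj_counit)

lemma proj2_cohom [simp]: "coc A \<Longrightarrow> coc B \<Longrightarrow> proj2 A B \<in> cohom (A \<otimes>\<^sub>c B) B"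
  by (intro cohom_I) (simp_all add: proj2_coalg_morphism proj_counit)

lemma proj1_pair:
  assumes f: "f \<in> cohom T A" and g: "g \<in> cohom T B"
  shows "proj1 A B \<cdot> pair T f g = f"
proof -
  note [simp] = cohom_typing[OF f] cohom_typing[OF g] cohom_coc[OF f] cohom_coc[OF g]
  have "proj1 A B \<cdot> pair T f g = (runit C \<flat>A \<cdot> (f \<otimes> \<one> \<I>)) \<cdot> (\<one> \<flat>T \<otimes> coalg_counit T)
      \<cdot> coalg_comult T"
    by (simp add: proj1_def pair_def tens_merge cohom_counit[OF g])
  also have "\<dots> = f \<cdot> (runit C \<flat>T \<cdot> (\<one> \<flat>T \<otimes> coalg_counit T) \<cdot> coalg_comult T)"
    by (subst runit_nat) simp_all
  also have "\<dots> = f" by (simp add: coalgebra_laws)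
  finally show ?thesis .
qed

lemma proj2_pair:
  assumes f: "f \<in> cohom T A" and g: "g \<in> cohom T B"
  shows "proj2 A B \<cdot> pair T f g = g"
proof -
  note [simp] = cohom_typing[OF f] cohom_typing[OF g] cohom_coc[OF f] cohom_coc[OF g]
  have "proj2 A B \<cdot> pair T f g = (lunit C \<flat>B \<cdot> (\<one> \<I> \<otimes> g)) \<cdot> (coalg_counit T \<otimes> \<one> \<flat>T)
      \<cdot> coalg_comult T"
    by (simp add: proj2_def pair_def tens_merge cohom_counit[OF f])
  also have "\<dots> = g \<cdot> (lunit C \<flat>T \<cdot> (coalg_counit T \<otimes> \<one> \<flat>T) \<cdot> coalg_comult T)"
    by (subst lunit_nat) simp_all
  also have "\<dots> = g" by (simp add: coalgebra_laws)
  finally show ?thesis .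
qed

lemma pair_comp:
  assumes f: "f \<in> Arr C" "Dom C f = \<flat>T" and g: "g \<in> Arr C" "Dom C g = \<flat>T" and h: "h \<in> cohom S T"
  shows "pair T f g \<cdot> h = pair S (f \<cdot> h) (g \<cdot> h)"
  using f g cohom_typing[OF h] cohom_coc[OF h] by (simp add: pair_def cohom_comult[OF h] tens_merge)

lemma tens_pair:
  assumes h: "h \<in> cohom T A" and k: "k \<in> cohom T B" and "f \<in> Arr C" "g \<in> Arr C" "Dom C f = \<flat>A"
      "Dom C g = \<flat>B"
  shows "(f \<otimes> g) \<cdot> pair T h k = pair T (f \<cdot> h) (g \<cdot> k)"
  using assms cohom_typing[OF h] cohom_typing[OF k] cohom_coc[OF h]
      by (simp add: pair_def tens_merge)

text \<open>The projections are the generic elements of \<open>A\<close> and \<open>B\<close>.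
  Written through them, a tensor product of morphisms becomes a pairing and can be computed
  elementwise.\<close>

lemma tens_eq_pair:
  assumes "coc A" "coc B" "f \<in> Arr C" "g \<in> Arr C" "Dom C f = \<flat>A" "Dom C g = \<flat>B"
  shows "f \<otimes> g = pair (A \<otimes>\<^sub>c B) (f \<cdot> proj1 A B) (g \<cdot> proj2 A B)"
  using assms by (simp add: tens_pair[OF proj1_cohom proj2_cohom, symmetric])
     (simp add: pair_def proj_pair)

lemma pair_proj:
  assumes h: "h \<in> cohom T (A \<otimes>\<^sub>c B)" and [simp]: "coc A" "coc B"
  shows "pair T (proj1 A B \<cdot> h) (proj2 A B \<cdot> h) = h"
  using cohom_typing[OF h] by (simp add: pair_comp[OF _ _ _ _ h, symmetric]) (simp add: pair_def
      proj_pair)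

lemma pair_ext:
  assumes "h \<in> cohom T (A \<otimes>\<^sub>c B)" "k \<in> cohom T (A \<otimes>\<^sub>c B)" "coc A" "coc B"
    "proj1 A B \<cdot> h = proj1 A B \<cdot> k" "proj2 A B \<cdot> h = proj2 A B \<cdot> k"
  shows "h = k"
  using assms pair_proj by metis

lemma assoc_pair:
  assumes f: "f \<in> cohom T A" and g: "g \<in> cohom T B" and h: "h \<in> cohom T D"
  shows "assoc C \<flat>A \<flat>B \<flat>D \<cdot> pair T (pair T f g) h = pair T f (pair T g h)"
proof -
  note [simp] = cohom_typing[OF f] cohom_typing[OF g] cohom_typing[OF h] cohom_coc[OF f]
      cohom_coc[OF g] cohom_coc[OF h]
  have "assoc C \<flat>A \<flat>B \<flat>D \<cdot> pair T (pair T f g) h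
    = (assoc C \<flat>A \<flat>B \<flat>D \<cdot> ((f \<otimes> g) \<otimes> h)) \<cdot> (coalg_comult T \<otimes> \<one> \<flat>T) \<cdot> coalg_comult T"
    by (simp add: pair_def tens_merge)
  also have "\<dots> = (f \<otimes> (g \<otimes> h)) \<cdot> (assoc C \<flat>T \<flat>T \<flat>T \<cdot> (coalg_comult T \<otimes> \<one> \<flat>T) \<cdot> coalg_comult T)"
    by (subst assoc_nat) simp_all
  also have "\<dots> = pair T f (pair T g h)"
    by (simp add: coalgebra_laws pair_def tens_merge)
  finally show ?thesis .
qed

text \<open>Writes the inverse unitor as a pairing with the counit, so that unit laws of an algebra
  can be compared with unit laws on elements.\<close>

lemma counit_linv:
  assumes [simp]: "coc A"
  shows "(coalg_counit A \<otimes> \<one> \<flat>A) \<cdot> coalg_comult A = linv \<flat>A"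
  by (rule iso_cancel_left[of "lunit C \<flat>A"]) (simp_all add: coalgebra_laws)

lemma counit_rinv:
  assumes [simp]: "coc A"
  shows "(\<one> \<flat>A \<otimes> coalg_counit A) \<cdot> coalg_comult A = rinv \<flat>A"
  by (rule iso_cancel_left[of "runit C \<flat>A"]) (simp_all add: coalgebra_laws)

lemma unit_coalg_simps [simp]:
  "\<flat>unit_coalg = \<I>" "coalg_comult unit_coalg = linv \<I>" "coalg_counit unit_coalg = \<one> \<I>"
  by (simp_all add: unit_coalg_def)

lemma coc_unit [simp]: "coc unit_coalg"
proof -
  have 1: "assoc C \<I> \<I> \<I> \<cdot> (linv \<I> \<otimes> \<one> \<I>) = \<one> \<I> \<otimes> linv \<I>"
  proof (rule iso_cancel_left[of "\<one> \<I> \<otimes> lunit C \<I>"])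
    show "(\<one> \<I> \<otimes> lunit C \<I>) \<cdot> (assoc C \<I> \<I> \<I> \<cdot> (linv \<I> \<otimes> \<one> \<I>)) = (\<one> \<I> \<otimes> lunit C \<I>) \<cdot> (\<one> \<I> \<otimes> linv \<I>)"
      by (simp add: Comp_eq_extend[OF triangle] tens_merge) (simp add: lunit_unit)
  qed (simp_all add: iso_tens iso_Ide)
  have 2: "braid C \<I> \<I> \<cdot> linv \<I> = linv \<I>"
  proof (rule iso_cancel_left[of "lunit C \<I>"])
    have "lunit C \<I> \<cdot> (braid C \<I> \<I> \<cdot> linv \<I>) = (lunit C \<I> \<cdot> braid C \<I> \<I>) \<cdot> linv \<I>"
      by simp
    then show "lunit C \<I> \<cdot> (braid C \<I> \<I> \<cdot> linv \<I>) = lunit C \<I> \<cdot> linv \<I>"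
      using lunit_braid[of \<I>] by (simp only: unit_Obj lunit_unit)
  qed simp_all
  show ?thesis
    unfolding coc_def is_coalgebra_def is_cocommutative_def Let_def hom_def
    by (simp add: 2 Comp_eq_extend[OF 1]) (simp add: lunit_unit)
qed

text \<open>Up to the unitor of \<open>\<I>\<close>, the equation on comultiplications says that
  \<open>coalg_comult A\<close> preserves counits, which is known from
  \<open>comult_cohom\<close>.\<close>

lemma counit_cohom [simp]: "coc A \<Longrightarrow> coalg_counit A \<in> cohom A unit_coalg"
proof (rule cohom_I)
  assume [simp]: "coc A"
  have "lunit C \<I> \<cdot> ((coalg_counit A \<otimes> coalg_counit A) \<cdot> coalg_comult A) = coalg_counit A"
    using cohom_counit[OF comult_cohom[of A]] by (simp add: counit_tensor)
  then show "coalg_comult unit_coalg \<cdot> coalg_counit A = (coalg_counit A \<otimes> coalg_counit A)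
      \<cdot> coalg_comult A"
    by - (rule iso_cancel_left[of "lunit C \<I>"], simp_all)
qed simp_all

section \<open>The convolution monoids of generalized elements\<close>

definition bialg :: "('o, 'm) bialgebra \<Rightarrow> bool" where
  "bialg A \<longleftrightarrow> is_bialgebra C A \<and> is_cocommutative C (bi_coalg A)"

definition conv :: "('o, 'm) coalgebra \<Rightarrow> ('o, 'm) bialgebra \<Rightarrow> 'm \<Rightarrow> 'm \<Rightarrow> 'm" where
  "conv T A f g = mult A \<cdot> pair T f g"

definition conv_unit :: "('o, 'm) coalgebra \<Rightarrow> ('o, 'm) bialgebra \<Rightarrow> 'm" where
  "conv_unit T A = unt A \<cdot> coalg_counit T"

lemma bialg_coc [simp]: "bialg A \<Longrightarrow> coc (bi_coalg A)"
  by (simp add: bialg_def is_bialgebra_def coc_def)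

lemma bialg_ob [simp]: "bialg A \<Longrightarrow> ob A = \<flat>(bi_coalg A)"
  by (simp add: bialg_def is_bialgebra_def)

lemma bialgebra_structure:
  assumes "bialg A"
  shows "mult A \<in> Arr C" "Dom C (mult A) = ob A \<odot> ob A" "Cod C (mult A) = ob A"
    "unt A \<in> Arr C" "Dom C (unt A) = \<I>" "Cod C (unt A) = ob A"
    "comult A \<cdot> mult A = (mult A \<otimes> mult A) \<cdot> interchange C (ob A) (ob A) (ob A) (ob A)
        \<cdot> (comult A \<otimes> comult A)"
    "counit A \<cdot> mult A = lunit C \<I> \<cdot> (counit A \<otimes> counit A)"
    "comult A \<cdot> unt A = (unt A \<otimes> unt A) \<cdot> linv \<I>"
    "counit A \<cdot> unt A = \<one> \<I>"
proof -
  have alg: "is_algebra C (bi_alg A)" and co: "coc (bi_coalg A)" and ob: "ob A = \<flat>(bi_coalg A)"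
    and comult: "alg_morphism C (bi_alg A) (tensor_alg C (bi_alg A) (bi_alg A)) (comult A)"
    and counit: "alg_morphism C (bi_alg A) (unit_alg C) (counit A)"
    using assms unfolding bialg_def is_bialgebra_def coc_def by simp_all
  show typing: "mult A \<in> Arr C" "Dom C (mult A) = ob A \<odot> ob A" "Cod C (mult A) = ob A"
    "unt A \<in> Arr C" "Dom C (unt A) = \<I>" "Cod C (unt A) = ob A"
    using alg by (simp_all add: is_algebra_def Let_def hom_def)
  show "comult A \<cdot> mult A = (mult A \<otimes> mult A) \<cdot> interchange C (ob A) (ob A) (ob A) (ob A)
      \<cdot> (comult A \<otimes> comult A)"
    "comult A \<cdot> unt A = (unt A \<otimes> unt A) \<cdot> linv \<I>"
    using comult typing co ob by (simp_all add: alg_morphism_def tensor_alg_def Let_def)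
  show "counit A \<cdot> mult A = lunit C \<I> \<cdot> (counit A \<otimes> counit A)" "counit A \<cdot> unt A = \<one> \<I>"
    using counit by (simp_all add: alg_morphism_def unit_alg_def)
qed

text \<open>The axioms that comultiplication and counit are algebra morphisms, read the other way
  round, say that the multiplication is a coalgebra morphism. The same reading for the unit gives
  \<open>unt_cohom\<close>.\<close>

lemma mult_cohom [simp]:
  assumes A: "bialg A"
  shows "mult A \<in> cohom (bi_coalg A \<otimes>\<^sub>c bi_coalg A) (bi_coalg A)"
proof (rule cohom_I)
  note s = bialgebra_structure[OF A, unfolded bialg_ob[OF A]]
  show "mult A \<in> Arr C" "Dom C (mult A) = \<flat>(bi_coalg A \<otimes>\<^sub>c bi_coalg A)"
      "Cod C (mult A) = \<flat>(bi_coalg A)"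
    using s(1-3) by simp_all
  show "comult A \<cdot> mult A = (mult A \<otimes> mult A) \<cdot> coalg_comult (bi_coalg A \<otimes>\<^sub>c bi_coalg A)"
    unfolding s(7) by (simp add: tensor_coalg_def Let_def)
  show "counit A \<cdot> mult A = coalg_counit (bi_coalg A \<otimes>\<^sub>c bi_coalg A)"
    unfolding s(8) by (simp add: tensor_coalg_def Let_def)
qed (use A in simp_all)

lemma unt_cohom [simp]:
  assumes A: "bialg A"
  shows "unt A \<in> cohom unit_coalg (bi_coalg A)"
proof (rule cohom_I)
  note s = bialgebra_structure[OF A, unfolded bialg_ob[OF A]]
  show "unt A \<in> Arr C" "Dom C (unt A) = \<flat>unit_coalg" "Cod C (unt A) = \<flat>(bi_coalg A)"
    using s(4-6) by simp_all
  show "comult A \<cdot> unt A = (unt A \<otimes> unt A) \<cdot> coalg_comult unit_coalg"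
    unfolding s(9) by simp
  show "counit A \<cdot> unt A = coalg_counit unit_coalg"
    unfolding s(10) by simp
qed (use A in simp_all)

lemma algebra_laws:
  assumes "bialg A"
  shows "mult A \<cdot> (mult A \<otimes> \<one> (ob A)) = mult A \<cdot> (\<one> (ob A) \<otimes> mult A) \<cdot> assoc C (ob A) (ob A) (ob A)"
    "mult A \<cdot> (unt A \<otimes> \<one> (ob A)) = lunit C (ob A)"
    "mult A \<cdot> (\<one> (ob A) \<otimes> unt A) = runit C (ob A)"
proof -
  have "is_algebra C (bi_alg A)" using assms unfolding bialg_def is_bialgebra_def by blast
  then show "mult A \<cdot> (mult A \<otimes> \<one> (ob A)) = mult A \<cdot> (\<one> (ob A) \<otimes> mult A)
      \<cdot> assoc C (ob A) (ob A) (ob A)"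
    "mult A \<cdot> (unt A \<otimes> \<one> (ob A)) = lunit C (ob A)"
    "mult A \<cdot> (\<one> (ob A) \<otimes> unt A) = runit C (ob A)"
    unfolding is_algebra_def Let_def by blast+
qed

lemma conv_cohom [simp]:
  assumes "bialg A" "f \<in> cohom T (bi_coalg A)" "g \<in> cohom T (bi_coalg A)"
  shows "conv T A f g \<in> cohom T (bi_coalg A)"
  unfolding conv_def using assms by (intro cohom_comp[OF pair_cohom mult_cohom])

lemma conv_unit_cohom [simp]:
  assumes "bialg A" "coc T"
  shows "conv_unit T A \<in> cohom T (bi_coalg A)"
  unfolding conv_unit_def using assms by (intro cohom_comp[OF counit_cohom unt_cohom])

lemma conv_comp:
  assumes A: "bialg A" and f: "f \<in> cohom T (bi_coalg A)" and g: "g \<in> cohom T (bi_coalg A)" and h: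
      "h \<in> cohom S T"
  shows "conv T A f g \<cdot> h = conv S A (f \<cdot> h) (g \<cdot> h)"
  using cohom_assoc[OF h pair_cohom[OF f g] mult_cohom[OF A]] cohom_typing[OF f] cohom_typing[OF g]
  by (simp add: conv_def pair_comp[OF _ _ _ _ h])

lemma conv_unit_comp:
  assumes A: "bialg A" and h: "h \<in> cohom S T"
  shows "conv_unit T A \<cdot> h = conv_unit S A"
  using cohom_assoc[OF h counit_cohom unt_cohom[OF A]] cohom_coc[OF h] by (simp add: conv_unit_def
      cohom_counit[OF h])

lemma conv_assoc:
  assumes A [simp]: "bialg A" and f: "f \<in> cohom T (bi_coalg A)" and g: "g \<in> cohom T (bi_coalg A)"
    and h: "h \<in> cohom T (bi_coalg A)"
  shows "conv T A (conv T A f g) h = conv T A f (conv T A g h)"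
proof -
  let ?a = "\<flat>(bi_coalg A)"
  note [simp] = cohom_typing[OF f] cohom_typing[OF g] cohom_typing[OF h] cohom_coc[OF f]
      cohom_coc[OF g] cohom_coc[OF h]
    cohom_typing[OF mult_cohom[OF A]] cohom_typing[OF pair_cohom[OF f g]] cohom_typing[OF
        pair_cohom[OF g h]]
    cohom_typing[OF pair_cohom[OF f pair_cohom[OF g h]]] cohom_typing[OF pair_cohom[OF
        pair_cohom[OF f g] h]]
  note law = algebra_laws(1)[OF A, unfolded bialg_ob[OF A]]
  have "conv T A (conv T A f g) h = mult A \<cdot> ((mult A \<otimes> \<one> ?a) \<cdot> pair T (pair T f g) h)"
    by (simp add: conv_def tens_pair[OF pair_cohom[OF f g] h])
  also have "\<dots> = mult A \<cdot> (\<one> ?a \<otimes> mult A) \<cdot> (assoc C ?a ?a ?a \<cdot> pair T (pair T f g) h)"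
    by (subst Comp_eq_extend[OF law]) simp_all
  also have "\<dots> = conv T A f (conv T A g h)"
    by (simp add: assoc_pair[OF f g h] conv_def tens_pair[OF f pair_cohom[OF g h]])
  finally show ?thesis .
qed

lemma conv_unit_left:
  assumes A [simp]: "bialg A" and f: "f \<in> cohom T (bi_coalg A)"
  shows "conv T A (conv_unit T A) f = f"
proof -
  let ?a = "\<flat>(bi_coalg A)"
  note [simp] = cohom_typing[OF f] cohom_coc[OF f]
    cohom_typing[OF mult_cohom[OF A]] cohom_typing[OF unt_cohom[OF A]]
  note law = algebra_laws(2)[OF A, unfolded bialg_ob[OF A]]
  have "conv T A (conv_unit T A) f = mult A \<cdot> ((unt A \<otimes> \<one> ?a) \<cdot> ((coalg_counit T \<otimes> f)
      \<cdot> coalg_comult T))"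
    by (simp add: conv_def pair_def tens_merge conv_unit_def)
  also have "\<dots> = lunit C ?a \<cdot> ((coalg_counit T \<otimes> f) \<cdot> coalg_comult T)"
    by (subst Comp_eq_extend[OF law]) simp_all
  also have "\<dots> = proj2 T (bi_coalg A) \<cdot> pair T (\<one> \<flat>T) f"
    by (simp add: proj2_def pair_def tens_merge)
  also have "\<dots> = f"
    using proj2_pair[OF cohom_Ide f] by simp
  finally show ?thesis .
qed

lemma conv_unit_right:
  assumes A [simp]: "bialg A" and f: "f \<in> cohom T (bi_coalg A)"
  shows "conv T A f (conv_unit T A) = f"
proof -
  let ?a = "\<flat>(bi_coalg A)"
  note [simp] = cohom_typing[OF f] cohom_coc[OF f]
    cohom_typing[OF mult_cohom[OF A]] cohom_typing[OF unt_cohom[OF A]]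
  note law = algebra_laws(3)[OF A, unfolded bialg_ob[OF A]]
  have "conv T A f (conv_unit T A) = mult A \<cdot> ((\<one> ?a \<otimes> unt A) \<cdot> ((f \<otimes> coalg_counit T)
      \<cdot> coalg_comult T))"
    by (simp add: conv_def pair_def tens_merge conv_unit_def)
  also have "\<dots> = runit C ?a \<cdot> ((f \<otimes> coalg_counit T) \<cdot> coalg_comult T)"
    by (subst Comp_eq_extend[OF law]) simp_all
  also have "\<dots> = proj1 (bi_coalg A) T \<cdot> pair T f (\<one> \<flat>T)"
    by (simp add: proj1_def pair_def tens_merge)
  also have "\<dots> = f"
    using proj1_pair[OF f cohom_Ide] by simp
  finally show ?thesis .
qed

section \<open>Bialgebra morphisms in terms of generalized elements\<close>

definition bihom :: "('o, 'm) bialgebra \<Rightarrow> ('o, 'm) bialgebra \<Rightarrow> 'm set" where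
  "bihom A B = {f. bialg A \<and> bialg B \<and> bialg_morphism C A B f}"

lemma bihom_bialg:
  assumes "f \<in> bihom A B"
  shows "bialg A" "bialg B"
  using assms by (simp_all add: bihom_def)

lemma bihom_cohom:
  assumes "f \<in> bihom A B"
  shows "f \<in> cohom (bi_coalg A) (bi_coalg B)"
  using assms by (simp add: bihom_def cohom_def bialg_morphism_def)

lemma bihom_conv:
  assumes f: "f \<in> bihom A B" and g: "g \<in> cohom T (bi_coalg A)" and h: "h \<in> cohom T (bi_coalg A)"
  shows "f \<cdot> conv T A g h = conv T B (f \<cdot> g) (f \<cdot> h)"
proof -
  note [simp] = bihom_bialg[OF f] cohom_typing[OF bihom_cohom[OF f]]
    cohom_typing[OF mult_cohom[OF bihom_bialg(1)[OF f]]] cohom_typing[OF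
        mult_cohom[OF bihom_bialg(2)[OF f]]]
    cohom_typing[OF pair_cohom[OF g h]]
  have mor: "f \<cdot> mult A = mult B \<cdot> (f \<otimes> f)"
    using f by (simp add: bihom_def bialg_morphism_def alg_morphism_def)
  have "f \<cdot> conv T A g h = (mult B \<cdot> (f \<otimes> f)) \<cdot> pair T g h"
    unfolding conv_def by (subst Comp_eq_extend[OF mor]) simp_all
  also have "\<dots> = conv T B (f \<cdot> g) (f \<cdot> h)"
    by (simp add: conv_def tens_pair[OF g h])
  finally show ?thesis .
qed

lemma bihom_conv_unit:
  assumes f: "f \<in> bihom A B" and T: "coc T"
  shows "f \<cdot> conv_unit T A = conv_unit T B"
proof -
  have mor: "f \<cdot> unt A = unt B"
    using f by (simp add: bihom_def bialg_morphism_def alg_morphism_def)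
  show ?thesis
    using cohom_assoc[OF counit_cohom[OF T] unt_cohom[OF bihom_bialg(1)[OF f]] bihom_cohom[OF f]]
    by (simp add: conv_unit_def mor)
qed

text \<open>The multiplication is the product of the generic pair of elements, because the two
  projections pair to the identity.\<close>

lemma mult_as_conv:
  assumes A [simp]: "bialg A"
  shows "mult A = conv (bi_coalg A \<otimes>\<^sub>c bi_coalg A) A (proj1 (bi_coalg A) (bi_coalg A)) (proj2
      (bi_coalg A) (bi_coalg A))"
  using cohom_typing[OF mult_cohom[OF A]] by (simp add: conv_def pair_def proj_pair)

lemma unt_as_conv_unit: "bialg A \<Longrightarrow> unt A = conv_unit unit_coalg A"
  using cohom_typing[OF unt_cohom] by (simp add: conv_unit_def)

text \<open>By the Yoneda lemma, it suffices to test multiplicativity on generalized elements.\<close>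

lemma bihom_I:
  assumes A: "bialg A" and B: "bialg B" and f: "f \<in> cohom (bi_coalg A) (bi_coalg B)"
    and conv: "\<And>T g h. g \<in> cohom T (bi_coalg A) \<Longrightarrow> h \<in> cohom T (bi_coalg A) \<Longrightarrow>
      f \<cdot> conv T A g h = conv T B (f \<cdot> g) (f \<cdot> h)"
    and unit: "\<And>T. coc T \<Longrightarrow> f \<cdot> conv_unit T A = conv_unit T B"
  shows "f \<in> bihom A B"
proof -
  let ?a = "bi_coalg A"
  note [simp] = A B cohom_typing[OF f]
  have "f \<cdot> mult A = mult B \<cdot> pair (?a \<otimes>\<^sub>c ?a) (f \<cdot> proj1 ?a ?a) (f \<cdot> proj2 ?a ?a)"
    unfolding mult_as_conv[OF A] by (subst conv) (simp_all add: conv_def)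
  also have "\<dots> = mult B \<cdot> (f \<otimes> f)"
    by (subst tens_eq_pair[of ?a ?a f f]) simp_all
  finally have 1: "f \<cdot> mult A = mult B \<cdot> (f \<otimes> f)" .
  have 2: "f \<cdot> unt A = unt B"
    using unit[OF coc_unit] by (simp add: unt_as_conv_unit)
  have "f \<in> hom C (ob A) (ob B)"
    by (simp add: hom_def)
  then show ?thesis
    using f 1 2 unfolding bihom_def bialg_morphism_def alg_morphism_def cohom_def by simp
qed

lemma bihom_comp:
  assumes f: "f \<in> bihom A B" and g: "g \<in> bihom B D"
  shows "g \<cdot> f \<in> bihom A D"
proof (rule bihom_I)
  note [simp] = bihom_bialg[OF f] bihom_bialg[OF g]
  note f' = bihom_cohom[OF f] note g' = bihom_cohom[OF g]
  show "(g \<cdot> f) \<cdot> conv T A h k = conv T D ((g \<cdot> f) \<cdot> h) ((g \<cdot> f) \<cdot> k)"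
    if h: "h \<in> cohom T (bi_coalg A)" and k: "k \<in> cohom T (bi_coalg A)" for T h k
    by (simp add: cohom_assoc[OF h f' g'] cohom_assoc[OF k f' g'] cohom_assoc[OF
        conv_cohom[OF bihom_bialg(1)[OF f] h k] f' g']
        bihom_conv[OF f h k] bihom_conv[OF g cohom_comp[OF h f'] cohom_comp[OF k f']])
  show "(g \<cdot> f) \<cdot> conv_unit T A = conv_unit T D" if "coc T" for T
    using that cohom_assoc[OF conv_unit_cohom[OF bihom_bialg(1)[OF f] that] f' g']
    by (simp add: bihom_conv_unit[OF f] bihom_conv_unit[OF g])
qed (use bihom_bialg[OF f] bihom_bialg[OF g] cohom_comp[OF bihom_cohom[OF f]
    bihom_cohom[OF g]] in simp_all)

lemma bihom_Ide: "bialg A \<Longrightarrow> \<one> \<flat>(bi_coalg A) \<in> bihom A A"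
  by (rule bihom_I) (simp_all add: cohom_Ide_comp[OF conv_cohom] cohom_Ide_comp[OF
      conv_unit_cohom] cohom_Ide_comp)

lemma conv_conv_unit: "bialg A \<Longrightarrow> coc T \<Longrightarrow> conv T A (conv_unit T A) (conv_unit T A) = conv_unit T A"
  by (simp add: conv_unit_left)

lemma bihom_zero:
  assumes A [simp]: "bialg A" and B [simp]: "bialg B"
  shows "conv_unit (bi_coalg A) B \<in> bihom A B"
proof (rule bihom_I)
  show "conv_unit (bi_coalg A) B \<cdot> conv T A g h
      = conv T B (conv_unit (bi_coalg A) B \<cdot> g) (conv_unit (bi_coalg A) B \<cdot> h)"
    if g: "g \<in> cohom T (bi_coalg A)" and h: "h \<in> cohom T (bi_coalg A)" for T g h
    using cohom_coc[OF g] by (simp add: conv_unit_comp[OF B g] conv_unit_comp[OF B h]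
        conv_unit_comp[OF B conv_cohom[OF A g h]] conv_conv_unit)
  show "conv_unit (bi_coalg A) B \<cdot> conv_unit T A = conv_unit T B" if "coc T" for T
    using conv_unit_comp[OF B conv_unit_cohom[OF A that]] .
qed simp_all

text \<open>Cocommutative bialgebras are the monoids in the cartesian category of cocommutative
  coalgebras, so the laws may be verified on generalized elements.\<close>

lemma bialg_I:
  assumes P [simp]: "coc P" and m: "m \<in> cohom (P \<otimes>\<^sub>c P) P" and u: "u \<in> cohom unit_coalg P"
    and assoc: "\<And>T f g h. f \<in> cohom T P \<Longrightarrow> g \<in> cohom T P \<Longrightarrow> h \<in> cohom T P \<Longrightarrow>
      m \<cdot> pair T (m \<cdot> pair T f g) h = m \<cdot> pair T f (m \<cdot> pair T g h)"
    and unit_left: "\<And>T f. f \<in> cohom T P \<Longrightarrow> m \<cdot> pair T (u \<cdot> coalg_counit T) f = f"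
    and unit_right: "\<And>T f. f \<in> cohom T P \<Longrightarrow> m \<cdot> pair T f (u \<cdot> coalg_counit T) = f"
  shows "bialg (Bialgebra (Algebra \<flat>P m u) P)"
proof -
  let ?p = "\<flat>P"
  let ?Q = "(P \<otimes>\<^sub>c P) \<otimes>\<^sub>c P"
  \<comment> \<open>The generic triple of elements of \<open>P\<close>. By \<open>gen\<close> it
    pairs to the identity of \<open>(P \<otimes> P) \<otimes> P\<close>, so associativity for this
    triple is associativity of \<open>m\<close>.\<close>
  let ?f = "proj1 P P \<cdot> proj1 (P \<otimes>\<^sub>c P) P"
  let ?g = "proj2 P P \<cdot> proj1 (P \<otimes>\<^sub>c P) P"
  let ?h = "proj2 (P \<otimes>\<^sub>c P) P"
  note [simp] = cohom_typing[OF m] cohom_typing[OF u]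
  have f: "?f \<in> cohom ?Q P" by (rule cohom_comp[OF proj1_cohom proj1_cohom]) simp_all
  have g: "?g \<in> cohom ?Q P" by (rule cohom_comp[OF proj1_cohom proj2_cohom]) simp_all
  have h: "?h \<in> cohom ?Q P" by simp
  have fg: "pair ?Q ?f ?g = proj1 (P \<otimes>\<^sub>c P) P"
    by (rule pair_proj) simp_all
  have gen: "pair ?Q (pair ?Q ?f ?g) ?h = \<one> ((?p \<odot> ?p) \<odot> ?p)"
    unfolding fg using proj_pair[of "P \<otimes>\<^sub>c P" P] by (simp add: pair_def)
  have L: "m \<otimes> \<one> ?p = pair ?Q (m \<cdot> pair ?Q ?f ?g) ?h"
    unfolding fg by (subst tens_eq_pair[of "P \<otimes>\<^sub>c P" P]) simp_all
  have R: "(\<one> ?p \<otimes> m) \<cdot> assoc C ?p ?p ?p = pair ?Q ?f (m \<cdot> pair ?Q ?g ?h)"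
  proof -
    have "(\<one> ?p \<otimes> m) \<cdot> assoc C ?p ?p ?p = (\<one> ?p \<otimes> m) \<cdot> (assoc C ?p ?p ?p
        \<cdot> pair ?Q (pair ?Q ?f ?g) ?h)"
      unfolding gen by simp
    also have "\<dots> = (\<one> ?p \<otimes> m) \<cdot> pair ?Q ?f (pair ?Q ?g ?h)"
      by (simp only: assoc_pair[OF f g h])
    also have "\<dots> = pair ?Q ?f (m \<cdot> pair ?Q ?g ?h)"
      by (subst tens_pair[OF f pair_cohom[OF g h]]) (simp_all add: cohom_Ide_comp[OF f])
    finally show ?thesis .
  qed
  have a1: "m \<cdot> (m \<otimes> \<one> ?p) = m \<cdot> (\<one> ?p \<otimes> m) \<cdot> assoc C ?p ?p ?p"
    unfolding L R using assoc[OF f g h] .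
  have a2: "m \<cdot> (u \<otimes> \<one> ?p) = lunit C ?p"
  proof (rule iso_cancel_right[of "linv ?p"])
    have "(m \<cdot> (u \<otimes> \<one> ?p)) \<cdot> linv ?p = m \<cdot> pair P (u \<cdot> coalg_counit P) (\<one> ?p)"
      by (simp add: counit_linv[symmetric] pair_def tens_merge)
    then show "(m \<cdot> (u \<otimes> \<one> ?p)) \<cdot> linv ?p = lunit C ?p \<cdot> linv ?p"
      using unit_left[OF cohom_Ide] by simp
  qed (auto simp: iso_def inverse_arrows_def hom_def intro!: exI[of _ "lunit C ?p"])
  have a3: "m \<cdot> (\<one> ?p \<otimes> u) = runit C ?p"
  proof (rule iso_cancel_right[of "rinv ?p"])
    have "(m \<cdot> (\<one> ?p \<otimes> u)) \<cdot> rinv ?p = m \<cdot> pair P (\<one> ?p) (u \<cdot> coalg_counit P)"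
      by (simp add: counit_rinv[symmetric] pair_def tens_merge)
    then show "(m \<cdot> (\<one> ?p \<otimes> u)) \<cdot> rinv ?p = runit C ?p \<cdot> rinv ?p"
      using unit_right[OF cohom_Ide] by simp
  qed (auto simp: iso_def inverse_arrows_def hom_def intro!: exI[of _ "runit C ?p"])
  have c1: "coalg_comult P \<cdot> m = ((m \<otimes> m) \<cdot> interchange C ?p ?p ?p ?p)
      \<cdot> (coalg_comult P \<otimes> coalg_comult P)"
    using cohom_comult[OF m] by (simp add: tensor_coalg_def Let_def)
  have c2: "coalg_counit P \<cdot> m = lunit C \<I> \<cdot> (coalg_counit P \<otimes> coalg_counit P)"
    using cohom_counit[OF m] by (simp add: counit_tensor)
  have c3: "coalg_comult P \<cdot> u = (u \<otimes> u) \<cdot> linv \<I>"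
    using cohom_comult[OF u] by simp
  have c4: "coalg_counit P \<cdot> u = \<one> \<I>"
    using cohom_counit[OF u] by simp
  show ?thesis
    using coc_cocommutative[OF P] coc_coalgebra[OF P] a1 a2 a3 c1 c2 c3 c4
    unfolding bialg_def is_bialgebra_def is_algebra_def alg_morphism_def tensor_alg_def unit_alg_def
      Let_def hom_def
    by (simp del: Comp_assoc')
qed

text \<open>The monoid laws for \<open>m\<close> and \<open>u\<close> can be tested after composing
  with the jointly monic \<open>a\<close> and \<open>b\<close>, where they hold in the convolution
  monoids of \<open>A\<close> and \<open>B\<close>. This produces both the product and the pullback
  of bialgebras.\<close>

lemma jointly_monic_bialg:
  assumes P [simp]: "coc P" and A [simp]: "bialg A" and B [simp]: "bialg B"
    and a: "a \<in> cohom P (bi_coalg A)" and b: "b \<in> cohom P (bi_coalg B)"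
    and joint: "\<And>T h k. h \<in> cohom T P \<Longrightarrow> k \<in> cohom T P \<Longrightarrow> a \<cdot> h = a \<cdot> k \<Longrightarrow> b \<cdot> h = b \<cdot> k \<Longrightarrow> h = k"
    and m: "m \<in> cohom (P \<otimes>\<^sub>c P) P" and u: "u \<in> cohom unit_coalg P"
    and am: "a \<cdot> m = conv (P \<otimes>\<^sub>c P) A (a \<cdot> proj1 P P) (a \<cdot> proj2 P P)" and au: "a \<cdot> u = unt A"
    and bm: "b \<cdot> m = conv (P \<otimes>\<^sub>c P) B (b \<cdot> proj1 P P) (b \<cdot> proj2 P P)" and bu: "b \<cdot> u = unt B"
  defines "Q \<equiv> Bialgebra (Algebra \<flat>P m u) P"
  shows "bialg Q" "a \<in> bihom Q A" "b \<in> bihom Q B"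
proof -
  have p: "proj1 P P \<in> cohom (P \<otimes>\<^sub>c P) P" "proj2 P P \<in> cohom (P \<otimes>\<^sub>c P) P" by simp_all
  have mult: "c \<cdot> (m \<cdot> pair T f g) = conv T D (c \<cdot> f) (c \<cdot> g)"
    if D: "bialg D" and c: "c \<in> cohom P (bi_coalg D)"
      and cm: "c \<cdot> m = conv (P \<otimes>\<^sub>c P) D (c \<cdot> proj1 P P) (c \<cdot> proj2 P P)"
      and f: "f \<in> cohom T P" and g: "g \<in> cohom T P" for c D T f g
  proof -
    note fg = pair_cohom[OF f g]
    have "c \<cdot> (m \<cdot> pair T f g) = conv (P \<otimes>\<^sub>c P) D (c \<cdot> proj1 P P) (c \<cdot> proj2 P P) \<cdot> pair T f g"
      by (simp add: cohom_assoc[OF fg m c, symmetric] cm)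
    also have "\<dots> = conv T D (c \<cdot> f) (c \<cdot> g)"
      by (simp add: conv_comp[OF D cohom_comp[OF p(1) c] cohom_comp[OF p(2) c] fg]
          cohom_assoc[OF fg p(1) c] cohom_assoc[OF fg p(2) c] proj1_pair[OF f g] proj2_pair[OF f g])
    finally show ?thesis .
  qed
  have unit: "c \<cdot> (u \<cdot> coalg_counit T) = conv_unit T D"
    if c: "c \<in> cohom P (bi_coalg D)" and cu: "c \<cdot> u = unt D" and T: "coc T" for c D T
    by (simp add: cohom_assoc[OF counit_cohom[OF T] u c, symmetric] cu conv_unit_def)
  note ma = mult[OF A a am] and mb = mult[OF B b bm]
  note ua = unit[OF a au] and ub = unit[OF b bu]
  have closed: "m \<cdot> pair T f g \<in> cohom T P" if "f \<in> cohom T P" "g \<in> cohom T P" for T f g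
    using that m by blast
  have closed_unit: "u \<cdot> coalg_counit T \<in> cohom T P" if "coc T" for T
    using that u by (intro cohom_comp[OF counit_cohom])
  show Q: "bialg Q"
    unfolding Q_def
  proof (rule bialg_I[OF P m u])
    fix T f assume f: "f \<in> cohom T P"
    note T = cohom_coc(1)[OF f]
    note fa = cohom_comp[OF f a] and fb = cohom_comp[OF f b]
    show "m \<cdot> pair T (u \<cdot> coalg_counit T) f = f" "m \<cdot> pair T f (u \<cdot> coalg_counit T) = f"
      by (rule joint[where T = T];
          simp add: closed ma mb f T closed_unit ua ub conv_unit_left fa fb conv_unit_right)+
    fix g h assume g: "g \<in> cohom T P" and h: "h \<in> cohom T P"
    note abgh = cohom_comp[OF g a] cohom_comp[OF g b] cohom_comp[OF h a] cohom_comp[OF h b]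
    show "m \<cdot> pair T (m \<cdot> pair T f g) h = m \<cdot> pair T f (m \<cdot> pair T g h)"
      by (rule joint[where T = T]; simp add: ma mb f g h closed conv_assoc fa fb abgh)
  qed
  have convQ: "conv T Q f g = m \<cdot> pair T f g" "conv_unit T Q = u \<cdot> coalg_counit T" for T f g
    by (simp_all add: conv_def conv_unit_def Q_def)
  have coQ: "bi_coalg Q = P" by (simp add: Q_def)
  show "a \<in> bihom Q A" "b \<in> bihom Q B"
    by (rule bihom_I; simp add: Q a b coQ convQ ma mb ua ub)+
qed

text \<open>Preservation of products and units can likewise be tested after composing with a jointly
  monic pair of bialgebra morphisms. It upgrades coalgebra morphisms built on elements to bialgebra
  morphisms.\<close>

lemma bihom_reflect:
  assumes a: "a \<in> bihom P A" and b: "b \<in> bihom P B" and f: "f \<in> cohom (bi_coalg T) (bi_coalg P)"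
    and joint: "\<And>S h k. h \<in> cohom S (bi_coalg P) \<Longrightarrow> k \<in> cohom S (bi_coalg P) \<Longrightarrow>
       a \<cdot> h = a \<cdot> k \<Longrightarrow> b \<cdot> h = b \<cdot> k \<Longrightarrow> h = k"
    and af: "a \<cdot> f \<in> bihom T A" and bf: "b \<cdot> f \<in> bihom T B"
  shows "f \<in> bihom T P"
proof (rule bihom_I)
  note [simp] = bihom_bialg[OF a] bihom_bialg[OF b] bihom_bialg[OF af]
  have mult: "c \<cdot> (f \<cdot> conv S T g h) = c \<cdot> conv S P (f \<cdot> g) (f \<cdot> h)"
    if c: "c \<in> bihom P D" and cf: "c \<cdot> f \<in> bihom T D"
      and g: "g \<in> cohom S (bi_coalg T)" and h: "h \<in> cohom S (bi_coalg T)" for c D S g h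
    by (simp add: cohom_assoc[OF conv_cohom[OF bihom_bialg(1)[OF cf] g h] f
        bihom_cohom[OF c], symmetric]
        bihom_conv[OF cf g h] bihom_conv[OF c cohom_comp[OF g f] cohom_comp[OF h f]]
        cohom_assoc[OF g f bihom_cohom[OF c]] cohom_assoc[OF h f bihom_cohom[OF c]])
  show "f \<cdot> conv S T g h = conv S P (f \<cdot> g) (f \<cdot> h)"
    if g: "g \<in> cohom S (bi_coalg T)" and h: "h \<in> cohom S (bi_coalg T)" for S g h
    using mult[OF a af g h] mult[OF b bf g h] g h cohom_comp[OF g f] cohom_comp[OF h f]
    by - (rule joint[where S = S], auto intro: cohom_comp[OF _ f])
  have unit: "c \<cdot> (f \<cdot> conv_unit S T) = c \<cdot> conv_unit S P"
    if c: "c \<in> bihom P D" and cf: "c \<cdot> f \<in> bihom T D" and S: "coc S" for c D S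
    by (simp add: cohom_assoc[OF conv_unit_cohom[OF bihom_bialg(1)[OF cf] S] f
        bihom_cohom[OF c], symmetric]
        bihom_conv_unit[OF cf S] bihom_conv_unit[OF c S])
  show "f \<cdot> conv_unit S T = conv_unit S P" if S: "coc S" for S
    using unit[OF a af S] unit[OF b bf S] S
    by - (rule joint[where S = S], auto intro: cohom_comp[OF _ f])
qed (use bihom_bialg[OF a] bihom_bialg[OF af] f in simp_all)

section \<open>Products of bialgebras\<close>

lemma interchange_pair:
  assumes [simp]: "coc A" "coc B"
  defines "P \<equiv> A \<otimes>\<^sub>c B"
  shows "interchange C \<flat>A \<flat>B \<flat>A \<flat>B = pair (P \<otimes>\<^sub>c P) (proj1 A B \<otimes> proj1 A B) (proj2 A B \<otimes> proj2 A B)"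
proof -
  have P [simp]: "coc P" "\<flat>P = \<flat>A \<odot> \<flat>B" by (simp_all add: P_def)
  have "pair (P \<otimes>\<^sub>c P) (proj1 A B \<otimes> proj1 A B) (proj2 A B \<otimes> proj2 A B)
    = (((proj1 A B \<otimes> proj1 A B) \<otimes> (proj2 A B \<otimes> proj2 A B)) \<cdot> interchange C \<flat>P \<flat>P \<flat>P \<flat>P)
       \<cdot> (coalg_comult P \<otimes> coalg_comult P)"
    by (simp add: pair_def tensor_coalg_def[of C P P] Let_def del: P(2)) simp
  also have "\<dots> = (interchange C \<flat>A \<flat>B \<flat>A \<flat>B \<cdot> ((proj1 A B \<otimes> proj2 A B) \<otimes> (proj1 A B \<otimes> proj2 A B)))
       \<cdot> (coalg_comult P \<otimes> coalg_comult P)"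
    by (subst interchange_nat) simp_all
  also have "\<dots> = interchange C \<flat>A \<flat>B \<flat>A \<flat>B"
    by (simp add: tens_merge P_def proj_pair)
  finally show ?thesis by simp
qed

lemma bi_coalg_tensor [simp]: "bi_coalg (tensor_bialg C A B) = bi_coalg A \<otimes>\<^sub>c bi_coalg B"
  by (simp add: tensor_bialg_def)

lemma tensor_bialg:
  assumes A [simp]: "bialg A" and B [simp]: "bialg B"
  shows "bialg (tensor_bialg C A B)"
    "proj1 (bi_coalg A) (bi_coalg B) \<in> bihom (tensor_bialg C A B) A"
    "proj2 (bi_coalg A) (bi_coalg B) \<in> bihom (tensor_bialg C A B) B"
proof -
  let ?a = "bi_coalg A" and ?b = "bi_coalg B"
  let ?P = "?a \<otimes>\<^sub>c ?b"
  let ?p = "proj1 ?a ?b" and ?q = "proj2 ?a ?b"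
  \<comment> \<open>Multiplication by components. \<open>m_eq\<close> identifies it with the
    multiplication of \<open>tensor_alg\<close>, by writing the interchange as a pairing of tensored
    projections.\<close>
  define m where "m = pair (?P \<otimes>\<^sub>c ?P) (mult A \<cdot> (?p \<otimes> ?p)) (mult B \<cdot> (?q \<otimes> ?q))"
  define u where "u = pair unit_coalg (unt A) (unt B)"
  note [simp] = cohom_typing[OF mult_cohom[OF A]] cohom_typing[OF mult_cohom[OF B]]
      cohom_typing[OF unt_cohom[OF A]] cohom_typing[OF unt_cohom[OF B]]
  have pp: "?p \<otimes> ?p \<in> cohom (?P \<otimes>\<^sub>c ?P) (?a \<otimes>\<^sub>c ?a)" and qq:
      "?q \<otimes> ?q \<in> cohom (?P \<otimes>\<^sub>c ?P) (?b \<otimes>\<^sub>c ?b)"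
    by (simp_all add: tens_cohom)
  have m_eq: "m = (mult A \<otimes> mult B) \<cdot> interchange C \<flat>?a \<flat>?b \<flat>?a \<flat>?b"
    by (simp add: interchange_pair m_def tens_pair[OF pp qq])
  have u_eq: "u = (unt A \<otimes> unt B) \<cdot> linv \<I>"
    by (simp add: u_def pair_def)
  have Q: "tensor_bialg C A B = Bialgebra (Algebra \<flat>?P m u) ?P"
    by (simp add: tensor_bialg_def tensor_alg_def Let_def m_eq u_eq)
  have mA: "mult A \<cdot> (?p \<otimes> ?p) \<in> cohom (?P \<otimes>\<^sub>c ?P) ?a" and mB: "mult B
      \<cdot> (?q \<otimes> ?q) \<in> cohom (?P \<otimes>\<^sub>c ?P) ?b"
    by (rule cohom_comp[OF pp], simp) (rule cohom_comp[OF qq], simp)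
  have m: "m \<in> cohom (?P \<otimes>\<^sub>c ?P) ?P" unfolding m_def using mA mB by (rule pair_cohom)
  have u: "u \<in> cohom unit_coalg ?P" unfolding u_def by (intro pair_cohom) simp_all
  have joint: "h = k" if "h \<in> cohom T ?P" "k \<in> cohom T ?P" "?p \<cdot> h = ?p \<cdot> k"
      "?q \<cdot> h = ?q \<cdot> k" for T h k
    using that by - (rule pair_ext[of h T ?a ?b k], simp_all)
  have 1: "?p \<cdot> m = conv (?P \<otimes>\<^sub>c ?P) A (?p \<cdot> proj1 ?P ?P) (?p \<cdot> proj2 ?P ?P)"
    unfolding m_def proj1_pair[OF mA mB] by (subst tens_eq_pair[of ?P ?P]) (simp_all add: conv_def)
  have 2: "?q \<cdot> m = conv (?P \<otimes>\<^sub>c ?P) B (?q \<cdot> proj1 ?P ?P) (?q \<cdot> proj2 ?P ?P)"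
    unfolding m_def proj2_pair[OF mA mB] by (subst tens_eq_pair[of ?P ?P]) (simp_all add: conv_def)
  have 3: "?p \<cdot> u = unt A" "?q \<cdot> u = unt B"
    unfolding u_def by (simp_all add: proj1_pair proj2_pair)
  have p: "?p \<in> cohom ?P ?a" and q: "?q \<in> cohom ?P ?b" and P: "coc ?P" by simp_all
  show "bialg (tensor_bialg C A B)" "?p \<in> bihom (tensor_bialg C A B) A"
      "?q \<in> bihom (tensor_bialg C A B) B"
    unfolding Q by (rule jointly_monic_bialg[OF P A B p q _ m u 1 3(1) 2 3(2)]; rule joint;
        assumption)+
qed

lemma pair_bihom:
  assumes f: "f \<in> bihom T A" and g: "g \<in> bihom T B"
  shows "pair (bi_coalg T) f g \<in> bihom T (tensor_bialg C A B)"
proof (rule bihom_reflect)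
  note [simp] = bihom_bialg[OF f] bihom_bialg[OF g]
  show "proj1 (bi_coalg A) (bi_coalg B) \<in> bihom (tensor_bialg C A B) A"
    "proj2 (bi_coalg A) (bi_coalg B) \<in> bihom (tensor_bialg C A B) B"
    by (simp_all add: tensor_bialg)
  show "pair (bi_coalg T) f g \<in> cohom (bi_coalg T) (bi_coalg (tensor_bialg C A B))"
    using pair_cohom[OF bihom_cohom[OF f] bihom_cohom[OF g]] by simp
  show "proj1 (bi_coalg A) (bi_coalg B) \<cdot> pair (bi_coalg T) f g \<in> bihom T A"
    "proj2 (bi_coalg A) (bi_coalg B) \<cdot> pair (bi_coalg T) f g \<in> bihom T B"
    using proj1_pair[OF bihom_cohom[OF f] bihom_cohom[OF g]] proj2_pair[OF bihom_cohom[OF f]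
        bihom_cohom[OF g]] f g by simp_all
  show "h = k" if "h \<in> cohom S (bi_coalg (tensor_bialg C A B))"
      "k \<in> cohom S (bi_coalg (tensor_bialg C A B))"
    "proj1 (bi_coalg A) (bi_coalg B) \<cdot> h = proj1 (bi_coalg A) (bi_coalg B) \<cdot> k"
    "proj2 (bi_coalg A) (bi_coalg B) \<cdot> h = proj2 (bi_coalg A) (bi_coalg B) \<cdot> k" for S h k
    using that by - (rule pair_ext[of h S "bi_coalg A" "bi_coalg B" k], simp_all)
qed

section \<open>The two categories in terms of \<open>bihom\<close> and \<open>cohom\<close>\<close>

lemma BiAlg_simps:
  "A \<in> Obj (BiAlg_coc C) \<longleftrightarrow> bialg A"
  "f \<in> Arr (BiAlg_coc C) \<longleftrightarrow> und f \<in> bihom (src f) (tgt f)"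
  "Dom (BiAlg_coc C) = src" "Cod (BiAlg_coc C) = tgt"
  "g \<cdot>\<^bsub>BiAlg_coc C\<^esub> f = SArr (src f) (tgt g) (und g \<cdot> und f)"
  "\<one>\<^bsub>BiAlg_coc C\<^esub> A = SArr A A (\<one> (ob A))"
  "f \<in> hom (BiAlg_coc C) A B \<longleftrightarrow> src f = A \<and> tgt f = B \<and> und f \<in> bihom A B"
  by (auto simp: BiAlg_coc_def Let_def bialg_def bihom_def hom_def)

lemma CoAlg_simps:
  "f \<in> Arr (CoAlg_coc C) \<longleftrightarrow> und f \<in> cohom (src f) (tgt f)"
  "Dom (CoAlg_coc C) = src" "Cod (CoAlg_coc C) = tgt"
  "g \<cdot>\<^bsub>CoAlg_coc C\<^esub> f = SArr (src f) (tgt g) (und g \<cdot> und f)"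
  "f \<in> hom (CoAlg_coc C) A B \<longleftrightarrow> src f = A \<and> tgt f = B \<and> und f \<in> cohom A B"
  by (auto simp: CoAlg_coc_def Let_def coc_def cohom_def hom_def)

text \<open>As \<open>X \<otimes> X\<close> is a product of bialgebras, joint monicity of the legs
  is monicity of the single morphism \<open>?f\<close>. The hypothesis on the forgetful functor
  carries this to coalgebras, where \<open>h\<close> and \<open>k\<close> live.\<close>

lemma relation_jointly_monic:
  assumes forget: "forget_preserves_monos C" and rel: "is_relation (BiAlg_coc C) X r0 r1"
    and h: "h \<in> cohom T (bi_coalg (src r0))" and k: "k \<in> cohom T (bi_coalg (src r0))"
    and eq: "und r0 \<cdot> h = und r0 \<cdot> k" "und r1 \<cdot> h = und r1 \<cdot> k"
  shows "h = k"
proof -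
  let ?R = "src r0"
  have r0: "und r0 \<in> bihom ?R X" and r1: "und r1 \<in> bihom ?R X" and tgts: "tgt r0 = X" "tgt r1 = X"
      "src r1 = ?R"
    using rel by (simp_all add: is_relation_def BiAlg_simps)
  note r0' = bihom_cohom[OF r0] and r1' = bihom_cohom[OF r1]
  note typing [simp] = cohom_typing[OF r0'] cohom_typing[OF r1']
  have X [simp]: "bialg X" using bihom_bialg[OF r0] by simp
  let ?x = "bi_coalg X"
  let ?f = "pair (bi_coalg ?R) (und r0) (und r1)"
  have proj: "proj1 ?x ?x \<cdot> (?f \<cdot> g) = und r0 \<cdot> g" "proj2 ?x ?x \<cdot> (?f \<cdot> g) = und r1 \<cdot> g"
    if "g \<in> cohom S (bi_coalg ?R)" for g S
    using cohom_comp[OF that r0'] cohom_comp[OF that r1']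
    by (simp_all add: pair_comp[OF _ _ _ _ that] proj1_pair proj2_pair)
  have "monic (BiAlg_coc C) (SArr ?R (tensor_bialg C X X) ?f)"
    unfolding monic_def
  proof (intro conjI allI ballI impI)
    show "SArr ?R (tensor_bialg C X X) ?f \<in> Arr (BiAlg_coc C)"
      by (simp add: BiAlg_simps pair_bihom r0 r1)
    fix S a b assume a: "a \<in> hom (BiAlg_coc C) S (Dom (BiAlg_coc C) (SArr ?R (tensor_bialg C X X)
        ?f))"
      and b: "b \<in> hom (BiAlg_coc C) S (Dom (BiAlg_coc C) (SArr ?R (tensor_bialg C X X) ?f))"
      and ab: "SArr ?R (tensor_bialg C X X) ?f \<cdot>\<^bsub>BiAlg_coc C\<^esub> a = SArr ?R (tensor_bialg C X X) ?f
          \<cdot>\<^bsub>BiAlg_coc C\<^esub> b"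
    have a': "und a \<in> bihom S ?R" "src a = S" "tgt a = ?R" and b': "und b \<in> bihom S ?R"
        "src b = S" "tgt b = ?R"
      and ab': "?f \<cdot> und a = ?f \<cdot> und b"
      using a b ab by (simp_all add: BiAlg_simps)
    have "und r0 \<cdot> und a = und r0 \<cdot> und b" "und r1 \<cdot> und a = und r1 \<cdot> und b"
      using proj[OF bihom_cohom[OF a'(1)]] proj[OF bihom_cohom[OF b'(1)]] ab' by simp_all
    then have "r0 \<cdot>\<^bsub>BiAlg_coc C\<^esub> a = r0 \<cdot>\<^bsub>BiAlg_coc C\<^esub> b"
        "r1 \<cdot>\<^bsub>BiAlg_coc C\<^esub> a = r1 \<cdot>\<^bsub>BiAlg_coc C\<^esub> b"
      by (simp_all add: BiAlg_simps a' b')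
    moreover have "a \<in> hom (BiAlg_coc C) S (Dom (BiAlg_coc C) r0)"
        "b \<in> hom (BiAlg_coc C) S (Dom (BiAlg_coc C) r0)"
      using a b by (simp_all add: BiAlg_simps)
    ultimately show "a = b"
      using rel unfolding is_relation_def by blast
  qed
  then have mono: "monic (CoAlg_coc C) (SArr (bi_coalg ?R) (?x \<otimes>\<^sub>c ?x) ?f)"
    using forget unfolding forget_preserves_monos_def forget_def by fastforce
  have "?f \<cdot> h = ?f \<cdot> k"
    using eq by (simp add: pair_comp[OF _ _ _ _ h] pair_comp[OF _ _ _ _ k])
  then have "SArr (bi_coalg ?R) (?x \<otimes>\<^sub>c ?x) ?f \<cdot>\<^bsub>CoAlg_coc C\<^esub> SArr T (bi_coalg ?R) h
      = SArr (bi_coalg ?R) (?x \<otimes>\<^sub>c ?x) ?f \<cdot>\<^bsub>CoAlg_coc C\<^esub> SArr T (bi_coalg ?R) k"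
    by (simp add: CoAlg_simps)
  moreover have "SArr T (bi_coalg ?R) g \<in> hom (CoAlg_coc C) T (Dom (CoAlg_coc C) (SArr (bi_coalg
      ?R) (?x \<otimes>\<^sub>c ?x) ?f))"
    if "g \<in> cohom T (bi_coalg ?R)" for g
    using that by (simp add: CoAlg_simps)
  ultimately have "SArr T (bi_coalg ?R) h = SArr T (bi_coalg ?R) k"
    using mono h k unfolding monic_def by blast
  then show ?thesis by simp
qed

end

section \<open>Commuting Schreier relations of monoids\<close>

text \<open>An explicit carrier, because the elements will be the coalgebra morphisms out of one
  fixed coalgebra, which form a set of arrows of \<open>C\<close>.\<close>

locale carrier_monoid =
  fixes M :: "'m set" and mul :: "'m \<Rightarrow> 'm \<Rightarrow> 'm" and unit :: 'm
  assumes closed [simp]: "x \<in> M \<Longrightarrow> y \<in> M \<Longrightarrow> mul x y \<in> M"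
    and unit_closed [simp]: "unit \<in> M"
    and assoc: "x \<in> M \<Longrightarrow> y \<in> M \<Longrightarrow> z \<in> M \<Longrightarrow> mul (mul x y) z = mul x (mul y z)"
    and left_unit [simp]: "x \<in> M \<Longrightarrow> mul unit x = x"
    and right_unit [simp]: "x \<in> M \<Longrightarrow> mul x unit = x"

text \<open>What a single coalgebra \<open>T\<close> sees of an \<open>S_coc\<close>-equivalence
  relation. \<open>decomp\<close> gives existence and \<open>retract\<close> uniqueness of the
  component in \<open>K\<close>; \<open>l\<close> is a mere function, whereas the other maps are
  homomorphisms.\<close>

locale schreier_relation =
  X: carrier_monoid X mX uX + R: carrier_monoid R mR uR + K: carrier_monoid K mK uK
  for X :: "'m set" and mX (infixr "\<star>" 70) and uX and R mR uR and K mK uK +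
  fixes r0 r1 e k l s :: "'m \<Rightarrow> 'm"
  assumes typing [simp]: "r \<in> R \<Longrightarrow> r0 r \<in> X" "r \<in> R \<Longrightarrow> r1 r \<in> X" "x \<in> X \<Longrightarrow> e x \<in> R"
      "a \<in> K \<Longrightarrow> k a \<in> R" "r \<in> R \<Longrightarrow> l r \<in> K" "r \<in> R \<Longrightarrow> s r \<in> R"
    and hom [simp]: "r \<in> R \<Longrightarrow> r' \<in> R \<Longrightarrow> r0 (mR r r') = r0 r \<star> r0 r'"
      "r \<in> R \<Longrightarrow> r' \<in> R \<Longrightarrow> r1 (mR r r') = r1 r \<star> r1 r'"
      "x \<in> X \<Longrightarrow> x' \<in> X \<Longrightarrow> e (x \<star> x') = mR (e x) (e x')"
      "a \<in> K \<Longrightarrow> a' \<in> K \<Longrightarrow> k (mK a a') = mR (k a) (k a')"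
      "r \<in> R \<Longrightarrow> r' \<in> R \<Longrightarrow> s (mR r r') = mR (s r) (s r')"
      "r0 uR = uX" "r1 uR = uX" "e uX = uR" "k uK = uR" "s uR = uR"
    and splitting [simp]: "x \<in> X \<Longrightarrow> r0 (e x) = x" "x \<in> X \<Longrightarrow> r1 (e x) = x"
    and kernel [simp]: "a \<in> K \<Longrightarrow> r0 (k a) = uX"
    and sym [simp]: "r \<in> R \<Longrightarrow> r0 (s r) = r1 r" "r \<in> R \<Longrightarrow> r1 (s r) = r0 r"
    and decomp: "r \<in> R \<Longrightarrow> mR (k (l r)) (e (r0 r)) = r"
    and retract [simp]: "a \<in> K \<Longrightarrow> x \<in> X \<Longrightarrow> l (mR (k a) (e x)) = a"
    and joint: "r \<in> R \<Longrightarrow> r' \<in> R \<Longrightarrow> r0 r = r0 r' \<Longrightarrow> r1 r = r1 r' \<Longrightarrow> r = r'"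
begin

text \<open>For \<open>r = (x, y)\<close> this is the quotient of \<open>x\<close> by
  \<open>y\<close>. The decomposition divides the second leg by the first, hence the reversed pair
  \<open>s r\<close>.\<close>

definition w :: "'m \<Rightarrow> 'm" where "w r = r1 (k (l (s r)))"

lemma w_closed [simp]: "r \<in> R \<Longrightarrow> w r \<in> X"
  by (simp add: w_def)

lemma r1_decomp: "r \<in> R \<Longrightarrow> r1 (k (l r)) \<star> r0 r = r1 r"
  using arg_cong[OF decomp, of r r1] by simp

lemma w_decomp: "r \<in> R \<Longrightarrow> w r \<star> r1 r = r0 r"
  using r1_decomp[of "s r"] by (simp add: w_def)

lemma l_section [simp]: "x \<in> X \<Longrightarrow> l (e x) = uK"
  using retract[of uK x] by simp

text \<open>By \<open>joint\<close>, a pair with equal legs lies in the image of \<open>e\<close>,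
  where the component in \<open>K\<close> is trivial.\<close>

lemma w_diagonal:
  assumes "r \<in> R" "r0 r = r1 r"
  shows "w r = uX"
proof -
  have "s r = e (r1 r)" using assms by - (rule joint, simp_all)
  then show ?thesis using assms by (simp add: w_def)
qed

text \<open>Uniqueness of quotients without cancellation in \<open>X\<close>: \<open>joint\<close>
  identifies the reversed pair with \<open>mR (k a) (e (r1 r))\<close>, and \<open>retract\<close>
  reads off \<open>a\<close>.\<close>

lemma w_eqI:
  assumes "r \<in> R" "a \<in> K" "r1 (k a) \<star> r1 r = r0 r"
  shows "w r = r1 (k a)"
proof -
  have "s r = mR (k a) (e (r1 r))" using assms by - (rule joint, simp_all)
  then show ?thesis using assms by (simp add: w_def)
qed

text \<open>To compute the quotient of a product, \<open>w r'\<close> has to move to the left of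
  \<open>r1 r\<close>. In the absence of inverses the Schreier decomposition provides the conjugate
  \<open>c\<close>.\<close>

lemma w_mult:
  assumes r: "r \<in> R" "r' \<in> R"
  obtains c where "c \<in> K" "w (mR r r') = w r \<star> r1 (k c)" "r1 (k c) \<star> r1 r = r1 r \<star> w r'"
proof -
  \<comment> \<open>With \<open>y = r1 r\<close>, this is the pair \<open>(y, y w')\<close> for
    \<open>w' = w r'\<close>. Its component in \<open>K\<close> is the wanted \<open>c\<close>, as
    its decomposition reads \<open>c y = y w'\<close>.\<close>
  define t where "t = mR (e (r1 r)) (k (l (s r')))"
  have t: "t \<in> R" "r0 t = r1 r" "r1 t = r1 r \<star> w r'"
    using r by (simp_all add: t_def w_def)
  have c: "r1 (k (l t)) \<star> r1 r = r1 r \<star> w r'"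
    using r1_decomp[OF t(1)] t by simp
  have "w (mR r r') = r1 (k (mK (l (s r)) (l t)))"
  proof (rule w_eqI)
    have "r1 (k (mK (l (s r)) (l t))) \<star> r1 (mR r r') = w r \<star> (r1 (k (l t)) \<star> r1 r) \<star> r1 r'"
      using r t(1) by (simp add: X.assoc w_def)
    also have "\<dots> = r0 (mR r r')"
      unfolding c using r by (simp add: X.assoc w_decomp) (simp add: X.assoc[symmetric] w_decomp)
    finally show "r1 (k (mK (l (s r)) (l t))) \<star> r1 (mR r r') = r0 (mR r r')" .
  qed (use r t(1) in simp_all)
  then show ?thesis
    using that[of "l t"] c r t(1) by (simp add: w_def)
qed

end

locale commuting_schreier_relations =
  R: schreier_relation X mX uX R mR uR K mK uK r0 r1 e k l s +
  S: schreier_relation X mX uX S mS uS L mL uL s0 s1 e' k' l' s'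
  for X :: "'m set" and mX (infixr "\<star>" 70) and uX and R mR uR and K mK uK and r0 r1 e k l s
    and S mS uS and L mL uL and s0 s1 e' k' l' s' +
  assumes commute: "a \<in> K \<Longrightarrow> b \<in> L \<Longrightarrow> r1 (k a) \<star> s1 (k' b) = s1 (k' b) \<star> r1 (k a)"
begin

text \<open>With \<open>r = (x, y)\<close> and \<open>q = (y, z)\<close> this is \<open>p(x, y, z)\<close>.\<close>

definition p :: "'m \<Rightarrow> 'm \<Rightarrow> 'm" where "p r q = R.w r \<star> s1 q"

lemma p_closed [simp]: "r \<in> R \<Longrightarrow> q \<in> S \<Longrightarrow> p r q \<in> X"
  by (simp add: p_def)

text \<open>With \<open>z = v y\<close>, commutation gives \<open>w z = w v y = v w y = v x\<close>.
  This second formula is what relates \<open>p(x, y, z)\<close> to \<open>x\<close> by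
  \<open>S\<close>.\<close>

lemma p_alt:
  assumes "r \<in> R" "q \<in> S" "r1 r = s0 q"
  shows "p r q = s1 (k' (l' q)) \<star> r0 r"
proof -
  have "p r q = (R.w r \<star> s1 (k' (l' q))) \<star> r1 r"
    using assms S.r1_decomp[of q] by (simp add: p_def R.X.assoc)
  also have "\<dots> = s1 (k' (l' q)) \<star> r0 r"
    using assms commute[of "l (s r)" "l' q"] R.w_decomp[of r]
    by (simp add: R.w_def R.X.assoc)
  finally show ?thesis .
qed

text \<open>The element \<open>c\<close> that carries \<open>R.w r'\<close> past
  \<open>y = r1 r\<close> also carries it past \<open>s1 q\<close>: the latter is
  \<open>?v \<star> y\<close>, and \<open>c\<close> commutes with \<open>?v\<close>. Only the first
  pair has to match.\<close>

lemma p_mult: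
  assumes r: "r \<in> R" "r' \<in> R" and q: "q \<in> S" "q' \<in> S" and rq: "r1 r = s0 q"
  shows "p (mR r r') (mS q q') = p r q \<star> p r' q'"
proof -
  obtain c where c: "c \<in> K" "R.w (mR r r') = R.w r \<star> r1 (k c)" "r1 (k c) \<star> r1 r = r1 r \<star> R.w r'"
    using R.w_mult[OF r] by blast
  let ?v = "s1 (k' (l' q))"
  have "r1 (k c) \<star> s1 q = (r1 (k c) \<star> ?v) \<star> r1 r"
    using q c(1) r S.r1_decomp[of q] by (simp add: R.X.assoc rq)
  also have "\<dots> = ?v \<star> (r1 (k c) \<star> r1 r)"
    using q c(1) r by (simp add: commute R.X.assoc)
  also have "\<dots> = (?v \<star> r1 r) \<star> R.w r'"
    unfolding c(3) using q r by (simp add: R.X.assoc)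
  also have "\<dots> = s1 q \<star> R.w r'"
    using q S.r1_decomp[of q] by (simp add: rq)
  finally have "r1 (k c) \<star> s1 q = s1 q \<star> R.w r'" .
  then have "R.w r \<star> (r1 (k c) \<star> s1 q) \<star> s1 q' = R.w r \<star> (s1 q \<star> R.w r') \<star> s1 q'"
    by simp
  then show ?thesis
    using r q c(1) by (simp add: p_def c(2) R.X.assoc)
qed

lemma p_unit: "p uR uS = uX"
  using R.w_diagonal[of uR] by (simp add: p_def)

lemma p_left: "r \<in> R \<Longrightarrow> q \<in> S \<Longrightarrow> r0 r = r1 r \<Longrightarrow> p r q = s1 q"
  by (simp add: p_def R.w_diagonal)

lemma p_right: "r \<in> R \<Longrightarrow> q \<in> S \<Longrightarrow> r1 r = s0 q \<Longrightarrow> s0 q = s1 q \<Longrightarrow> p r q = r0 r"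
  using R.w_decomp[of r] by (simp add: p_def)

text \<open>Quotients compose: by uniqueness, the quotient of \<open>x\<close> by \<open>u\<close>
  is that of \<open>x\<close> by \<open>y\<close> times that of \<open>y\<close> by
  \<open>u\<close>. Here \<open>\<rho>1 = (y, u)\<close>, \<open>\<rho>2 = (x, y)\<close> and
  \<open>\<rho>3 = (x, u)\<close>.\<close>

lemma p_assoc_right:
  assumes "\<rho>1 \<in> R" "q1 \<in> S" "\<rho>2 \<in> R" "q2 \<in> S" "\<rho>3 \<in> R" "q3 \<in> S"
    and "s1 q2 = p \<rho>1 q1" "r1 \<rho>2 = r0 \<rho>1" "r0 \<rho>3 = r0 \<rho>2" "r1 \<rho>3 = r1 \<rho>1" "s1 q3 = s1 q1"
  shows "p \<rho>2 q2 = p \<rho>3 q3"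
proof -
  have "R.w \<rho>3 = r1 (k (mK (l (s \<rho>2)) (l (s \<rho>1))))"
  proof (rule R.w_eqI)
    have "r1 (k (mK (l (s \<rho>2)) (l (s \<rho>1)))) \<star> r1 \<rho>3 = R.w \<rho>2 \<star> (R.w \<rho>1 \<star> r1 \<rho>1)"
      using assms by (simp add: R.w_def R.X.assoc)
    also have "\<dots> = r0 \<rho>3" using assms R.w_decomp[of \<rho>1] R.w_decomp[of \<rho>2] by simp
    finally show "r1 (k (mK (l (s \<rho>2)) (l (s \<rho>1)))) \<star> r1 \<rho>3 = r0 \<rho>3" .
  qed (use assms in simp_all)
  then show ?thesis using assms by (simp add: p_def R.w_def R.X.assoc)
qed

text \<open>As \<open>p(x, y, u)\<close> is \<open>u\<close> multiplied by the quotient of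
  \<open>x\<close> by \<open>y\<close>, its quotient by \<open>u\<close> is that same element. Here
  \<open>\<rho>1\<close> and \<open>\<rho>3\<close> are \<open>(x, y)\<close>, and
  \<open>\<rho>2 = (p(x, y, u), u)\<close>.\<close>

lemma p_assoc_left:
  assumes "\<rho>1 \<in> R" "q1 \<in> S" "\<rho>2 \<in> R" "q2 \<in> S" "\<rho>3 \<in> R" "q3 \<in> S"
    and "r0 \<rho>2 = p \<rho>1 q1" "r1 \<rho>2 = s1 q1" "r0 \<rho>3 = r0 \<rho>1" "r1 \<rho>3 = r1 \<rho>1" "s1 q3 = s1 q2"
  shows "p \<rho>2 q2 = p \<rho>3 q3"
proof -
  have "\<rho>3 = \<rho>1" using assms by - (rule R.joint, simp_all)
  moreover have "R.w \<rho>2 = r1 (k (l (s \<rho>1)))"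
    using assms by - (rule R.w_eqI, simp_all add: p_def R.w_def)
  ultimately show ?thesis using assms by (simp add: p_def R.w_def)
qed

text \<open>The elements \<open>(x, p(x, y, z)) \<in> S\<close> and \<open>(z, p(x, y, z)) \<in> R\<close>.\<close>

definition pS :: "'m \<Rightarrow> 'm \<Rightarrow> 'm" where "pS r q = mS (k' (l' q)) (e' (r0 r))"
definition pR :: "'m \<Rightarrow> 'm \<Rightarrow> 'm" where "pR r q = mR (k (l (s r))) (e (s1 q))"

text \<open>The second leg comes out as \<open>v x\<close>, which is \<open>p\<close> by
  \<open>p_alt\<close>; thus this leg rests on commutation, whereas those of \<open>pR\<close>
  follow from the definition of \<open>p\<close>.\<close>

lemma pS_legs:
  assumes "r \<in> R" "q \<in> S" "r1 r = s0 q"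
  shows "s0 (pS r q) = r0 r" "s1 (pS r q) = p r q"
  using assms by (simp_all add: pS_def p_alt)

lemma pR_legs:
  assumes "r \<in> R" "q \<in> S"
  shows "r0 (pR r q) = s1 q" "r1 (pR r q) = p r q"
  using assms by (simp_all add: pR_def p_def R.w_def)

end

section \<open>The connector of commuting relations\<close>

text \<open>Elements are arbitrary coalgebra morphisms because convolution products of bialgebra
  morphisms need not be bialgebra morphisms. Accordingly the Schreier laws and joint monicity are
  stated for every coalgebra \<open>T\<close>.\<close>

locale schreier_bialgebras = symmetric_monoidal_category C
  for C :: "('o, 'm, 'z) monoidal_category_scheme" (structure) +
  fixes X R K :: "('o, 'm) bialgebra" and r0 r1 e k l s :: 'm
  assumes legs: "r0 \<in> bihom R X" "r1 \<in> bihom R X" and e: "e \<in> bihom X R" and k: "k \<in> bihom K R"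
    and l: "l \<in> cohom (bi_coalg R) (bi_coalg K)" and s: "s \<in> bihom R R"
    and section_eq: "r0 \<cdot> e = \<one> (ob X)" "r1 \<cdot> e = \<one> (ob X)"
    and kernel_eq: "r0 \<cdot> k = conv_unit (bi_coalg K) X"
    and sym_eq: "r0 \<cdot> s = r1" "r1 \<cdot> s = r0"
    and decomp_eq: "r \<in> cohom T (bi_coalg R) \<Longrightarrow> conv T R (k \<cdot> (l \<cdot> r)) (e \<cdot> (r0 \<cdot> r)) = r"
    and retract_eq: "a \<in> cohom T (bi_coalg K) \<Longrightarrow> x \<in> cohom T (bi_coalg X) \<Longrightarrow>
      l \<cdot> conv T R (k \<cdot> a) (e \<cdot> x) = a"
    and jointly_monic: "h \<in> cohom T (bi_coalg R) \<Longrightarrow> h' \<in> cohom T (bi_coalg R) \<Longrightarrow>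
      r0 \<cdot> h = r0 \<cdot> h' \<Longrightarrow> r1 \<cdot> h = r1 \<cdot> h' \<Longrightarrow> h = h'"
begin

lemma bialgs [simp]: "bialg X" "bialg R" "bialg K"
  using bihom_bialg[OF e] bihom_bialg[OF k] by simp_all

lemmas legs_cohom = bihom_cohom[OF legs(1)] bihom_cohom[OF legs(2)]
lemmas eks_cohom = bihom_cohom[OF e] bihom_cohom[OF k] bihom_cohom[OF s]

lemma elements_monoid:
  assumes "bialg A" "coc T"
  shows "carrier_monoid (cohom T (bi_coalg A)) (conv T A) (conv_unit T A)"
  by unfold_locales (simp_all add: assms conv_assoc conv_unit_left conv_unit_right)

lemma elements:
  assumes T [simp]: "coc T"
  shows "schreier_relation (cohom T (bi_coalg X)) (conv T X) (conv_unit T X)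
    (cohom T (bi_coalg R)) (conv T R) (conv_unit T R) (cohom T (bi_coalg K)) (conv T K) (conv_unit
        T K)
    (\<lambda>f. r0 \<cdot> f) (\<lambda>f. r1 \<cdot> f) (\<lambda>f. e \<cdot> f) (\<lambda>f. k \<cdot> f) (\<lambda>f. l \<cdot> f) (\<lambda>f. s \<cdot> f)"
proof (intro schreier_relation.intro elements_monoid bialgs T schreier_relation_axioms.intro)
  fix r r' assume r: "r \<in> cohom T (bi_coalg R)" and r': "r' \<in> cohom T (bi_coalg R)"
  show "r0 \<cdot> r \<in> cohom T (bi_coalg X)" "r1 \<cdot> r \<in> cohom T (bi_coalg X)"
      "l \<cdot> r \<in> cohom T (bi_coalg K)"
    "s \<cdot> r \<in> cohom T (bi_coalg R)"
    by (rule cohom_comp[OF r] legs_cohom l eks_cohom)+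
  show "r0 \<cdot> conv T R r r' = conv T X (r0 \<cdot> r) (r0 \<cdot> r')"
    "r1 \<cdot> conv T R r r' = conv T X (r1 \<cdot> r) (r1 \<cdot> r')"
    "s \<cdot> conv T R r r' = conv T R (s \<cdot> r) (s \<cdot> r')"
    by (rule bihom_conv r r' legs s)+
  show "r0 \<cdot> (s \<cdot> r) = r1 \<cdot> r" "r1 \<cdot> (s \<cdot> r) = r0 \<cdot> r"
    using cohom_assoc[OF r eks_cohom(3) legs_cohom(1)]
        cohom_assoc[OF r eks_cohom(3) legs_cohom(2)] by (simp_all add: sym_eq)
  show "conv T R (k \<cdot> (l \<cdot> r)) (e \<cdot> (r0 \<cdot> r)) = r"
    by (rule decomp_eq[OF r])
  show "r = r'" if "r0 \<cdot> r = r0 \<cdot> r'" "r1 \<cdot> r = r1 \<cdot> r'"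
    using that by (rule jointly_monic[OF r r'])
next
  fix x x' assume x: "x \<in> cohom T (bi_coalg X)" and x': "x' \<in> cohom T (bi_coalg X)"
  show "e \<cdot> x \<in> cohom T (bi_coalg R)" by (rule cohom_comp[OF x] eks_cohom)+
  show "e \<cdot> conv T X x x' = conv T R (e \<cdot> x) (e \<cdot> x')" by (rule bihom_conv[OF e x x'])
  show "r0 \<cdot> (e \<cdot> x) = x" "r1 \<cdot> (e \<cdot> x) = x"
    using cohom_assoc[OF x eks_cohom(1) legs_cohom(1)]
        cohom_assoc[OF x eks_cohom(1) legs_cohom(2)] cohom_Ide_comp[OF x]
    by (simp_all add: section_eq)
next
  fix a a' assume a: "a \<in> cohom T (bi_coalg K)" and a': "a' \<in> cohom T (bi_coalg K)"
  show "k \<cdot> a \<in> cohom T (bi_coalg R)" by (rule cohom_comp[OF a] eks_cohom)+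
  show "k \<cdot> conv T K a a' = conv T R (k \<cdot> a) (k \<cdot> a')" by (rule bihom_conv[OF k a a'])
  show "r0 \<cdot> (k \<cdot> a) = conv_unit T X"
    using cohom_assoc[OF a eks_cohom(2) legs_cohom(1)] by (simp add: kernel_eq
        conv_unit_comp[OF _ a])
  show "l \<cdot> conv T R (k \<cdot> a) (e \<cdot> x) = a" if "x \<in> cohom T (bi_coalg X)" for x
    by (rule retract_eq[OF a that])
qed (simp_all add: bihom_conv_unit[OF legs(1)] bihom_conv_unit[OF legs(2)] bihom_conv_unit[OF e]
    bihom_conv_unit[OF k] bihom_conv_unit[OF s])

end

locale commuting_schreier_bialgebras = symmetric_monoidal_category C +
  R: schreier_bialgebras C X R K r0 r1 e k l s + S: schreier_bialgebras C X S L s0 s1 e' k' l' s'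
  for C :: "('o, 'm, 'z) monoidal_category_scheme" (structure)
    and X R K r0 r1 e k l s S L s0 s1 e' k' l' s' +
  assumes commute: "a \<in> cohom T (bi_coalg K) \<Longrightarrow> b \<in> cohom T (bi_coalg L) \<Longrightarrow>
    conv T X (r1 \<cdot> (k \<cdot> a)) (s1 \<cdot> (k' \<cdot> b)) = conv T X (s1 \<cdot> (k' \<cdot> b)) (r1 \<cdot> (k \<cdot> a))"
begin

lemma elements:
  assumes T: "coc T"
  shows "commuting_schreier_relations (cohom T (bi_coalg X)) (conv T X) (conv_unit T X)
    (cohom T (bi_coalg R)) (conv T R) (conv_unit T R) (cohom T (bi_coalg K)) (conv T K) (conv_unit
        T K)
    (\<lambda>f. r0 \<cdot> f) (\<lambda>f. r1 \<cdot> f) (\<lambda>f. e \<cdot> f) (\<lambda>f. k \<cdot> f) (\<lambda>f. l \<cdot> f) (\<lambda>f. s \<cdot> f)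
    (cohom T (bi_coalg S)) (conv T S) (conv_unit T S) (cohom T (bi_coalg L)) (conv T L) (conv_unit
        T L)
    (\<lambda>f. s0 \<cdot> f) (\<lambda>f. s1 \<cdot> f) (\<lambda>f. e' \<cdot> f) (\<lambda>f. k' \<cdot> f) (\<lambda>f. l' \<cdot> f) (\<lambda>f. s' \<cdot> f)"
  by (intro commuting_schreier_relations.intro commuting_schreier_relations_axioms.intro
      R.elements S.elements T commute)

text \<open>As \<open>s0\<close> is split with kernel \<open>L\<close>, the pullback \<open>R \<times>\<^sub>X S\<close> is carried by \<open>R \<otimes> L\<close>: the pair
  \<open>(r, b)\<close> stands for \<open>(r, \<sigma>(r, b))\<close> with \<open>\<sigma>(r, b) = k'(b) e'(r1(r))\<close>.\<close>

definition P :: "('o, 'm) coalgebra" where "P = bi_coalg R \<otimes>\<^sub>c bi_coalg L"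
definition \<pi> :: 'm where "\<pi> = proj1 (bi_coalg R) (bi_coalg L)"
definition \<beta> :: 'm where "\<beta> = proj2 (bi_coalg R) (bi_coalg L)"
definition \<sigma> :: 'm where "\<sigma> = conv P S (k' \<cdot> \<beta>) (e' \<cdot> (r1 \<cdot> \<pi>))"
definition lift :: "('o, 'm) coalgebra \<Rightarrow> 'm \<Rightarrow> 'm \<Rightarrow> 'm" where "lift T r q = pair T r (l' \<cdot> q)"

lemma P_coc [simp]: "coc P" by (simp add: P_def)
lemma \<pi>_cohom: "\<pi> \<in> cohom P (bi_coalg R)" and \<beta>_cohom: "\<beta> \<in> cohom P (bi_coalg L)"
  by (simp_all add: P_def \<pi>_def \<beta>_def)

lemma \<sigma>_cohom: "\<sigma> \<in> cohom P (bi_coalg S)"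
  unfolding \<sigma>_def
  by (rule conv_cohom[OF S.bialgs(2) cohom_comp[OF \<beta>_cohom S.eks_cohom(2)] cohom_comp[OF
      cohom_comp[OF \<pi>_cohom R.legs_cohom(2)] S.eks_cohom(1)]])

lemma \<sigma>_comp:
  assumes t: "t \<in> cohom T P"
  shows "\<sigma> \<cdot> t = conv T S (k' \<cdot> (\<beta> \<cdot> t)) (e' \<cdot> (r1 \<cdot> (\<pi> \<cdot> t)))"
  unfolding \<sigma>_def using cohom_comp[OF \<beta>_cohom S.eks_cohom(2)] cohom_comp[OF
      cohom_comp[OF \<pi>_cohom R.legs_cohom(2)] S.eks_cohom(1)]
  by (simp add: conv_comp[OF _ _ _ t] cohom_assoc[OF t \<beta>_cohom S.eks_cohom(2)]
      cohom_assoc[OF t cohom_comp[OF \<pi>_cohom R.legs_cohom(2)] S.eks_cohom(1)]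
          cohom_assoc[OF t \<pi>_cohom R.legs_cohom(2)])

text \<open>The last equation recovers the component of \<open>t\<close> in \<open>L\<close> from
  \<open>\<sigma> \<cdot> t\<close>; it makes \<open>\<pi>\<close> and \<open>\<sigma>\<close>
  jointly monic.\<close>

lemma P_elements:
  assumes t: "t \<in> cohom T P"
  shows "\<pi> \<cdot> t \<in> cohom T (bi_coalg R)" "\<sigma> \<cdot> t \<in> cohom T (bi_coalg S)"
    "r1 \<cdot> (\<pi> \<cdot> t) = s0 \<cdot> (\<sigma> \<cdot> t)" "l' \<cdot> (\<sigma> \<cdot> t) = \<beta> \<cdot> t"
proof -
  interpret E: commuting_schreier_relations "cohom T (bi_coalg X)" "conv T X" "conv_unit T X"
    "cohom T (bi_coalg R)" "conv T R" "conv_unit T R" "cohom T (bi_coalg K)" "conv T K"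
        "conv_unit T K"
    "\<lambda>f. r0 \<cdot> f" "\<lambda>f. r1 \<cdot> f" "\<lambda>f. e \<cdot> f" "\<lambda>f. k \<cdot> f" "\<lambda>f. l \<cdot> f" "\<lambda>f. s \<cdot> f"
    "cohom T (bi_coalg S)" "conv T S" "conv_unit T S" "cohom T (bi_coalg L)" "conv T L"
        "conv_unit T L"
    "\<lambda>f. s0 \<cdot> f" "\<lambda>f. s1 \<cdot> f" "\<lambda>f. e' \<cdot> f" "\<lambda>f. k' \<cdot> f" "\<lambda>f. l' \<cdot> f" "\<lambda>f. s' \<cdot> f"
    by (rule elements[OF cohom_coc(1)[OF t]])
  have \<beta>: "\<beta> \<cdot> t \<in> cohom T (bi_coalg L)" by (rule cohom_comp[OF t \<beta>_cohom])
  show \<pi>: "\<pi> \<cdot> t \<in> cohom T (bi_coalg R)" by (rule cohom_comp[OF t \<pi>_cohom])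
  show "\<sigma> \<cdot> t \<in> cohom T (bi_coalg S)" by (rule cohom_comp[OF t \<sigma>_cohom])
  show "r1 \<cdot> (\<pi> \<cdot> t) = s0 \<cdot> (\<sigma> \<cdot> t)" "l' \<cdot> (\<sigma> \<cdot> t) = \<beta> \<cdot> t"
    unfolding \<sigma>_comp[OF t] using \<beta> \<pi> by simp_all
qed

lemma P_joint:
  assumes "h \<in> cohom T P" "h' \<in> cohom T P" "\<pi> \<cdot> h = \<pi> \<cdot> h'" "\<sigma> \<cdot> h = \<sigma> \<cdot> h'"
  shows "h = h'"
proof -
  have "\<beta> \<cdot> h = \<beta> \<cdot> h'"
    using P_elements(4)[OF assms(1)] P_elements(4)[OF assms(2)] assms(4) by simp
  then show ?thesis
    using assms unfolding P_def \<pi>_def \<beta>_def by - (rule pair_ext, simp_all)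
qed

text \<open>Decomposing \<open>q\<close> along \<open>s0\<close> writes it as the product of
  \<open>k' (l' q)\<close> and \<open>e' (s0 q)\<close>, and \<open>s0 q = r1 r\<close>. Hence
  \<open>(r, l' q)\<close> stands for the matching pair \<open>(r, q)\<close>.\<close>

lemma lift:
  assumes r: "r \<in> cohom T (bi_coalg R)" and q: "q \<in> cohom T (bi_coalg S)" and rq: "r1 \<cdot> r = s0 \<cdot> q"
  shows "lift T r q \<in> cohom T P" "\<pi> \<cdot> lift T r q = r" "\<sigma> \<cdot> lift T r q = q"
proof -
  have lq: "l' \<cdot> q \<in> cohom T (bi_coalg L)" by (rule cohom_comp[OF q S.l])
  show t: "lift T r q \<in> cohom T P" unfolding lift_def P_def by (rule pair_cohom[OF r lq])
  show \<pi>: "\<pi> \<cdot> lift T r q = r" unfolding lift_def \<pi>_def by (rule proj1_pair[OF r lq])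
  have \<beta>: "\<beta> \<cdot> lift T r q = l' \<cdot> q" unfolding lift_def \<beta>_def by (rule proj2_pair[OF r lq])
  show "\<sigma> \<cdot> lift T r q = q"
    unfolding \<sigma>_comp[OF t] \<pi> \<beta> rq by (rule S.decomp_eq[OF q])
qed

text \<open>The multiplication of the pullback, componentwise in \<open>R\<close> and
  \<open>S\<close> and then lifted. It is not taken from \<open>tensor_bialg\<close>, although the
  underlying coalgebra is a tensor product.\<close>

definition P_mult :: 'm where
  "P_mult = lift (P \<otimes>\<^sub>c P) (conv (P \<otimes>\<^sub>c P) R (\<pi> \<cdot> proj1 P P) (\<pi> \<cdot> proj2 P P))
     (conv (P \<otimes>\<^sub>c P) S (\<sigma> \<cdot> proj1 P P) (\<sigma> \<cdot> proj2 P P))"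

definition P_unit :: 'm where "P_unit = lift unit_coalg (unt R) (unt S)"

definition Q :: "('o, 'm) bialgebra" where "Q = Bialgebra (Algebra (coalg_ob P) P_mult P_unit) P"

lemma bi_coalg_Q [simp]: "bi_coalg Q = P" by (simp add: Q_def)

lemma Q: "bialg Q" "\<pi> \<in> bihom Q R" "\<sigma> \<in> bihom Q S"
proof -
  have p: "proj1 P P \<in> cohom (P \<otimes>\<^sub>c P) P" "proj2 P P \<in> cohom (P \<otimes>\<^sub>c P) P" by simp_all
  note \<pi>\<sigma> = P_elements[OF p(1)] P_elements[OF p(2)]
  have m: "r1 \<cdot> conv (P \<otimes>\<^sub>c P) R (\<pi> \<cdot> proj1 P P) (\<pi> \<cdot> proj2 P P)
      = s0 \<cdot> conv (P \<otimes>\<^sub>c P) S (\<sigma> \<cdot> proj1 P P) (\<sigma> \<cdot> proj2 P P)"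
    by (simp add: bihom_conv[OF R.legs(2)] bihom_conv[OF S.legs(1)] \<pi>\<sigma>)
  have u: "r1 \<cdot> unt R = s0 \<cdot> unt S"
    by (simp add: unt_as_conv_unit bihom_conv_unit[OF R.legs(2)] bihom_conv_unit[OF S.legs(1)])
  note M = lift[OF conv_cohom[OF R.bialgs(2) \<pi>\<sigma>(1) \<pi>\<sigma>(5)]
      conv_cohom[OF S.bialgs(2) \<pi>\<sigma>(2) \<pi>\<sigma>(6)] m, folded P_mult_def]
  note U = lift[OF unt_cohom[OF R.bialgs(2)] unt_cohom[OF S.bialgs(2)] u, folded P_unit_def]
  note J = jointly_monic_bialg[OF P_coc R.bialgs(2) S.bialgs(2) \<pi>_cohom \<sigma>_cohom _ M(1) U(1) M(2)
      U(2) M(3) U(3), folded Q_def]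
  show "bialg Q" "\<pi> \<in> bihom Q R" "\<sigma> \<in> bihom Q S"
    by (rule J; rule P_joint; assumption)+
qed

end

section \<open>The connector as a bialgebra morphism\<close>

context commuting_schreier_bialgebras
begin

text \<open>\<open>val\<close>, \<open>val_S\<close> and \<open>val_R\<close> are \<open>p\<close>,
  \<open>pS\<close> and \<open>pR\<close> of the monoid locale as terms in \<open>T\<close>, so that
  results for different coalgebras can be combined; \<open>val_eq\<close> makes the
  translation.\<close>

definition val :: "('o, 'm) coalgebra \<Rightarrow> 'm \<Rightarrow> 'm \<Rightarrow> 'm" where
  "val T r q = conv T X (r1 \<cdot> (k \<cdot> (l \<cdot> (s \<cdot> r)))) (s1 \<cdot> q)"

definition val_S :: "('o, 'm) coalgebra \<Rightarrow> 'm \<Rightarrow> 'm \<Rightarrow> 'm" where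
  "val_S T r q = conv T S (k' \<cdot> (l' \<cdot> q)) (e' \<cdot> (r0 \<cdot> r))"

definition val_R :: "('o, 'm) coalgebra \<Rightarrow> 'm \<Rightarrow> 'm \<Rightarrow> 'm" where
  "val_R T r q = conv T R (k \<cdot> (l \<cdot> (s \<cdot> r))) (e \<cdot> (s1 \<cdot> q))"

context
  fixes T
  assumes T: "coc T"
begin

interpretation E: commuting_schreier_relations "cohom T (bi_coalg X)" "conv T X" "conv_unit T X"
    "cohom T (bi_coalg R)" "conv T R" "conv_unit T R" "cohom T (bi_coalg K)" "conv T K"
        "conv_unit T K"
    "\<lambda>f. r0 \<cdot> f" "\<lambda>f. r1 \<cdot> f" "\<lambda>f. e \<cdot> f" "\<lambda>f. k \<cdot> f" "\<lambda>f. l \<cdot> f" "\<lambda>f. s \<cdot> f"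
    "cohom T (bi_coalg S)" "conv T S" "conv_unit T S" "cohom T (bi_coalg L)" "conv T L"
        "conv_unit T L"
    "\<lambda>f. s0 \<cdot> f" "\<lambda>f. s1 \<cdot> f" "\<lambda>f. e' \<cdot> f" "\<lambda>f. k' \<cdot> f" "\<lambda>f. l' \<cdot> f" "\<lambda>f. s' \<cdot> f"
  by (rule elements[OF T])

lemma val_eq: "E.p r q = val T r q" "E.pS r q = val_S T r q" "E.pR r q = val_R T r q"
  by (simp_all add: E.p_def E.R.w_def val_def E.pS_def val_S_def E.pR_def val_R_def)

lemma val_closed:
  assumes "r \<in> cohom T (bi_coalg R)" "q \<in> cohom T (bi_coalg S)"
  shows "val T r q \<in> cohom T (bi_coalg X)" "val_S T r q \<in> cohom T (bi_coalg S)"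
      "val_R T r q \<in> cohom T (bi_coalg R)"
  using assms by (simp_all add: val_def val_S_def val_R_def)

lemmas val_mult = E.p_mult[unfolded val_eq]
lemmas val_unit = E.p_unit[unfolded val_eq]
lemmas val_left = E.p_left[unfolded val_eq]
lemmas val_right = E.p_right[unfolded val_eq]
lemmas val_assoc_right = E.p_assoc_right[unfolded val_eq]
lemmas val_assoc_left = E.p_assoc_left[unfolded val_eq]
lemmas val_S_legs = E.pS_legs[unfolded val_eq]
lemmas val_R_legs = E.pR_legs[unfolded val_eq]

end

text \<open>\<open>p\<close> at the generic triple. By \<open>connector_comp\<close>, composing with
  an element \<open>t\<close> evaluates it at the triple named by \<open>t\<close>.\<close>

definition connector :: 'm where "connector = val P \<pi> \<sigma>"

lemma connector_comp:
  assumes t: "t \<in> cohom T P"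
  shows "connector \<cdot> t = val T (\<pi> \<cdot> t) (\<sigma> \<cdot> t)"
proof -
  note c = cohom_comp[OF \<pi>_cohom R.eks_cohom(3)] cohom_comp[OF
      cohom_comp[OF \<pi>_cohom R.eks_cohom(3)] R.l]
    cohom_comp[OF cohom_comp[OF cohom_comp[OF \<pi>_cohom R.eks_cohom(3)] R.l] R.eks_cohom(2)]
    cohom_comp[OF cohom_comp[OF cohom_comp[OF cohom_comp[OF \<pi>_cohom R.eks_cohom(3)] R.l]
        R.eks_cohom(2)] R.legs_cohom(2)]
    cohom_comp[OF \<sigma>_cohom S.legs_cohom(2)]
  show ?thesis
    by (simp add: connector_def val_def conv_comp[OF R.bialgs(1) c(4) c(5) t]
        cohom_assoc[OF t c(3) R.legs_cohom(2)]
      cohom_assoc[OF t c(2) R.eks_cohom(2)] cohom_assoc[OF t c(1) R.l]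
          cohom_assoc[OF t \<pi>_cohom R.eks_cohom(3)]
      cohom_assoc[OF t \<sigma>_cohom S.legs_cohom(2)])
qed

lemma P_legs: "r1 \<cdot> \<pi> = s0 \<cdot> \<sigma>"
  using P_elements(3)[OF cohom_Ide[OF P_coc]] cohom_Ide_comp(2)[OF \<pi>_cohom] cohom_Ide_comp(2)[OF
      \<sigma>_cohom] by simp

text \<open>On elements this is \<open>val_mult\<close> and \<open>val_unit\<close>;
  \<open>P_elements\<close> supplies the matching condition of the former.\<close>

lemma connector_bihom: "connector \<in> bihom Q X"
proof (rule bihom_I)
  show "connector \<in> cohom (bi_coalg Q) (bi_coalg X)"
    unfolding connector_def using val_closed(1)[OF P_coc \<pi>_cohom \<sigma>_cohom] by simp
  fix T g h assume g: "g \<in> cohom T (bi_coalg Q)" and h: "h \<in> cohom T (bi_coalg Q)"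
  have g': "g \<in> cohom T P" and h': "h \<in> cohom T P" and gh: "conv T Q g h \<in> cohom T P"
    using g h conv_cohom[OF Q(1) g h] by simp_all
  note G = P_elements[OF g'] and G' = P_elements[OF h']
  show "connector \<cdot> conv T Q g h = conv T X (connector \<cdot> g) (connector \<cdot> h)"
    by (simp add: connector_comp[OF g'] connector_comp[OF h'] connector_comp[OF gh]
      bihom_conv[OF Q(2) g h] bihom_conv[OF Q(3) g h]
      val_mult[OF cohom_coc(1)[OF g] G(1) G'(1) G(2) G'(2) G(3)])
next
  fix T assume T: "coc T"
  have u: "conv_unit T Q \<in> cohom T P" using conv_unit_cohom[OF Q(1) T] by simp
  show "connector \<cdot> conv_unit T Q = conv_unit T X"
    by (simp add: connector_comp[OF u] bihom_conv_unit[OF Q(2) T] bihom_conv_unit[OF Q(3) T]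
        val_unit[OF T])
qed (simp_all add: Q)

text \<open>\<open>related\<close> asks for factorizations by bialgebra morphisms. The composites
  with the legs are bialgebra morphisms, the connector among them, and the jointly monic legs
  reflect this.\<close>

lemma val_S_bihom: "val_S P \<pi> \<sigma> \<in> bihom Q S"
  and val_R_bihom: "val_R P \<pi> \<sigma> \<in> bihom Q R"
proof -
  note SL = val_S_legs[OF P_coc \<pi>_cohom \<sigma>_cohom P_legs] and RL
      = val_R_legs[OF P_coc \<pi>_cohom \<sigma>_cohom]
  note closed = val_closed[OF P_coc \<pi>_cohom \<sigma>_cohom]
  show "val_S P \<pi> \<sigma> \<in> bihom Q S"
  proof (rule bihom_reflect[OF S.legs])
    show "s0 \<cdot> val_S P \<pi> \<sigma> \<in> bihom Q X" "s1 \<cdot> val_S P \<pi> \<sigma> \<in> bihom Q X"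
      unfolding SL using bihom_comp[OF Q(2) R.legs(1)] connector_bihom[unfolded connector_def]
          by simp_all
    show "val_S P \<pi> \<sigma> \<in> cohom (bi_coalg Q) (bi_coalg S)" using closed(2) by simp
  qed (rule S.jointly_monic)
  show "val_R P \<pi> \<sigma> \<in> bihom Q R"
  proof (rule bihom_reflect[OF R.legs])
    show "r0 \<cdot> val_R P \<pi> \<sigma> \<in> bihom Q X" "r1 \<cdot> val_R P \<pi> \<sigma> \<in> bihom Q X"
      unfolding RL using bihom_comp[OF Q(3) S.legs(2)] connector_bihom[unfolded connector_def]
          by simp_all
    show "val_R P \<pi> \<sigma> \<in> cohom (bi_coalg Q) (bi_coalg R)" using closed(3) by simp
  qed (rule R.jointly_monic)
qed

lemma lift_bihom:
  assumes r: "r \<in> bihom T R" and q: "q \<in> bihom T S" and rq: "r1 \<cdot> r = s0 \<cdot> q"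
  shows "lift (bi_coalg T) r q \<in> bihom T Q"
proof (rule bihom_reflect[OF Q(2,3)])
  note l = lift[OF bihom_cohom[OF r] bihom_cohom[OF q] rq]
  show "lift (bi_coalg T) r q \<in> cohom (bi_coalg T) (bi_coalg Q)"
    "\<pi> \<cdot> lift (bi_coalg T) r q \<in> bihom T R" "\<sigma> \<cdot> lift (bi_coalg T) r q \<in> bihom T S"
    using l r q by simp_all
qed (simp, rule P_joint, assumption)

section \<open>Pullback and connector in the category of bialgebras\<close>

abbreviation "Bi \<equiv> BiAlg_coc C"

lemma pullback: "is_pullback Bi (SArr R X r1) (SArr S X s0) (SArr Q R \<pi>) (SArr Q S \<sigma>)"
  unfolding is_pullback_def
proof (intro conjI allI ballI impI)
  fix T a b
  assume a: "a \<in> hom Bi T (Dom Bi (SArr R X r1))" and b: "b \<in> hom Bi T (Dom Bi (SArr S X s0))"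
    and ab: "SArr R X r1 \<cdot>\<^bsub>Bi\<^esub> a = SArr S X s0 \<cdot>\<^bsub>Bi\<^esub> b"
  have a': "und a \<in> bihom T R" "src a = T" "tgt a = R" and b': "und b \<in> bihom T S" "src b = T"
      "tgt b = S"
    and ab': "r1 \<cdot> und a = s0 \<cdot> und b"
    using a b ab by (simp_all add: BiAlg_simps)
  note l = lift[OF bihom_cohom[OF a'(1)] bihom_cohom[OF b'(1)] ab']
  show "\<exists>!t. t \<in> hom Bi T (Dom Bi (SArr Q R \<pi>)) \<and> SArr Q R \<pi> \<cdot>\<^bsub>Bi\<^esub> t = a \<and> SArr Q S \<sigma> \<cdot>\<^bsub>Bi\<^esub> t = b"
  proof (rule ex1I[of _ "SArr T Q (lift (bi_coalg T) (und a) (und b))"])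
    show "SArr T Q (lift (bi_coalg T) (und a) (und b)) \<in> hom Bi T (Dom Bi (SArr Q R \<pi>)) \<and>
      SArr Q R \<pi> \<cdot>\<^bsub>Bi\<^esub> SArr T Q (lift (bi_coalg T) (und a) (und b)) = a \<and>
      SArr Q S \<sigma> \<cdot>\<^bsub>Bi\<^esub> SArr T Q (lift (bi_coalg T) (und a) (und b)) = b"
      using lift_bihom[OF a'(1) b'(1) ab'] l a' b' by (auto simp: BiAlg_simps intro:
          struct_arr.expand)
    fix t assume t: "t \<in> hom Bi T (Dom Bi (SArr Q R \<pi>)) \<and> SArr Q R \<pi> \<cdot>\<^bsub>Bi\<^esub> t = a \<and> SArr Q S \<sigma>
        \<cdot>\<^bsub>Bi\<^esub> t = b"
    then have t': "und t \<in> bihom T Q" "src t = T" "tgt t = Q" "\<pi> \<cdot> und t = und a"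
        "\<sigma> \<cdot> und t = und b"
      by (auto simp: BiAlg_simps)
    have "und t = lift (bi_coalg T) (und a) (und b)"
      using bihom_cohom[OF t'(1)] l t' by - (rule P_joint, simp_all)
    then show "t = SArr T Q (lift (bi_coalg T) (und a) (und b))"
      using t' by (intro struct_arr.expand) simp
  qed
qed (simp_all add: BiAlg_simps Q R.legs S.legs P_legs)

abbreviation "triple \<equiv> is_triple Bi (SArr R X r0) (SArr R X r1) (SArr S X s0) (SArr S X s1)
  (SArr Q R \<pi>) (SArr Q S \<sigma>)"

lemma is_connector:
  "is_connector Bi (SArr R X r0) (SArr R X r1) (SArr S X s0) (SArr S X s1)
     (SArr Q R \<pi>) (SArr Q S \<sigma>) (SArr Q X connector)"
proof -
  \<comment> \<open>Every triple is read as an element of \<open>P\<close> whose components underlie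
    \<open>x\<close>, \<open>y\<close> and \<open>z\<close>. Each connector clause then becomes an
    identity for \<open>val\<close>.\<close>
  have tripD: "und t \<in> cohom (bi_coalg T) P \<and> und t \<in> bihom T Q \<and> src t = T \<and> x = SArr T X (r0
      \<cdot> (\<pi> \<cdot> und t)) \<and> y = SArr T X (r1 \<cdot> (\<pi> \<cdot> und t)) \<and>
     y = SArr T X (s0 \<cdot> (\<sigma> \<cdot> und t)) \<and> z = SArr T X (s1 \<cdot> (\<sigma> \<cdot> und t)) \<and>
     SArr Q X connector \<cdot>\<^bsub>Bi\<^esub> t = SArr T X (val (bi_coalg T) (\<pi> \<cdot> und t) (\<sigma> \<cdot> und t))"
    if "triple T t x y z"
    for T t x y z
  proof -
    have t: "und t \<in> bihom T Q" "src t = T"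
      using that by (simp_all add: is_triple_def BiAlg_simps)
    then have t': "und t \<in> cohom (bi_coalg T) P" using bihom_cohom[OF t(1)] by simp
    then show ?thesis using that t by (auto simp: is_triple_def BiAlg_simps connector_comp[OF t'])
  qed
  show ?thesis
    unfolding is_connector_def Let_def
  proof (intro conjI allI impI; (elim conjE)?)
    show "SArr Q X connector \<in> hom Bi (Dom Bi (SArr Q R \<pi>)) (Cod Bi (SArr R X r0))"
      by (simp add: BiAlg_simps connector_bihom)
  next
    fix T t x y z
    assume "triple T t x y z"
    note t = tripD[OF this]
    note p = P_elements[OF t[THEN conjunct1]]
    have tP: "und t \<in> cohom (bi_coalg T) P" and tB: "und t \<in> bihom T Q" using t by simp_all
    \<comment> \<open>The factorizations for a given triple arise from the generic ones by composing
      with \<open>t\<close>.\<close>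
    have S: "val_S P \<pi> \<sigma> \<cdot> und t \<in> bihom T S" and R: "val_R P \<pi> \<sigma> \<cdot> und t \<in> bihom T R"
      by (rule bihom_comp[OF tB val_S_bihom] bihom_comp[OF tB val_R_bihom])+
    note SL = val_S_legs[OF P_coc \<pi>_cohom \<sigma>_cohom P_legs] and RL
        = val_R_legs[OF P_coc \<pi>_cohom \<sigma>_cohom]
    note closed = val_closed[OF P_coc \<pi>_cohom \<sigma>_cohom]
    have S': "s0 \<cdot> (val_S P \<pi> \<sigma> \<cdot> und t) = r0 \<cdot> (\<pi> \<cdot> und t)"
        "s1 \<cdot> (val_S P \<pi> \<sigma> \<cdot> und t) = connector \<cdot> und t"
      using cohom_assoc[OF tP closed(2) S.legs_cohom(1)]
          cohom_assoc[OF tP closed(2) S.legs_cohom(2)]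
        cohom_assoc[OF tP \<pi>_cohom R.legs_cohom(1)] by (simp_all add: SL connector_def)
    have R': "r0 \<cdot> (val_R P \<pi> \<sigma> \<cdot> und t) = s1 \<cdot> (\<sigma> \<cdot> und t)"
        "r1 \<cdot> (val_R P \<pi> \<sigma> \<cdot> und t) = connector \<cdot> und t"
      using cohom_assoc[OF tP closed(3) R.legs_cohom(1)]
          cohom_assoc[OF tP closed(3) R.legs_cohom(2)]
        cohom_assoc[OF tP \<sigma>_cohom S.legs_cohom(2)] by (simp_all add: RL connector_def)
    show "related Bi (SArr S X s0) (SArr S X s1) x (SArr Q X connector \<cdot>\<^bsub>Bi\<^esub> t)"
      unfolding related_def using t S S'
      by (intro bexI[of _ "SArr T S (val_S P \<pi> \<sigma> \<cdot> und t)"]) (simp_all add: BiAlg_simps)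
    show "related Bi (SArr R X r0) (SArr R X r1) z (SArr Q X connector \<cdot>\<^bsub>Bi\<^esub> t)"
      unfolding related_def using t R R'
      by (intro bexI[of _ "SArr T R (val_R P \<pi> \<sigma> \<cdot> und t)"]) (simp_all add: BiAlg_simps)
  next
    fix T t x y
    assume "triple T t x x y"
    note t = tripD[OF this]
    note p = P_elements[OF t[THEN conjunct1]]
    show "SArr Q X connector \<cdot>\<^bsub>Bi\<^esub> t = y"
      using t val_left[OF cohom_coc(1)[OF p(1)] p(1,2)] by auto
  next
    fix T t x y
    assume "triple T t x y y"
    note t = tripD[OF this]
    note p = P_elements[OF t[THEN conjunct1]]
    show "SArr Q X connector \<cdot>\<^bsub>Bi\<^esub> t = x"
      using t val_right[OF cohom_coc(1)[OF p(1)] p(1,2,3)] by auto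
  next
    fix T t1 t2 t3 x y u v
    assume 1: "triple T t1 y u v"
      and 2: "triple T t2 x y (SArr Q X connector \<cdot>\<^bsub>Bi\<^esub> t1)"
      and 3: "triple T t3 x u v"
    note t = tripD[OF 1] tripD[OF 2] tripD[OF 3]
    note p = P_elements[OF t(1)[THEN conjunct1]] P_elements[OF t(2)[THEN conjunct1]] P_elements[OF
        t(3)[THEN conjunct1]]
    show "SArr Q X connector \<cdot>\<^bsub>Bi\<^esub> t2 = SArr Q X connector \<cdot>\<^bsub>Bi\<^esub> t3"
      using t val_assoc_right[OF cohom_coc(1)[OF p(1)] p(1,2,5,6,9,10)] by auto
  next
    fix T t1 t2 t3 x y u v
    assume 1: "triple T t1 x y u"
      and 2: "triple T t2 (SArr Q X connector \<cdot>\<^bsub>Bi\<^esub> t1) u v"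
      and 3: "triple T t3 x y v"
    note t = tripD[OF 1] tripD[OF 2] tripD[OF 3]
    note p = P_elements[OF t(1)[THEN conjunct1]] P_elements[OF t(2)[THEN conjunct1]] P_elements[OF
        t(3)[THEN conjunct1]]
    show "SArr Q X connector \<cdot>\<^bsub>Bi\<^esub> t2 = SArr Q X connector \<cdot>\<^bsub>Bi\<^esub> t3"
      using t val_assoc_left[OF cohom_coc(1)[OF p(1)] p(1,2,5,6,9,10)] by auto
  qed
qed

lemma smith_centralize:
  "smith_centralize Bi (SArr R X r0) (SArr R X r1) (SArr S X s0) (SArr S X s1)"
  unfolding smith_centralize_def using pullback is_connector by blast

end

section \<open>Smith and Huq centrality\<close>

context symmetric_monoidal_category
begin

lemma zero_mor_conv_unit: "zero_mor C A B = SArr A B (conv_unit (bi_coalg A) B)"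
  by (simp add: zero_mor_def conv_unit_def)

text \<open>Conditions (3) and (4) of a split extension are these identities at generic elements: at
  the identity of \<open>R\<close> and at the two projections of \<open>K \<otimes> X\<close>.
  Composing with \<open>r\<close> and with \<open>pair T a x\<close> gives the general case.\<close>

lemma split_extension_elements:
  assumes "split_extension C K R X \<kappa> \<alpha> e l"
  shows "r \<in> cohom T (bi_coalg R) \<Longrightarrow> conv T R (und \<kappa> \<cdot> (l \<cdot> r)) (und e \<cdot> (und \<alpha> \<cdot> r)) = r"
    and "a \<in> cohom T (bi_coalg K) \<Longrightarrow> x \<in> cohom T (bi_coalg X) \<Longrightarrow>
      l \<cdot> conv T R (und \<kappa> \<cdot> a) (und e \<cdot> x) = a"
    and "l \<in> cohom (bi_coalg R) (bi_coalg K)"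
proof -
  have k: "und \<kappa> \<in> bihom K R" and al: "und \<alpha> \<in> bihom R X" and e: "und e \<in> bihom X R"
    and lco: "coalg_morphism C (bi_coalg R) (bi_coalg K) l"
    and decomp: "mult R \<cdot> ((und \<kappa> \<cdot> l) \<otimes> (und e \<cdot> und \<alpha>)) \<cdot> comult R = \<one> (ob R)"
    and retr: "l \<cdot> mult R \<cdot> (und \<kappa> \<otimes> und e) = runit C (ob K) \<cdot> (\<one> (ob K) \<otimes> counit X)"
    using assms by (simp_all add: split_extension_def BiAlg_simps)
  have [simp]: "bialg K" "bialg R" "bialg X" using bihom_bialg[OF k] bihom_bialg[OF al] by simp_all
  show l: "l \<in> cohom (bi_coalg R) (bi_coalg K)" using lco by (simp add: cohom_def)
  note k' = bihom_cohom[OF k] and al' = bihom_cohom[OF al] and e' = bihom_cohom[OF e]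
  note kl = cohom_comp[OF l k'] and ea = cohom_comp[OF al' e']
  {
    assume r: "r \<in> cohom T (bi_coalg R)"
    have "r = conv (bi_coalg R) R (und \<kappa> \<cdot> l) (und e \<cdot> und \<alpha>) \<cdot> r"
      using decomp cohom_Ide_comp(1)[OF r] by (simp add: conv_def pair_def)
    then show "conv T R (und \<kappa> \<cdot> (l \<cdot> r)) (und e \<cdot> (und \<alpha> \<cdot> r)) = r"
      by (simp add: conv_comp[OF _ kl ea r] cohom_assoc[OF r l k'] cohom_assoc[OF r al' e'])
  next
    assume a: "a \<in> cohom T (bi_coalg K)" and x: "x \<in> cohom T (bi_coalg X)"
    note [simp] = cohom_typing[OF k'] cohom_typing[OF e'] cohom_typing[OF l] cohom_typing[OF
        pair_cohom[OF a x]]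
      cohom_typing[OF mult_cohom[OF bihom_bialg(2)[OF k]]]
    have "l \<cdot> conv T R (und \<kappa> \<cdot> a) (und e \<cdot> x) = l \<cdot> (mult R \<cdot> ((und \<kappa> \<otimes> und e) \<cdot> pair T a x))"
      by (simp add: conv_def tens_pair[OF a x])
    also have "\<dots> = (l \<cdot> mult R \<cdot> (und \<kappa> \<otimes> und e)) \<cdot> pair T a x"
      by simp
    also have "\<dots> = proj1 (bi_coalg K) (bi_coalg X) \<cdot> pair T a x"
      unfolding retr by (simp add: proj1_def)
    also have "\<dots> = a" by (rule proj1_pair[OF a x])
    finally show "l \<cdot> conv T R (und \<kappa> \<cdot> a) (und e \<cdot> x) = a" .
  }
qed

lemma kernel_factor:
  assumes kernel: "is_kernel C r0 n" and k: "k \<in> bihom K (src r0)"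
    and zero: "und r0 \<cdot> k = conv_unit (bi_coalg K) (tgt r0)"
  obtains h where "h \<in> bihom K (src n)" "k = und n \<cdot> h"
proof -
  have r0: "und r0 \<in> bihom (src r0) (tgt r0)"
    using kernel by (simp add: is_kernel_def is_equalizer_def BiAlg_simps)
  have "\<exists>!h. h \<in> hom (BiAlg_coc C) K (Dom (BiAlg_coc C) n) \<and> n \<cdot>\<^bsub>BiAlg_coc C\<^esub> h = SArr K (src r0) k"
  proof -
    have "SArr K (src r0) k \<in> hom (BiAlg_coc C) K (Dom (BiAlg_coc C) r0)"
      using k by (simp add: BiAlg_simps)
    moreover have "r0 \<cdot>\<^bsub>BiAlg_coc C\<^esub> SArr K (src r0) k = zero_mor C (src r0) (tgt r0)
        \<cdot>\<^bsub>BiAlg_coc C\<^esub> SArr K (src r0) k"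
      using conv_unit_comp[OF bihom_bialg(2)[OF r0] bihom_cohom[OF k]] zero
      by (simp add: BiAlg_simps zero_mor_conv_unit)
    ultimately show ?thesis
      using kernel unfolding is_kernel_def is_equalizer_def by blast
  qed
  then show ?thesis
    using that by (auto simp: BiAlg_simps)
qed

lemma equivalence_relation_symmetry:
  assumes "is_equivalence_relation (BiAlg_coc C) X r0 r1"
  obtains s where "s \<in> bihom (src r0) (src r0)" "und r0 \<cdot> s = und r1" "und r1 \<cdot> s = und r0"
proof -
  obtain \<tau> where \<tau>: "\<tau> \<in> hom (BiAlg_coc C) (Dom (BiAlg_coc C) r0) (Dom (BiAlg_coc C) r0)"
    and eqs: "r0 \<cdot>\<^bsub>BiAlg_coc C\<^esub> \<tau> = r1" "r1 \<cdot>\<^bsub>BiAlg_coc C\<^esub> \<tau> = r0"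
    using assms unfolding is_equivalence_relation_def by blast
  have "und r0 \<cdot> und \<tau> = und r1" "und r1 \<cdot> und \<tau> = und r0"
    using arg_cong[OF eqs(1), of und] arg_cong[OF eqs(2), of und] by (simp_all add: BiAlg_simps)
  then show ?thesis using \<tau> that[of "und \<tau>"] by (simp add: BiAlg_simps)
qed

text \<open>The \<open>\<kappa>\<close> belonging to the splitting may differ from the chosen kernel
  \<open>n\<close>. The comparison \<open>h\<close> is recorded so that commutation of the chosen
  normalization can be passed on to \<open>\<kappa>\<close>.\<close>

lemma S_coc_equivalence_relation_schreier:
  assumes forget: "forget_preserves_monos C" and eq: "S_coc_equivalence_relation C X r0 r1"
    and kernel: "is_kernel C r0 n"
  obtains K k h e l s where "schreier_bialgebras C X (src r0) K (und r0) (und r1) e k l s"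
    "h \<in> bihom K (src n)" "k = und n \<cdot> h"
proof -
  obtain e K \<kappa> l where refl: "reflexivity (BiAlg_coc C) X r0 r1 e"
    and split: "split_extension C K (src r0) (tgt r0) \<kappa> r0 e l"
    using eq by (auto simp: S_coc_equivalence_relation_def in_S_coc_def)
  have rel: "is_relation (BiAlg_coc C) X r0 r1"
    using eq by (simp add: S_coc_equivalence_relation_def is_equivalence_relation_def)
  then have r0: "und r0 \<in> bihom (src r0) X" and r1: "und r1 \<in> bihom (src r0) X" and X: "tgt r0 = X"
    by (simp_all add: is_relation_def BiAlg_simps)
  obtain s where s: "s \<in> bihom (src r0) (src r0)" "und r0 \<cdot> s = und r1" "und r1 \<cdot> s = und r0"
    using eq equivalence_relation_symmetry unfolding S_coc_equivalence_relation_def by blast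
  have e: "und e \<in> bihom X (src r0)" "und r0 \<cdot> und e = \<one> (ob X)" "und r1 \<cdot> und e = \<one> (ob X)"
    using refl by (auto simp: reflexivity_def BiAlg_simps)
  have k: "und \<kappa> \<in> bihom K (src r0)" "und r0 \<cdot> und \<kappa> = conv_unit (bi_coalg K) X"
    using split X by (simp_all add: split_extension_def BiAlg_simps conv_unit_def)
  obtain h where h: "h \<in> bihom K (src n)" "und \<kappa> = und n \<cdot> h"
    using kernel_factor[OF kernel k(1)] k(2) X by auto
  note el = split_extension_elements[OF split, unfolded X]
  have "schreier_bialgebras C X (src r0) K (und r0) (und r1) (und e) (und \<kappa>) l s"
  proof unfold_locales
    fix h h' T assume "h \<in> cohom T (bi_coalg (src r0))" "h' \<in> cohom T (bi_coalg (src r0))"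
      "und r0 \<cdot> h = und r0 \<cdot> h'" "und r1 \<cdot> h = und r1 \<cdot> h'"
    then show "h = h'" by (rule relation_jointly_monic[OF forget rel])
  qed (use r0 r1 s e k el in auto)
  then show ?thesis using that h by blast
qed

text \<open>\<open>x \<cdot> a\<close> and \<open>y \<cdot> b\<close> are the images under
  \<open>p\<close> of \<open>(a, 1)\<close> and \<open>(1, b)\<close>, which commute in the product
  of \<open>K\<close> and \<open>L\<close>, as is checked by components.\<close>

lemma huq_elements:
  assumes x: "x \<in> bihom K X" and y: "y \<in> bihom L X" and p: "p \<in> bihom (tensor_bialg C K L) X"
    and px: "p \<cdot> (\<one> (ob K) \<otimes> unt L) \<cdot> rinv (ob K) = x"
    and py: "p \<cdot> (unt K \<otimes> \<one> (ob L)) \<cdot> linv (ob L) = y"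
    and a: "a \<in> cohom T (bi_coalg K)" and b: "b \<in> cohom T (bi_coalg L)"
  shows "conv T X (x \<cdot> a) (y \<cdot> b) = conv T X (y \<cdot> b) (x \<cdot> a)"
proof -
  note T = cohom_coc(1)[OF a]
  have K [simp]: "bialg K" and L [simp]: "bialg L" using bihom_bialg[OF x] bihom_bialg[OF y]
      by simp_all
  note [simp] = cohom_typing[OF bihom_cohom[OF p]] cohom_typing[OF a]
      cohom_typing[OF b] T cohom_coc(2)[OF a] cohom_coc(2)[OF b]
    cohom_typing[OF unt_cohom[OF K]] cohom_typing[OF unt_cohom[OF L]]
  let ?i = "pair T a (conv_unit T L)" and ?j = "pair T (conv_unit T K) b"
  have i: "?i \<in> cohom T (bi_coalg K \<otimes>\<^sub>c bi_coalg L)" and j: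
      "?j \<in> cohom T (bi_coalg K \<otimes>\<^sub>c bi_coalg L)"
    using pair_cohom[OF a conv_unit_cohom[OF L T]] pair_cohom[OF conv_unit_cohom[OF K T] b]
        by simp_all
  have "x \<cdot> a = p \<cdot> (pair (bi_coalg K) (\<one> (ob K)) (conv_unit (bi_coalg K) L) \<cdot> a)"
    unfolding px[symmetric] by (simp add: counit_rinv[symmetric] pair_def conv_unit_def tens_merge)
  also have "\<dots> = p \<cdot> ?i"
    using cohom_typing[OF conv_unit_cohom[OF L bialg_coc[OF K]]]
    by (simp add: pair_comp[OF _ _ _ _ a] conv_unit_comp[OF L a])
  finally have xa: "x \<cdot> a = p \<cdot> ?i" .
  have "y \<cdot> b = p \<cdot> (pair (bi_coalg L) (conv_unit (bi_coalg L) K) (\<one> (ob L)) \<cdot> b)"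
    unfolding py[symmetric] by (simp add: counit_linv[symmetric] pair_def conv_unit_def tens_merge)
  also have "\<dots> = p \<cdot> ?j"
    using cohom_typing[OF conv_unit_cohom[OF K bialg_coc[OF L]]]
    by (simp add: pair_comp[OF _ _ _ _ b] conv_unit_comp[OF K b])
  finally have yb: "y \<cdot> b = p \<cdot> ?j" .
  have KL: "bialg (tensor_bialg C K L)" by (simp add: tensor_bialg)
  have i': "?i \<in> cohom T (bi_coalg (tensor_bialg C K L))" and j':
      "?j \<in> cohom T (bi_coalg (tensor_bialg C K L))"
    using i j by simp_all
  have "conv T (tensor_bialg C K L) ?i ?j = conv T (tensor_bialg C K L) ?j ?i"
  proof (rule pair_ext[where A = "bi_coalg K" and B = "bi_coalg L"])
    show "proj1 (bi_coalg K) (bi_coalg L) \<cdot> conv T (tensor_bialg C K L) ?i ?j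
        = proj1 (bi_coalg K) (bi_coalg L) \<cdot> conv T (tensor_bialg C K L) ?j ?i"
      by (simp add: bihom_conv[OF tensor_bialg(2) i' j'] bihom_conv[OF tensor_bialg(2) j' i']
          proj1_pair[OF a conv_unit_cohom[OF L T]] proj1_pair[OF conv_unit_cohom[OF K T] b]
          conv_unit_left[OF K a] conv_unit_right[OF K a])
    show "proj2 (bi_coalg K) (bi_coalg L) \<cdot> conv T (tensor_bialg C K L) ?i ?j
        = proj2 (bi_coalg K) (bi_coalg L) \<cdot> conv T (tensor_bialg C K L) ?j ?i"
      by (simp add: bihom_conv[OF tensor_bialg(3) i' j'] bihom_conv[OF tensor_bialg(3) j' i']
          proj2_pair[OF a conv_unit_cohom[OF L T]] proj2_pair[OF conv_unit_cohom[OF K T] b]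
          conv_unit_left[OF L b] conv_unit_right[OF L b])
  qed (use conv_cohom[OF KL i' j'] conv_cohom[OF KL j' i'] in simp_all)
  then show ?thesis
    using bihom_conv[OF p i' j'] bihom_conv[OF p j' i'] by (simp add: xa yb)
qed

lemma smith_imp_huq:
  assumes R: "is_equivalence_relation (BiAlg_coc C) X r0 r1"
    and S: "is_equivalence_relation (BiAlg_coc C) X s0 s1"
    and kR: "is_kernel C r0 m" and kS: "is_kernel C s0 n"
    and smith: "smith_centralize (BiAlg_coc C) r0 r1 s0 s1"
  shows "huq_commute C (r1 \<cdot>\<^bsub>BiAlg_coc C\<^esub> m) (s1 \<cdot>\<^bsub>BiAlg_coc C\<^esub> n)"
proof -
  let ?Bi = "BiAlg_coc C"
  define K L where "K = src m" and "L = src n"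
  have m: "und m \<in> bihom K (src r0)" "tgt m = src r0"
      "und r0 \<cdot> und m = conv_unit (bi_coalg (src r0)) (tgt r0) \<cdot> und m"
    and n: "und n \<in> bihom L (src s0)" "tgt n = src s0"
        "und s0 \<cdot> und n = conv_unit (bi_coalg (src s0)) (tgt s0) \<cdot> und n"
    using kR kS by (auto simp: is_kernel_def is_equalizer_def BiAlg_simps zero_mor_conv_unit K_def
        L_def)
  have r: "und r0 \<in> bihom (src r0) X" "und r1 \<in> bihom (src r0) X" "tgt r0 = X" "tgt r1 = X"
      "src r1 = src r0"
    and s: "und s0 \<in> bihom (src s0) X" "und s1 \<in> bihom (src s0) X" "tgt s0 = X" "tgt s1 = X"
        "src s1 = src s0"
    using R S by (auto simp: is_equivalence_relation_def is_relation_def BiAlg_simps)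
  obtain \<tau> where \<tau>: "\<tau> \<in> bihom (src r0) (src r0)" "und r0 \<cdot> \<tau> = und r1" "und r1 \<cdot> \<tau> = und r0"
    using equivalence_relation_symmetry[OF R] .
  obtain pR pS p where pb: "is_pullback ?Bi r1 s0 pR pS" and con:
      "is_connector ?Bi r0 r1 s0 s1 pR pS p"
    using smith by (auto simp: smith_centralize_def)
  have bialgs [simp]: "bialg K" "bialg L" "bialg X"
    using bihom_bialg[OF m(1)] bihom_bialg[OF n(1)] bihom_bialg[OF r(1)] by simp_all
  let ?T = "tensor_bialg C K L" and ?k = "bi_coalg K" and ?l = "bi_coalg L"
  let ?q1 = "proj1 ?k ?l" and ?q2 = "proj2 ?k ?l"
  have q: "?q1 \<in> bihom ?T K" "?q2 \<in> bihom ?T L" by (simp_all add: tensor_bialg)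
  note [simp] = cohom_typing[OF bihom_cohom[OF m(1)]] cohom_typing[OF bihom_cohom[OF n(1)]]
      cohom_typing[OF bihom_cohom[OF r(1)]]
    cohom_typing[OF bihom_cohom[OF r(2)]] cohom_typing[OF bihom_cohom[OF s(1)]] cohom_typing[OF
        bihom_cohom[OF s(2)]] cohom_typing[OF bihom_cohom[OF \<tau>(1)]]
  have zero: "und r0 \<cdot> und m = conv_unit ?k X" "und s0 \<cdot> und n = conv_unit ?l X"
    using m(3) n(3) conv_unit_comp[OF bialgs(3) bihom_cohom[OF m(1)]] conv_unit_comp[OF bialgs(3)
        bihom_cohom[OF n(1)]]
    by (simp_all add: r s)
  \<comment> \<open>The kernel of \<open>r0\<close> yields pairs \<open>(1, a)\<close>. The symmetry
    \<open>\<tau>\<close> turns them into \<open>(a, 1)\<close>, which match the pairs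
    \<open>(1, b)\<close> from the kernel of \<open>s0\<close>.\<close>
  define a where "a = \<tau> \<cdot> (und m \<cdot> ?q1)"
  define b where "b = und n \<cdot> ?q2"
  have a: "a \<in> bihom ?T (src r0)" and b: "b \<in> bihom ?T (src s0)"
    unfolding a_def b_def by (rule bihom_comp[OF bihom_comp[OF q(1) m(1)] \<tau>(1)]
        bihom_comp[OF q(2) n(1)])+
  have r0a: "und r0 \<cdot> (a \<cdot> f) = und r1 \<cdot> (und m \<cdot> (?q1 \<cdot> f))"
    and r1a: "und r1 \<cdot> (a \<cdot> f) = conv_unit A X"
    and s0b: "und s0 \<cdot> (b \<cdot> f) = conv_unit A X"
    and s1b: "und s1 \<cdot> (b \<cdot> f) = und s1 \<cdot> (und n \<cdot> (?q2 \<cdot> f))"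
    if f: "f \<in> cohom A (?k \<otimes>\<^sub>c ?l)" for f A
  proof -
    have [simp]: "f \<in> Arr C" "Dom C f = coalg_ob A" "Cod C f = coalg_ob ?k \<odot> coalg_ob ?l"
      using cohom_typing[OF f] by simp_all
    have "?q1 \<cdot> f \<in> cohom A ?k" "?q2 \<cdot> f \<in> cohom A ?l"
      by (rule cohom_comp[OF f], simp)+
    then show "und r0 \<cdot> (a \<cdot> f) = und r1 \<cdot> (und m \<cdot> (?q1 \<cdot> f))" "und r1 \<cdot> (a \<cdot> f) = conv_unit A X"
      "und s0 \<cdot> (b \<cdot> f) = conv_unit A X" "und s1 \<cdot> (b \<cdot> f) = und s1 \<cdot> (und n \<cdot> (?q2 \<cdot> f))"
      by (simp_all add: a_def b_def Comp_eq_extend[OF \<tau>(2)] Comp_eq_extend[OF \<tau>(3)]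
          Comp_eq_extend[OF zero(1)] Comp_eq_extend[OF zero(2)] conv_unit_comp)
  qed
  have id: "\<one> (coalg_ob (?k \<otimes>\<^sub>c ?l)) \<in> cohom (?k \<otimes>\<^sub>c ?l) (?k \<otimes>\<^sub>c ?l)" by (rule cohom_Ide) simp
  have "und r1 \<cdot> a = und s0 \<cdot> b"
    using r1a[OF id] s0b[OF id] cohom_Ide_comp(2)[OF bihom_cohom[OF a]] cohom_Ide_comp(2)[OF
        bihom_cohom[OF b]]
    by (simp only: bi_coalg_tensor)
  then have "r1 \<cdot>\<^bsub>?Bi\<^esub> SArr ?T (src r0) a = s0 \<cdot>\<^bsub>?Bi\<^esub> SArr ?T (src s0) b"
    by (simp add: BiAlg_simps r s)
  moreover have "SArr ?T (src r0) a \<in> hom ?Bi ?T (Dom ?Bi r1)"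
      "SArr ?T (src s0) b \<in> hom ?Bi ?T (Dom ?Bi s0)"
    using a b by (simp_all add: BiAlg_simps r)
  ultimately obtain t where t: "t \<in> hom ?Bi ?T (Dom ?Bi pR)"
    and pRt: "pR \<cdot>\<^bsub>?Bi\<^esub> t = SArr ?T (src r0) a" and pSt: "pS \<cdot>\<^bsub>?Bi\<^esub> t = SArr ?T (src s0) b"
    using pb unfolding is_pullback_def by blast
  have pR: "und pR \<in> bihom (src pR) (src r0)" and pS: "und pS \<in> bihom (src pR) (src s0)"
    and tgts: "tgt pR = src r0" "tgt pS = src s0" "src pS = src pR"
  proof -
    have "pR \<in> Arr ?Bi \<and> pS \<in> Arr ?Bi \<and> Dom ?Bi pR = Dom ?Bi pS \<and> Cod ?Bi pR = Dom ?Bi r1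
        \<and> Cod ?Bi pS = Dom ?Bi s0"
      using pb unfolding is_pullback_def by blast
    then show "und pR \<in> bihom (src pR) (src r0)" "und pS \<in> bihom (src pR) (src s0)"
      "tgt pR = src r0" "tgt pS = src s0" "src pS = src pR"
      by (auto simp: BiAlg_simps r)
  qed
  have t': "und t \<in> bihom ?T (src pR)" "src t = ?T" "tgt t = src pR"
    using t by (simp_all add: BiAlg_simps)
  have p: "und p \<in> bihom (src pR) X" "src p = src pR" "tgt p = X"
  proof -
    have "p \<in> hom ?Bi (Dom ?Bi pR) (Cod ?Bi r0)"
      using con unfolding is_connector_def Let_def by blast
    then show "und p \<in> bihom (src pR) X" "src p = src pR" "tgt p = X"
      by (simp_all add: BiAlg_simps r)
  qed
  note con' = con[unfolded is_connector_def Let_def, THEN conjunct2, THEN conjunct2]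
  note p_left = con'[THEN conjunct1, rule_format] and p_right
      = con'[THEN conjunct2, THEN conjunct1, rule_format]
  \<comment> \<open>\<open>t\<close> is the generic triple \<open>(a, 1, b)\<close>; composing with
    \<open>f\<close> evaluates it.\<close>
  have trip: "is_triple ?Bi r0 r1 s0 s1 pR pS A (t \<cdot>\<^bsub>?Bi\<^esub> SArr A ?T f)
     (SArr A X (und r1 \<cdot> (und m \<cdot> (?q1 \<cdot> f)))) (SArr A X (conv_unit (bi_coalg A) X)) (SArr A X
         (und s1 \<cdot> (und n \<cdot> (?q2 \<cdot> f))))"
    if f: "f \<in> bihom A ?T" for A f
  proof -
    have f': "f \<in> cohom (bi_coalg A) (?k \<otimes>\<^sub>c ?l)" using bihom_cohom[OF f] by simp
    have "und pR \<cdot> (und t \<cdot> f) = a \<cdot> f" "und pS \<cdot> (und t \<cdot> f) = b \<cdot> f"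
      using pRt pSt cohom_assoc[OF bihom_cohom[OF f] bihom_cohom[OF t'(1)] bihom_cohom[OF pR]]
          cohom_assoc[OF bihom_cohom[OF f] bihom_cohom[OF t'(1)] bihom_cohom[OF pS]]
      by (simp_all add: BiAlg_simps)
    then show ?thesis
      using bihom_comp[OF f t'(1)] by (simp add: is_triple_def BiAlg_simps t' r s r0a[OF f']
          r1a[OF f'] s0b[OF f'] s1b[OF f'])
  qed
  have assoc_p: "(und p \<cdot> und t) \<cdot> f = und p \<cdot> (und t \<cdot> f)" if "f \<in> bihom A ?T" for A f
    by (rule cohom_assoc[OF bihom_cohom[OF that] bihom_cohom[OF t'(1)] bihom_cohom[OF p(1)]])
  \<comment> \<open>The two inclusions restrict the generic triple to \<open>(a, 1, 1)\<close> and
    \<open>(1, 1, b)\<close>. The unit laws of the connector send these to \<open>a\<close> and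
    \<open>b\<close>, which are the two equations of Huq centrality.\<close>
  let ?i = "pair ?k (\<one> (coalg_ob ?k)) (conv_unit ?k L)" and ?j =
      "pair ?l (conv_unit ?l K) (\<one> (coalg_ob ?l))"
  have i: "?i \<in> bihom K ?T" and j: "?j \<in> bihom L ?T"
    by (rule pair_bihom bihom_Ide bihom_zero bialgs)+
  have qi: "?q1 \<cdot> ?i = \<one> (coalg_ob ?k)" "?q2 \<cdot> ?i = conv_unit ?k L"
    by (simp_all add: proj1_pair[OF cohom_Ide conv_unit_cohom] proj2_pair[OF cohom_Ide
        conv_unit_cohom])
  have qj: "?q1 \<cdot> ?j = conv_unit ?l K" "?q2 \<cdot> ?j = \<one> (coalg_ob ?l)"
    by (simp_all add: proj1_pair[OF conv_unit_cohom cohom_Ide] proj2_pair[OF conv_unit_cohom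
        cohom_Ide])
  have zeros: "und s1 \<cdot> (und n \<cdot> conv_unit ?k L) = conv_unit ?k X"
      "und r1 \<cdot> (und m \<cdot> conv_unit ?l K) = conv_unit ?l X"
    by (simp_all add: bihom_conv_unit[OF n(1)] bihom_conv_unit[OF m(1)] bihom_conv_unit[OF s(2)]
        bihom_conv_unit[OF r(2)])
  have "p \<cdot>\<^bsub>?Bi\<^esub> (t \<cdot>\<^bsub>?Bi\<^esub> SArr K ?T ?i) = SArr K X (und r1 \<cdot> und m)"
    using p_right[OF trip[OF i, unfolded qi zeros]] by (simp add: cohom_Ide_comp(2)[OF
        bihom_cohom[OF m(1)]])
  then have 1: "und p \<cdot> (und t \<cdot> ?i) = und r1 \<cdot> und m" by (simp add: BiAlg_simps)
  have "p \<cdot>\<^bsub>?Bi\<^esub> (t \<cdot>\<^bsub>?Bi\<^esub> SArr L ?T ?j) = SArr L X (und s1 \<cdot> und n)"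
    using p_left[OF trip[OF j, unfolded qj zeros]] by (simp add: cohom_Ide_comp(2)[OF
        bihom_cohom[OF n(1)]])
  then have 2: "und p \<cdot> (und t \<cdot> ?j) = und s1 \<cdot> und n" by (simp add: BiAlg_simps)
  have ij: "?i = (\<one> (ob K) \<otimes> unt L) \<cdot> rinv (ob K)" "?j = (unt K \<otimes> \<one> (ob L)) \<cdot> linv (ob L)"
    using cohom_typing[OF unt_cohom[OF bialgs(1)]] cohom_typing[OF unt_cohom[OF bialgs(2)]]
    by (simp_all add: counit_rinv[symmetric] counit_linv[symmetric] pair_def conv_unit_def
        tens_merge)
  show ?thesis
    unfolding huq_commute_def Let_def
  proof (intro bexI[of _ "SArr ?T X (und p \<cdot> und t)"] conjI)
    show "und (SArr ?T X (und p \<cdot> und t)) \<cdot> (\<one> (ob (src (r1 \<cdot>\<^bsub>?Bi\<^esub> m))) \<otimes> unt (src (s1 \<cdot>\<^bsub>?Bi\<^esub> n)))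
        \<cdot> rinv (ob (src (r1 \<cdot>\<^bsub>?Bi\<^esub> m)))
       = und (r1 \<cdot>\<^bsub>?Bi\<^esub> m)"
      using assoc_p[OF i] 1 unfolding ij by (simp add: BiAlg_simps K_def L_def)
    show "und (SArr ?T X (und p \<cdot> und t)) \<cdot> (unt (src (r1 \<cdot>\<^bsub>?Bi\<^esub> m)) \<otimes> \<one> (ob (src (s1 \<cdot>\<^bsub>?Bi\<^esub> n))))
        \<cdot> linv (ob (src (s1 \<cdot>\<^bsub>?Bi\<^esub> n)))
       = und (s1 \<cdot>\<^bsub>?Bi\<^esub> n)"
      using assoc_p[OF j] 2 unfolding ij by (simp add: BiAlg_simps K_def L_def)
    show "SArr ?T X (und p \<cdot> und t) \<in> hom ?Bi (tensor_bialg C (src (r1 \<cdot>\<^bsub>?Bi\<^esub> m)) (src (s1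
        \<cdot>\<^bsub>?Bi\<^esub> n))) (tgt (r1 \<cdot>\<^bsub>?Bi\<^esub> m))"
      using bihom_comp[OF t'(1) p(1)] by (simp add: BiAlg_simps K_def L_def r)
  qed
qed

lemma huq_imp_smith:
  assumes forget: "forget_preserves_monos C"
    and R: "S_coc_equivalence_relation C X r0 r1" and S: "S_coc_equivalence_relation C X s0 s1"
    and kR: "is_kernel C r0 m" and kS: "is_kernel C s0 n"
    and huq: "huq_commute C (r1 \<cdot>\<^bsub>BiAlg_coc C\<^esub> m) (s1 \<cdot>\<^bsub>BiAlg_coc C\<^esub> n)"
  shows "smith_centralize (BiAlg_coc C) r0 r1 s0 s1"
proof -
  have r: "und r1 \<in> bihom (src r0) X" "tgt r0 = X" "tgt r1 = X" "src r1 = src r0"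
    and s: "und s1 \<in> bihom (src s0) X" "tgt s0 = X" "tgt s1 = X" "src s1 = src s0"
    using R S by (auto simp: S_coc_equivalence_relation_def is_equivalence_relation_def
        is_relation_def BiAlg_simps)
  have m: "und m \<in> bihom (src m) (src r0)" and n: "und n \<in> bihom (src n) (src s0)"
    using kR kS by (auto simp: is_kernel_def is_equalizer_def BiAlg_simps)
  obtain K k h e l \<tau> where R': "schreier_bialgebras C X (src r0) K (und r0) (und r1) e k l \<tau>"
    and h: "h \<in> bihom K (src m)" "k = und m \<cdot> h"
    using S_coc_equivalence_relation_schreier[OF forget R kR] by metis
  obtain L k' h' e' l' \<tau>' where S': "schreier_bialgebras C X (src s0) L (und s0) (und s1) e' k' l'
      \<tau>'"
    and h': "h' \<in> bihom L (src n)" "k' = und n \<cdot> h'"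
    using S_coc_equivalence_relation_schreier[OF forget S kS] by metis
  obtain p where "p \<in> hom (BiAlg_coc C) (tensor_bialg C (src m) (src n)) X"
    and px: "und p \<cdot> (\<one> (ob (src m)) \<otimes> unt (src n)) \<cdot> rinv (ob (src m)) = und r1 \<cdot> und m"
    and py: "und p \<cdot> (unt (src m) \<otimes> \<one> (ob (src n))) \<cdot> linv (ob (src n)) = und s1 \<cdot> und n"
    using huq unfolding huq_commute_def Let_def by (simp add: BiAlg_simps(5) r) blast
  then have p: "und p \<in> bihom (tensor_bialg C (src m) (src n)) X" by (simp add: BiAlg_simps)
  interpret commuting_schreier_bialgebras C X "src r0" K "und r0" "und r1" e k l \<tau>
    "src s0" L "und s0" "und s1" e' k' l' \<tau>'
  proof (intro commuting_schreier_bialgebras.intro R' S' commuting_schreier_bialgebras_axioms.intro)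
    show "symmetric_monoidal_category C" ..
    fix T a b assume a: "a \<in> cohom T (bi_coalg K)" and b: "b \<in> cohom T (bi_coalg L)"
    \<comment> \<open>Along \<open>h\<close> and \<open>h'\<close>, elements of the kernels of the
      splittings become elements of the chosen kernels, to which \<open>huq_elements\<close>
      applies.\<close>
    have "und r1 \<cdot> (k \<cdot> a) = (und r1 \<cdot> und m) \<cdot> (h \<cdot> a)"
        "und s1 \<cdot> (k' \<cdot> b) = (und s1 \<cdot> und n) \<cdot> (h' \<cdot> b)"
      using cohom_typing[OF bihom_cohom[OF m]] cohom_typing[OF bihom_cohom[OF n]] cohom_typing[OF
          bihom_cohom[OF h(1)]] cohom_typing[OF bihom_cohom[OF h'(1)]]
        cohom_typing[OF bihom_cohom[OF r(1)]] cohom_typing[OF bihom_cohom[OF s(1)]]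
            cohom_typing[OF a] cohom_typing[OF b]
      by (simp_all add: h(2) h'(2))
    then show "conv T X (und r1 \<cdot> (k \<cdot> a)) (und s1 \<cdot> (k' \<cdot> b)) = conv T X (und s1 \<cdot> (k'
        \<cdot> b)) (und r1 \<cdot> (k \<cdot> a))"
      using huq_elements[OF bihom_comp[OF m r(1)] bihom_comp[OF n s(1)] p px py cohom_comp[OF a
          bihom_cohom[OF h(1)]] cohom_comp[OF b bihom_cohom[OF h'(1)]]]
      by simp
  qed
  \<comment> \<open>The locale result speaks of arrows rebuilt from their underlying morphisms; this
    identifies them with the given legs.\<close>
  have "SArr (src f) (tgt f) (und f) = f" for f :: "(('o, 'm) bialgebra, 'm) struct_arr" by simp
  then show ?thesis
    using smith_centralize r s by metis
qed

end

theorem theorem4p6: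
  fixes C :: "('o, 'm) monoidal_category"
    and X :: "('o, 'm) bialgebra"
    and r0 r1 s0 s1 x y :: "(('o, 'm) bialgebra, 'm) struct_arr"
  assumes "symmetric_monoidal_category C"
    and "has_equalizers C"
    and "forget_preserves_monos C"
    and "S_coc_equivalence_relation C X r0 r1"
    and "S_coc_equivalence_relation C X s0 s1"
    and "is_normalization C r0 r1 x"
    and "is_normalization C s0 s1 y"
  shows "smith_centralize (BiAlg_coc C) r0 r1 s0 s1 \<longleftrightarrow> huq_commute C x y"
proof -
  interpret symmetric_monoidal_category C by fact
  obtain m n where m: "is_kernel C r0 m" "x = r1 \<cdot>\<^bsub>BiAlg_coc C\<^esub> m"
    and n: "is_kernel C s0 n" "y = s1 \<cdot>\<^bsub>BiAlg_coc C\<^esub> n"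
    using assms(6,7) by (auto simp: is_normalization_def)
  have "is_equivalence_relation (BiAlg_coc C) X r0 r1"
      "is_equivalence_relation (BiAlg_coc C) X s0 s1"
    using assms(4,5) by (simp_all add: S_coc_equivalence_relation_def)
  then show ?thesis
    unfolding m(2) n(2)
    using smith_imp_huq[OF _ _ m(1) n(1)] huq_imp_smith[OF assms(3,4,5) m(1) n(1)] by blast
qed

end
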